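(* Let $G$ be a group such that $\widetilde{NR}(G)=G$ and such that the upper radical series $1=R_0\subset R_1\subset R_2\subset\cdots$ of $G$ has finite length (i.e. $R_k=R_{k+1}=\widetilde R(G)$ for some natural number $k$). Then $\widetilde R(G)$ coincides with the set of all quasi-nil elements of $G$.
   Context: Words: $e_1(x,y)=[x,y]$ and $e_n(x,y)=[e_{n-1}(x,y),y]$ for $n\ge 2$, where $[x,y]$ denotes the group commutator (with one fixed standard convention, say $[x,y]=x^{-1}y^{-1}xy$). For positive integers $n_1,\dots,n_k$ define words $\varepsilon_{(n_1,\dots,n_k)}(x_1,\dots,x_k;y)$ inductively by $\varepsilon_{(n_1)}(x_1;y)=e_{n_1}(x_1,y)$ and $\varepsilon_{(n_1,\dots,n_k)}(x_1,\dots,x_k;y)=e_{n_k}\bigl(x_k,\varepsilon_{(n_1,\dots,n_{k-1})}(x_1,\dots,x_{k-1};y)\bigr)$. Quasi-nil elements: an element $g\in G$ is quasi-nil if there is $k=k(g)\ge 1$ such that for every sequence $(a_1,\dots,a_k)$ of elements of $G$ there is a compatible sequence $(n_1,\dots,n_k)$ of positive integers with $\varepsilon_{(n_1,\dots,n_k)}(a_1,\dots,a_k;g)=1$. Compatible means that each $n_i$ depends only on $a_1,\dots,a_i$ and $g$ and not on $a_{i+1},\dots,a_k$; that is, there are functions $N_i:G^i\to\mathbb{Z}_{\ge1}$, $i=1,\dots,k$, such that for all $(a_1,\dots,a_k)\in G^k$ the equality holds with $n_i=N_i(a_1,\dots,a_i)$. Radicals: a group is locally nilpotent (resp. locally noetherian)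 if each finitely generated subgroup is nilpotent (resp. noetherian, i.e. satisfies the maximal condition on subgroups). $R(G)=\mathrm{HP}(G)$ is the locally nilpotent radical, the subgroup generated by all locally nilpotent normal subgroups of $G$; $NR(G)$ is the locally noetherian radical, the subgroup generated by all locally noetherian normal subgroups of $G$. The upper radical series of $G$ is the ascending transfinite series $1=R_0\subset R_1\subset\cdots\subset R_\alpha\subset\cdots$ with $R_{\alpha+1}/R_\alpha=R(G/R_\alpha)$ and unions taken at limit ordinals; its terminal member is $\widetilde R(G)$. The upper radical $\widetilde{NR}(G)$ is obtained in the same way by transfinite iteration of $NR$ in place of $R$. *)

theory Defs
  imports "HOL-Algebra.Algebra"
begin

section \<open>Commutators, Engel words and quasi-nil elements\<close>

definition commutator :: "('a, 'b) monoid_scheme \<Rightarrow> 'a \<Rightarrow> 'a \<Rightarrow> 'a" where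
  "commutator G x y = inv\<^bsub>G\<^esub> x \<otimes>\<^bsub>G\<^esub> inv\<^bsub>G\<^esub> y \<otimes>\<^bsub>G\<^esub> x \<otimes>\<^bsub>G\<^esub> y"

text \<open>The recursion is started at \<open>e\<^sub>0(x, y) = x\<close>, so that \<open>e\<^sub>1(x, y) = [x, y]\<close>.\<close>

primrec engel_word :: "('a, 'b) monoid_scheme \<Rightarrow> nat \<Rightarrow> 'a \<Rightarrow> 'a \<Rightarrow> 'a" where
  "engel_word G 0 x y = x"
| "engel_word G (Suc n) x y = commutator G (engel_word G n x y) y"

text \<open>The value of the word \<open>\<epsilon>\<close> at the parameters \<open>n 0, \<dots>, n (k - 1)\<close> and the elements
  \<open>x 0, \<dots>, x (k - 1); y\<close>. Indices are shifted to start at 0, and the recursion starts at the empty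
  sequence, whose value is \<open>y\<close>.\<close>

primrec eps_word :: "('a, 'b) monoid_scheme \<Rightarrow> (nat \<Rightarrow> nat) \<Rightarrow> (nat \<Rightarrow> 'a) \<Rightarrow> 'a \<Rightarrow> nat \<Rightarrow> 'a" where
  "eps_word G n x y 0 = y"
| "eps_word G n x y (Suc i) = engel_word G (n i) (x i) (eps_word G n x y i)"

text \<open>The family of functions \<open>N\<^sub>i : G\<^sup>i \<rightarrow> {1, 2, \<dots>}\<close> is encoded as one function \<open>N\<close> on
  lists; its restriction to lists of length \<open>i\<close> is \<open>N\<^sub>i\<close>.\<close>

definition quasi_nil :: "('a, 'b) monoid_scheme \<Rightarrow> 'a \<Rightarrow> bool" where
  "quasi_nil G g \<longleftrightarrow>
     (\<exists>k\<ge>1. \<exists>N :: 'a list \<Rightarrow> nat. (\<forall>as\<in>lists (carrier G). 1 \<le> N as) \<and>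
        (\<forall>as\<in>lists (carrier G). length as = k \<longrightarrow>
           eps_word G (\<lambda>i. N (take (Suc i) as)) (\<lambda>i. as ! i) g k = \<one>\<^bsub>G\<^esub>))"

section \<open>Local properties and radicals\<close>

primrec lower_central :: "('a, 'b) monoid_scheme \<Rightarrow> nat \<Rightarrow> 'a set" where
  "lower_central G 0 = carrier G"
| "lower_central G (Suc n) =
     generate G {commutator G x y | x y. x \<in> lower_central G n \<and> y \<in> carrier G}"

definition nilpotent_group :: "('a, 'b) monoid_scheme \<Rightarrow> bool" where
  "nilpotent_group G \<longleftrightarrow> group G \<and> (\<exists>n. lower_central G n = {\<one>\<^bsub>G\<^esub>})"

definition noetherian_group :: "('a, 'b) monoid_scheme \<Rightarrow> bool" where
  "noetherian_group G \<longleftrightarrow> group G \<and>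
     (\<forall>\<S>. \<S> \<subseteq> {H. subgroup H G} \<and> \<S> \<noteq> {} \<longrightarrow> (\<exists>M\<in>\<S>. \<forall>H\<in>\<S>. M \<subseteq> H \<longrightarrow> H = M))"

definition locally_nilpotent :: "('a, 'b) monoid_scheme \<Rightarrow> bool" where
  "locally_nilpotent G \<longleftrightarrow> group G \<and>
     (\<forall>A. finite A \<and> A \<subseteq> carrier G \<longrightarrow> nilpotent_group (G\<lparr>carrier := generate G A\<rparr>))"

definition locally_noetherian :: "('a, 'b) monoid_scheme \<Rightarrow> bool" where
  "locally_noetherian G \<longleftrightarrow> group G \<and>
     (\<forall>A. finite A \<and> A \<subseteq> carrier G \<longrightarrow> noetherian_group (G\<lparr>carrier := generate G A\<rparr>))"

definition HP_radical :: "('a, 'b) monoid_scheme \<Rightarrow> 'a set" where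
  "HP_radical G = generate G (\<Union>{H. H \<lhd> G \<and> locally_nilpotent (G\<lparr>carrier := H\<rparr>)})"

definition NR_radical :: "('a, 'b) monoid_scheme \<Rightarrow> 'a set" where
  "NR_radical G = generate G (\<Union>{H. H \<lhd> G \<and> locally_noetherian (G\<lparr>carrier := H\<rparr>)})"

section \<open>Upper radical series\<close>

text \<open>For \<open>H\<close> normal in \<open>G\<close>, the subgroup \<open>K\<close> of \<open>G\<close> containing \<open>H\<close> with \<open>K/H = F (G/H)\<close>.\<close>

definition radical_step ::
  "('a set monoid \<Rightarrow> 'a set set) \<Rightarrow> ('a, 'b) monoid_scheme \<Rightarrow> 'a set \<Rightarrow> 'a set" where
  "radical_step F G H = {x \<in> carrier G. H #>\<^bsub>G\<^esub> x \<in> F (G Mod H)}"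

text \<open>The stages of the series for the radical \<open>F\<close>, indexed by the elements of a well-order \<open>r\<close>.
  The index \<open>i\<close> is the successor of \<open>j\<close> exactly if the strict predecessors of \<open>i\<close> are the elements
  below or equal to \<open>j\<close>. The cases are the least index, successors, and limits.\<close>

definition upper_series ::
  "('a set monoid \<Rightarrow> 'a set set) \<Rightarrow> ('a, 'b) monoid_scheme \<Rightarrow> 'i rel \<Rightarrow> 'i \<Rightarrow> 'a set" where
  "upper_series F G r = wfrec (r - Id) (\<lambda>S i.
     if underS r i = {} then {\<one>\<^bsub>G\<^esub>}
     else if \<exists>j. underS r i = under r j
       then radical_step F G (S (THE j. underS r i = under r j))
     else (\<Union>j\<in>underS r i. S j))"

text \<open>The terminal member of the series. There are more indices in the well-order
  \<open>card_of (Pow (carrier G))\<close> than elements of \<open>G\<close>, so that an ascending series of subsets of \<open>G\<close> indexed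
  by it becomes stationary; its last member is then the union of all members. This is the
  content of \<open>upper_radical_terminal\<close> below.\<close>

definition upper_radical ::
  "('a set monoid \<Rightarrow> 'a set set) \<Rightarrow> ('a, 'b) monoid_scheme \<Rightarrow> 'a set" where
  "upper_radical F G =
     (\<Union>i\<in>Field (card_of (Pow (carrier G))). upper_series F G (card_of (Pow (carrier G))) i)"

lemma under_eq_imp_eq:
  assumes "Well_order r" "i \<in> Field r" "underS r i = under r j" "underS r i = under r k"
    and "underS r i \<noteq> {}"
  shows "j = k"
proof -
  have 1: "Refl r" "antisym r" using assms(1)
    unfolding well_order_on_def linear_order_on_def partial_order_on_def preorder_on_def by auto
  have "j \<in> Field r" "k \<in> Field r"
    using assms(3-5) by (auto simp: under_def intro: FieldI2)
  then have "(j, k) \<in> r" "(k, j) \<in> r"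
    using 1(1) assms(3,4) unfolding under_def refl_on_def by blast+
  with 1(2) show ?thesis by (rule antisymD)
qed

lemma under_subset_underS:
  assumes "trans r" "antisym r" "i \<in> underS r j"
  shows "under r i \<subseteq> underS r j"
proof
  fix x assume "x \<in> under r i"
  then have xi: "(x, i) \<in> r" by (simp add: under_def)
  have ij: "(i, j) \<in> r" "i \<noteq> j" using assms(3) by (auto simp: underS_def)
  have "(x, j) \<in> r" using transD[OF assms(1) xi ij(1)] .
  moreover have "x \<noteq> j" using antisymD[OF assms(2) ij(1)] xi ij(2) by blast
  ultimately show "x \<in> underS r j" by (simp add: underS_def)
qed

lemma
  assumes r: "Well_order r" and i: "i \<in> Field r"
  shows upper_series_zero: "underS r i = {} \<Longrightarrow> upper_series F G r i = {\<one>\<^bsub>G\<^esub>}"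
    and upper_series_succ: "underS r i \<noteq> {} \<Longrightarrow> underS r i = under r j \<Longrightarrow>
      upper_series F G r i = radical_step F G (upper_series F G r j)"
    and upper_series_limit: "underS r i \<noteq> {} \<Longrightarrow> (\<nexists>j. underS r i = under r j) \<Longrightarrow>
      upper_series F G r i = (\<Union>j\<in>underS r i. upper_series F G r j)"
proof -
  have wf: "wf (r - Id)" using r unfolding well_order_on_def by auto
  note unfold = def_wfrec[OF eq_reflection[OF upper_series_def] wf, of F G i]
  show "underS r i = {} \<Longrightarrow> upper_series F G r i = {\<one>\<^bsub>G\<^esub>}"
    by (subst unfold) simp
  show "upper_series F G r i = radical_step F G (upper_series F G r j)"
    if ne: "underS r i \<noteq> {}" and j: "underS r i = under r j"
  proof -
    have the: "(THE j. underS r i = under r j) = j"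
      using j under_eq_imp_eq[OF r i _ j ne] by (rule the_equality)
    have "Refl r" using r
      unfolding well_order_on_def linear_order_on_def partial_order_on_def preorder_on_def by auto
    moreover have "j \<in> Field r" using ne j by (auto simp: under_def intro: FieldI2)
    ultimately have "j \<in> underS r i" using j by (auto simp: under_def refl_on_def)
    then have "(j, i) \<in> r - Id" by (auto simp: underS_def)
    then show ?thesis using ne j the by (subst unfold) (auto simp: cut_def)
  qed
  show "upper_series F G r i = (\<Union>j\<in>underS r i. upper_series F G r j)"
    if ne: "underS r i \<noteq> {}" and lim: "\<nexists>j. underS r i = under r j"
    using ne lim by (subst unfold) (auto simp: cut_def underS_def)
qed

lemma upper_series_nat:
  shows "upper_series F G natLeq 0 = {\<one>\<^bsub>G\<^esub>}"
    and "upper_series F G natLeq (Suc k) = radical_step F G (upper_series F G natLeq k)"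
proof -
  show "upper_series F G natLeq 0 = {\<one>\<^bsub>G\<^esub>}"
    by (rule upper_series_zero[OF natLeq_Well_order])
      (simp add: Field_natLeq, auto simp: underS_def natLeq_def)
  show "upper_series F G natLeq (Suc k) = radical_step F G (upper_series F G natLeq k)"
    by (rule upper_series_succ[OF natLeq_Well_order])
      (simp add: Field_natLeq, auto simp: underS_def under_def natLeq_def)
qed

lemma upper_radical_terminal:
  fixes G :: "('a, 'b) monoid_scheme"
  defines "r \<equiv> card_of (Pow (carrier G))"
  assumes inc: "\<And>i. i \<in> Field r \<Longrightarrow>
    upper_series F G r i \<subseteq> radical_step F G (upper_series F G r i)"
    and one: "\<one>\<^bsub>G\<^esub> \<in> carrier G"
  shows "\<exists>i\<in>Field r. upper_radical F G = upper_series F G r i"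
    and "radical_step F G (upper_radical F G) = upper_radical F G"
proof -
  let ?S = "upper_series F G r"
  let ?f = "radical_step F G"
  have r: "Well_order r" unfolding r_def by simp
  have wf: "wf (r - Id)" using r unfolding well_order_on_def by auto
  have po: "Refl r" "trans r" "antisym r" "Total r" using r
    unfolding well_order_on_def linear_order_on_def partial_order_on_def preorder_on_def by auto
  have one_in: "\<one>\<^bsub>G\<^esub> \<in> ?S i" if "i \<in> Field r" for i
    using that
  proof (induction i rule: wf_induct_rule[OF wf])
    case (1 i)
    have IH: "\<one>\<^bsub>G\<^esub> \<in> ?S j" if "j \<in> underS r i" for j
      using 1(1)[of j] that by (auto simp: underS_def intro: FieldI1)
    show ?case
    proof (cases "underS r i = {}")
      case True
      then show ?thesis using upper_series_zero[OF r 1(2) True, of F G] by simp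
    next
      case ne: False
      show ?thesis
      proof (cases "\<exists>j. underS r i = under r j")
        case True
        then obtain j where j: "underS r i = under r j" by blast
        then have F: "j \<in> Field r" using ne by (auto simp: under_def intro: FieldI2)
        then have "j \<in> underS r i" using j po(1) by (auto simp: under_def refl_on_def)
        then show ?thesis using IH inc[OF F] upper_series_succ[OF r 1(2) ne j, of F G] by blast
      next
        case False
        then show ?thesis using IH ne upper_series_limit[OF r 1(2) ne False, of F G] by blast
      qed
    qed
  qed
  have step: "?f (?S i) \<subseteq> ?S j" if "j \<in> Field r" "i \<in> underS r j" for i j
    using that
  proof (induction j arbitrary: i rule: wf_induct_rule[OF wf])
    case (1 j)
    have iF: "i \<in> Field r" using 1(3) by (auto simp: underS_def intro: FieldI1)
    have ne: "underS r j \<noteq> {}" using 1(3) by auto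
    have IH: "?f (?S a) \<subseteq> ?S m" if "m \<in> underS r j" "a \<in> underS r m" for a m
      using 1(1)[of m a] that by (auto simp: underS_def intro: FieldI1)
    show ?case
    proof (cases "\<exists>m. underS r j = under r m")
      case True
      then obtain m where m: "underS r j = under r m" by blast
      then have F: "m \<in> Field r" using ne by (auto simp: under_def intro: FieldI2)
      then have mj: "m \<in> underS r j" using m po(1) by (auto simp: under_def refl_on_def)
      have Sj: "?S j = ?f (?S m)" using upper_series_succ[OF r 1(2) ne m] .
      show ?thesis
      proof (cases "i = m")
        case True
        then show ?thesis using Sj by simp
      next
        case False
        then have "i \<in> underS r m" using 1(3) m by (auto simp: under_def underS_def)
        from IH[OF mj this] show ?thesis using inc[OF F] Sj by blast
      qed
    next
      case False
      then have "\<not> underS r j \<subseteq> under r i"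
        using under_subset_underS[OF po(2,3) 1(3)] False by blast
      then obtain m where m: "m \<in> underS r j" "m \<notin> under r i" by blast
      then have "m \<in> Field r" by (auto simp: underS_def intro: FieldI1)
      then have "i \<in> underS r m"
        using m(2) po(1,4) iF unfolding under_def underS_def total_on_def refl_on_def
        by (cases "m = i") auto
      then show ?thesis using IH m(1) upper_series_limit[OF r 1(2) ne False, of F G] by blast
    qed
  qed
  have ex: "\<exists>i\<in>Field r. ?f (?S i) = ?S i"
  proof (rule ccontr)
    assume "\<not> ?thesis"
    then have "\<forall>i\<in>Field r. \<exists>x. x \<in> ?f (?S i) \<and> x \<notin> ?S i" using inc by blast
    then obtain g where g: "\<And>i. i \<in> Field r \<Longrightarrow> g i \<in> ?f (?S i) \<and> g i \<notin> ?S i" by metis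
    have ne: "g i \<noteq> g j" if "i \<in> Field r" "j \<in> Field r" "i \<in> underS r j" for i j
      using step[OF that(2,3)] g[OF that(1)] g[OF that(2)] by auto
    have "inj_on g (Field r)"
    proof (rule inj_onI, rule ccontr)
      fix i j assume ij: "i \<in> Field r" "j \<in> Field r" "g i = g j" "i \<noteq> j"
      then have "i \<in> underS r j \<or> j \<in> underS r i"
        using po(4) unfolding underS_def total_on_def by auto
      then show False using ne ij by metis
    qed
    moreover have "g ` Field r \<subseteq> carrier G" using g by (auto simp: radical_step_def)
    moreover have "Field r = Pow (carrier G)" unfolding r_def by simp
    ultimately have "inj_on g (Pow (carrier G))" "g ` Pow (carrier G) \<subseteq> carrier G" by auto
    then show False
      using card_of_ordLeqI[of g "Pow (carrier G)" "carrier G"] card_of_Pow[of "carrier G"]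
        not_ordLess_ordLeq by blast
  qed
  then obtain i where i: "i \<in> Field r" "?f (?S i) = ?S i" by blast
  have "?S j \<subseteq> ?S i" if jF: "j \<in> Field r" for j
    using that
  proof (induction j rule: wf_induct_rule[OF wf])
    case (1 j)
    have IH: "?S m \<subseteq> ?S i" if "m \<in> underS r j" for m
      using 1(1)[of m] that by (auto simp: underS_def intro: FieldI1)
    show ?case
    proof (cases "underS r j = {}")
      case True
      then show ?thesis using upper_series_zero[OF r 1(2) True, of F G] one_in[OF i(1)] by auto
    next
      case ne: False
      show ?thesis
      proof (cases "\<exists>m. underS r j = under r m")
        case True
        then obtain m where m: "underS r j = under r m" by blast
        then have F: "m \<in> Field r" using ne by (auto simp: under_def intro: FieldI2)
        then have mj: "m \<in> underS r j" using m po(1) by (auto simp: under_def refl_on_def)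
        have Sj: "?S j = ?f (?S m)" using upper_series_succ[OF r 1(2) ne m] .
        consider "m \<in> underS r i" | "m = i" | "i \<in> underS r m"
          using po(4) F i(1) unfolding underS_def total_on_def by auto
        then show ?thesis
        proof cases
          case 1
          then show ?thesis using step[OF i(1)] Sj by blast
        next
          case 2
          then show ?thesis using Sj i(2) by simp
        next
          case 3
          then have "?S i \<subseteq> ?S m" using step[OF F 3] i(2) by simp
          then have "?S m = ?S i" using IH[OF mj] by blast
          then show ?thesis using Sj i(2) by simp
        qed
      next
        case False
        then show ?thesis using IH upper_series_limit[OF r 1(2) ne False, of F G] by blast
      qed
    qed
  qed
  then have eq: "upper_radical F G = ?S i"
    using i(1) unfolding upper_radical_def r_def by blast
  then show "\<exists>i\<in>Field r. upper_radical F G = upper_series F G r i" using i(1) by blast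
  show "radical_step F G (upper_radical F G) = upper_radical F G" using eq i(2) by simp
qed

end

theory Submission
  imports Defs
begin

text \<open>
  Unravelling the compatibility condition, \<open>g\<close> is quasi-nil with parameter \<open>k + 1\<close> iff for every
  \<open>a\<close> some \<open>e\<^sub>n(a, g)\<close> with \<open>n \<ge> 1\<close> is quasi-nil with parameter \<open>k\<close>, where only \<open>1\<close> has
  parameter \<open>0\<close>.

  By the Hirsch-Plotkin theorem \<open>R(G)\<close> is locally nilpotent, so for \<open>g\<close> in the \<open>(k + 1)\<close>-st
  member \<open>R\<^sub>k\<^sub>+\<^sub>1\<close> of the radical series some \<open>e\<^sub>n(a, g)\<close> lies in \<open>R\<^sub>k\<close>; hence members of \<open>R\<^sub>k\<close>
  are quasi-nil.

  Conversely, by induction on the parameter, a quasi-nil element becomes a left Engel element of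
  \<open>\<Gamma> = G/R\<close>, where \<open>R\<close> is the upper radical of \<open>G\<close>, so \<open>R(\<Gamma>) = 1\<close>. One shows by transfinite
  induction that the Engel elements of \<open>\<Gamma>\<close> centralize the image of every member of the
  \<open>NR\<close>-series of \<open>G\<close>. They are therefore central, and the center of \<open>\<Gamma>\<close> is trivial. The
  induction rests on Baer's theorem that the normal closure of a left Engel element of a
  noetherian group is nilpotent.\<close>

section \<open>Normalizing elements and commutators\<close>

text \<open>Division by R makes Engel elements rigid: an abelian normal subgroup of \<Gamma> is
  locally nilpotent, hence trivial, so every normal subgroup of \<Gamma> meets its centralizer
  trivially. Finite length matters because parameters are natural numbers: R is a single R_k with
  R(\<Gamma>) = 1.

  The obstacle is that Baer's theorem speaks of noetherian groups, while H is only locally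
  noetherian and g need not lie in it. For H normal in \<Gamma> the theorem is applied to the span
  of g and B, with B a finite subset of H whose span g normalizes. The conjugates of g under H then
  generate a locally nilpotent T; T \<inter> H is normal in H and therefore trivial, and [h, g] =
  (g^h)^(-1) g lies in it.

  A step of the NR-series over a stage M is only generated by pieces H/M that are locally
  noetherian. Since the elements commuting with all Engel elements form a subgroup, each piece may
  be treated alone. The stages are taken in G, where the hypothesis holds, and compared through
  their images in \<Gamma>.\<close>

definition normalizing :: "('a, 'b) monoid_scheme \<Rightarrow> 'a set \<Rightarrow> 'a set" where
  "normalizing G H = {g \<in> carrier G. \<forall>h\<in>H.
     inv\<^bsub>G\<^esub> g \<otimes>\<^bsub>G\<^esub> h \<otimes>\<^bsub>G\<^esub> g \<in> H \<and> g \<otimes>\<^bsub>G\<^esub> h \<otimes>\<^bsub>G\<^esub> inv\<^bsub>G\<^esub> g \<in> H}"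

context group
begin

lemma inv_mult_cancel [simp]:
  assumes "x \<in> carrier G" "y \<in> carrier G"
  shows "inv x \<otimes> (x \<otimes> y) = y" "x \<otimes> (inv x \<otimes> y) = y"
  using assms by (simp_all add: m_assoc[symmetric])

lemmas word = m_assoc inv_mult_group commutator_def

lemma commutator_closed [simp, intro]:
  "x \<in> carrier G \<Longrightarrow> y \<in> carrier G \<Longrightarrow> commutator G x y \<in> carrier G"
  by (simp add: commutator_def)

lemma inv_commutator:
  "x \<in> carrier G \<Longrightarrow> y \<in> carrier G \<Longrightarrow> inv (commutator G x y) = commutator G y x"
  by (simp add: word)

lemma commutator_eq_one_iff:
  assumes "x \<in> carrier G" "y \<in> carrier G"
  shows "commutator G x y = \<one> \<longleftrightarrow> x \<otimes> y = y \<otimes> x"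
proof -
  have "commutator G x y = inv (y \<otimes> x) \<otimes> (x \<otimes> y)"
    using assms by (simp add: word)
  then show ?thesis
    using assms by (metis inv_closed inv_equality inv_inv l_inv m_closed)
qed

lemma subgroup_commutator:
  "subgroup H G \<Longrightarrow> x \<in> H \<Longrightarrow> y \<in> H \<Longrightarrow> commutator G x y \<in> H"
  by (simp add: commutator_def subgroup.m_closed subgroup.m_inv_closed)

lemma normalizingI:
  assumes "g \<in> carrier G" "\<And>h. h \<in> H \<Longrightarrow> inv g \<otimes> h \<otimes> g \<in> H"
    "\<And>h. h \<in> H \<Longrightarrow> g \<otimes> h \<otimes> inv g \<in> H"
  shows "g \<in> normalizing G H"
  using assms by (simp add: normalizing_def)

lemma normalizingD:
  assumes "g \<in> normalizing G H" "h \<in> H"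
  shows "inv g \<otimes> h \<otimes> g \<in> H" "g \<otimes> h \<otimes> inv g \<in> H"
  using assms by (simp_all add: normalizing_def)

lemma normalizing_subset: "normalizing G H \<subseteq> carrier G"
  by (auto simp: normalizing_def)

text \<open>Conjugation in both directions occurs in \<open>normalizing\<close> because for infinite
  H the inclusion of H^g in H may be proper; requiring both gives closure under inverses.\<close>

lemma subgroup_normalizing:
  assumes H: "H \<subseteq> carrier G"
  shows "subgroup (normalizing G H) G"
proof (rule subgroupI)
  show "normalizing G H \<subseteq> carrier G" by (rule normalizing_subset)
  have "\<one> \<in> normalizing G H"
    using H by (auto intro!: normalizingI)
  then show "normalizing G H \<noteq> {}" by blast
next
  fix a assume "a \<in> normalizing G H"
  then show "inv a \<in> normalizing G H" by (auto simp: normalizing_def)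
next
  fix a b assume a: "a \<in> normalizing G H" and b: "b \<in> normalizing G H"
  have c: "a \<in> carrier G" "b \<in> carrier G" using a b normalizing_subset by auto
  show "a \<otimes> b \<in> normalizing G H"
  proof (rule normalizingI)
    fix h assume h: "h \<in> H"
    then have hc: "h \<in> carrier G" using H by auto
    show "inv (a \<otimes> b) \<otimes> h \<otimes> (a \<otimes> b) \<in> H"
      using normalizingD(1)[OF b normalizingD(1)[OF a h]] c hc by (simp add: word)
    show "a \<otimes> b \<otimes> h \<otimes> inv (a \<otimes> b) \<in> H"
      using normalizingD(2)[OF a normalizingD(2)[OF b h]] c hc by (simp add: word)
  qed (use c in simp)
qed

lemma subgroup_le_normalizing: "subgroup H G \<Longrightarrow> H \<subseteq> normalizing G H"
  by (auto intro!: normalizingI simp: subgroup.m_closed subgroup.m_inv_closed subgroup.mem_carrier)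

lemma normal_iff_normalizing: "H \<lhd> G \<longleftrightarrow> subgroup H G \<and> carrier G \<subseteq> normalizing G H"
proof
  assume H: "H \<lhd> G"
  then show "subgroup H G \<and> carrier G \<subseteq> normalizing G H"
    by (auto intro!: normalizingI simp: normal_imp_subgroup normal.inv_op_closed1 normal.inv_op_closed2)
next
  assume "subgroup H G \<and> carrier G \<subseteq> normalizing G H"
  then show "H \<lhd> G"
    unfolding normal_inv_iff by (auto dest: normalizingD)
qed

lemma conj_generate:
  assumes A: "A \<subseteq> carrier G" and S: "subgroup S G" and g: "g \<in> carrier G"
    and gA: "\<And>a. a \<in> A \<Longrightarrow> inv g \<otimes> a \<otimes> g \<in> S" and x: "x \<in> generate G A"
  shows "inv g \<otimes> x \<otimes> g \<in> S"
  using x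
proof (induction rule: generate.induct)
  case one
  then show ?case using g S by (simp add: subgroup.one_closed)
next
  case (incl h)
  then show ?case by (rule gA)
next
  case (inv h)
  then have "inv (inv g \<otimes> h \<otimes> g) \<in> S" "h \<in> carrier G"
    using gA S A subgroup.m_inv_closed by fastforce+
  then show ?case using g by (simp add: word)
next
  case (eng a b)
  then have "a \<in> carrier G" "b \<in> carrier G" using generate_in_carrier[OF A] by auto
  moreover have "(inv g \<otimes> a \<otimes> g) \<otimes> (inv g \<otimes> b \<otimes> g) \<in> S"
    using eng S by (simp add: subgroup.m_closed)
  ultimately show ?case using g by (simp add: word)
qed

lemma normalizing_generate:
  assumes A: "A \<subseteq> carrier G" and g: "g \<in> carrier G"
    and 1: "\<And>a. a \<in> A \<Longrightarrow> inv g \<otimes> a \<otimes> g \<in> generate G A"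
    and 2: "\<And>a. a \<in> A \<Longrightarrow> g \<otimes> a \<otimes> inv g \<in> generate G A"
  shows "g \<in> normalizing G (generate G A)"
proof (rule normalizingI[OF g])
  fix h assume h: "h \<in> generate G A"
  show "inv g \<otimes> h \<otimes> g \<in> generate G A"
    by (rule conj_generate[OF A generate_is_subgroup[OF A] g 1 h])
  show "g \<otimes> h \<otimes> inv g \<in> generate G A"
    using conj_generate[OF A generate_is_subgroup[OF A] inv_closed[OF g] _ h] 2 g by simp
qed

lemma generate_le_normalizing:
  assumes "A \<subseteq> normalizing G H" "H \<subseteq> carrier G"
  shows "generate G A \<subseteq> normalizing G H"
  using generate_subgroup_incl[OF assms(1) subgroup_normalizing[OF assms(2)]] .

lemma generate_generate_eqI:
  assumes "A \<subseteq> generate G B" "B \<subseteq> generate G A" "A \<subseteq> carrier G" "B \<subseteq> carrier G"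
  shows "generate G A = generate G B"
  using generate_subgroup_incl[OF assms(1) generate_is_subgroup[OF assms(4)]]
    generate_subgroup_incl[OF assms(2) generate_is_subgroup[OF assms(3)]] by auto

text \<open>The identities [u, h^(-1)] = h [u, h]^(-1) h^(-1) and [u, ab] = [u, b] b^(-1) [u, a] b
  reduce commutators with words to commutators with generators, provided these normalize Y. With Y a
  term of an upper central series this is the device for placing u one term higher.\<close>

lemma commutator_generate:
  assumes A: "A \<subseteq> carrier G" and Y: "subgroup Y G" and u: "u \<in> carrier G"
    and AY: "A \<subseteq> normalizing G Y"
    and comm: "\<And>a. a \<in> A \<Longrightarrow> commutator G u a \<in> Y" and w: "w \<in> generate G A"
  shows "commutator G u w \<in> Y"
  using w
proof (induction rule: generate.induct)
  case one
  then show ?case using u Y by (simp add: word subgroup.one_closed)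
next
  case (incl h)
  then show ?case by (rule comm)
next
  case (inv h)
  then have h: "h \<in> carrier G" "h \<in> normalizing G Y" using A AY by auto
  have "h \<otimes> inv (commutator G u h) \<otimes> inv h \<in> Y"
    using normalizingD(2)[OF h(2)] comm[OF inv] Y by (simp add: subgroup.m_inv_closed)
  then show ?case using h u by (simp add: word)
next
  case (eng a b)
  then have ab: "a \<in> carrier G" "b \<in> carrier G" using generate_in_carrier[OF A] by auto
  have "b \<in> normalizing G Y"
    using eng generate_le_normalizing[OF AY subgroup.subset[OF Y]] by auto
  then have "commutator G u b \<otimes> (inv b \<otimes> commutator G u a \<otimes> b) \<in> Y"
    using eng Y by (simp add: normalizingD subgroup.m_closed)
  then show ?case using ab u by (simp add: word)
qed

lemma commutator_in_normalized:
  assumes S: "subgroup S G" and "u \<in> S" "a \<in> normalizing G S"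
  shows "commutator G u a \<in> S"
proof -
  have "inv u \<otimes> (inv a \<otimes> u \<otimes> a) \<in> S"
    using assms normalizingD(1) by (simp add: subgroup.m_closed subgroup.m_inv_closed)
  then show ?thesis
    using assms subgroup.mem_carrier[OF S] normalizing_subset by (auto simp: word subset_iff)
qed

text \<open>A word mentions only finitely many elements of S. Local properties of a span can thus be
  tested on finitely many generators of a prescribed shape.\<close>

lemma finite_in_generate:
  assumes "finite A" "A \<subseteq> generate G S"
  obtains F where "finite F" "F \<subseteq> S" "A \<subseteq> generate G F"
proof -
  have single: "\<exists>F. finite F \<and> F \<subseteq> S \<and> a \<in> generate G F" if "a \<in> generate G S" for a
    using that
  proof (induction rule: generate.induct)
    case one
    then show ?case by (intro exI[of _ "{}"]) (simp add: generate.one)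
  next
    case (incl h)
    then show ?case by (intro exI[of _ "{h}"]) (simp add: generate.incl)
  next
    case (inv h)
    then show ?case by (intro exI[of _ "{h}"]) (simp add: generate.inv)
  next
    case (eng a b)
    then obtain F1 F2 where F: "finite F1" "F1 \<subseteq> S" "a \<in> generate G F1"
      "finite F2" "F2 \<subseteq> S" "b \<in> generate G F2" by auto
    then have "a \<in> generate G (F1 \<union> F2)" "b \<in> generate G (F1 \<union> F2)"
      using mono_generate[of F1 "F1 \<union> F2"] mono_generate[of F2 "F1 \<union> F2"] by auto
    then show ?case using F by (intro exI[of _ "F1 \<union> F2"]) (simp add: generate.eng)
  qed
  have "\<exists>F. finite F \<and> F \<subseteq> S \<and> A \<subseteq> generate G F"
    using assms
  proof (induction rule: finite_induct)
    case empty
    then show ?case by blast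
  next
    case (insert a A)
    then obtain F1 F2 where F: "finite F1" "F1 \<subseteq> S" "a \<in> generate G F1"
      "finite F2" "F2 \<subseteq> S" "A \<subseteq> generate G F2" using single[of a] by auto
    then have "insert a A \<subseteq> generate G (F1 \<union> F2)"
      using mono_generate[of F1 "F1 \<union> F2"] mono_generate[of F2 "F1 \<union> F2"] by auto
    then show ?case using F by (intro exI[of _ "F1 \<union> F2"]) simp
  qed
  then show thesis using that by blast
qed

end

section \<open>Nilpotent subgroups\<close>

text \<open>The upper central series of the subgroup H, computed inside G, so that the series of
  different subgroups can be compared without changing the group record. Its terms, unlike those of
  the lower series, are described elementwise.\<close>

primrec upper_central :: "('a, 'b) monoid_scheme \<Rightarrow> 'a set \<Rightarrow> nat \<Rightarrow> 'a set" where
  "upper_central G H 0 = {\<one>\<^bsub>G\<^esub>}"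
| "upper_central G H (Suc n) = {z \<in> H. \<forall>x\<in>H. commutator G z x \<in> upper_central G H n}"

definition nilpotent_subgroup :: "('a, 'b) monoid_scheme \<Rightarrow> 'a set \<Rightarrow> bool" where
  "nilpotent_subgroup G H \<longleftrightarrow> subgroup H G \<and> (\<exists>n. H \<subseteq> upper_central G H n)"

definition locally_nilpotent_subgroup :: "('a, 'b) monoid_scheme \<Rightarrow> 'a set \<Rightarrow> bool" where
  "locally_nilpotent_subgroup G H \<longleftrightarrow>
     subgroup H G \<and> (\<forall>A. finite A \<and> A \<subseteq> H \<longrightarrow> nilpotent_subgroup G (generate G A))"

context group
begin

lemma upper_central_subset: "subgroup H G \<Longrightarrow> upper_central G H n \<subseteq> H"
  by (cases n) (auto simp: subgroup.one_closed)

text \<open>Conjugation by g is an automorphism of H: [z^g, x] is the conjugate by g of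
  [z, g x g^(-1)].\<close>

lemma normalizing_upper_central:
  assumes H: "subgroup H G"
  shows "normalizing G H \<subseteq> normalizing G (upper_central G H n)"
proof (induction n)
  case 0
  show ?case using normalizing_subset by (auto simp: normalizing_def)
next
  case (Suc n)
  have conj: "inv g \<otimes> z \<otimes> g \<in> upper_central G H (Suc n)"
    if g: "g \<in> normalizing G H" and z: "z \<in> upper_central G H (Suc n)" for g z
  proof -
    have zc: "z \<in> H" "z \<in> carrier G" "g \<in> carrier G"
      using z g H normalizing_subset subgroup.mem_carrier by auto
    have "commutator G (inv g \<otimes> z \<otimes> g) x \<in> upper_central G H n" if x: "x \<in> H" for x
    proof -
      have "inv g \<otimes> commutator G z (g \<otimes> x \<otimes> inv g) \<otimes> g \<in> upper_central G H n"
        using z normalizingD[OF g x] Suc g normalizingD(1) by auto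
      then show ?thesis using zc x subgroup.mem_carrier[OF H] by (simp add: word)
    qed
    then show ?thesis using normalizingD(1)[OF g zc(1)] by simp
  qed
  show ?case
  proof
    fix g assume g: "g \<in> normalizing G H"
    then have gc: "g \<in> carrier G" using normalizing_subset by auto
    have "inv g \<in> normalizing G H"
      using g H by (simp add: subgroup.m_inv_closed subgroup_normalizing subgroup.subset)
    from conj[OF this] show "g \<in> normalizing G (upper_central G H (Suc n))"
      using gc conj[OF g] by (intro normalizingI) auto
  qed
qed

text \<open>From [ab, x] = b^(-1) [a, x] b [b, x] and [a^(-1), x] = a [a, x]^(-1) a^(-1); the
  conjugations stay inside the previous term because H normalizes it.\<close>

lemma subgroup_upper_central:
  assumes H: "subgroup H G"
  shows "subgroup (upper_central G H n) G"
proof (induction n)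
  case 0
  show ?case by (simp add: triv_subgroup)
next
  case (Suc n)
  let ?Z = "upper_central G H n"
  have N: "H \<subseteq> normalizing G ?Z"
    using subgroup_le_normalizing[OF H] normalizing_upper_central[OF H] by blast
  note Hc = subgroup.mem_carrier[OF H]
  show ?case
  proof (rule subgroupI)
    show "upper_central G H (Suc n) \<subseteq> carrier G"
      using upper_central_subset[OF H] subgroup.subset[OF H] by blast
    have "\<one> \<in> upper_central G H (Suc n)"
      using Suc H Hc by (auto simp: subgroup.one_closed word)
    then show "upper_central G H (Suc n) \<noteq> {}" by blast
  next
    fix a assume a: "a \<in> upper_central G H (Suc n)"
    have "commutator G (inv a) x \<in> ?Z" if x: "x \<in> H" for x
    proof -
      have "inv (commutator G a x) \<in> ?Z" using a x Suc by (simp add: subgroup.m_inv_closed)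
      then have "a \<otimes> inv (commutator G a x) \<otimes> inv a \<in> ?Z"
        using a N normalizingD(2) by auto
      then show ?thesis using a x Hc by (simp add: word)
    qed
    then show "inv a \<in> upper_central G H (Suc n)"
      using a H by (simp add: subgroup.m_inv_closed)
  next
    fix a b assume a: "a \<in> upper_central G H (Suc n)" and b: "b \<in> upper_central G H (Suc n)"
    have "commutator G (a \<otimes> b) x \<in> ?Z" if x: "x \<in> H" for x
    proof -
      have "inv b \<otimes> commutator G a x \<otimes> b \<in> ?Z"
        using a b x N normalizingD(1) by auto
      then have "inv b \<otimes> commutator G a x \<otimes> b \<otimes> commutator G b x \<in> ?Z"
        using b x Suc by (simp add: subgroup.m_closed)
      then show ?thesis using a b x Hc by (simp add: word)
    qed
    then show "a \<otimes> b \<in> upper_central G H (Suc n)"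
      using a b H by (simp add: subgroup.m_closed)
  qed
qed

lemma upper_central_Suc:
  assumes H: "subgroup H G"
  shows "upper_central G H n \<subseteq> upper_central G H (Suc n)"
proof
  fix z assume z: "z \<in> upper_central G H n"
  then have zH: "z \<in> H" using upper_central_subset[OF H] by auto
  have "commutator G z x \<in> upper_central G H n" if x: "x \<in> H" for x
  proof -
    have "x \<in> normalizing G (upper_central G H n)"
      using x subgroup_le_normalizing[OF H] normalizing_upper_central[OF H] by blast
    then have "inv z \<otimes> (inv x \<otimes> z \<otimes> x) \<in> upper_central G H n"
      using z subgroup_upper_central[OF H, of n]
      by (simp add: subgroup.m_closed subgroup.m_inv_closed normalizingD)
    then show ?thesis using x zH subgroup.mem_carrier[OF H] by (simp add: word)
  qed
  then show "z \<in> upper_central G H (Suc n)" using zH by simp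
qed

lemma upper_central_mono:
  "subgroup H G \<Longrightarrow> m \<le> n \<Longrightarrow> upper_central G H m \<subseteq> upper_central G H n"
  by (rule lift_Suc_mono_le[of "upper_central G H"]) (auto simp del: upper_central.simps dest: upper_central_Suc)

text \<open>By induction Z_n(H) \<inter> K lies in Z_n(K).\<close>

lemma nilpotent_subgroup_mono:
  assumes "nilpotent_subgroup G H" "subgroup K G" "K \<subseteq> H"
  shows "nilpotent_subgroup G K"
proof -
  have "upper_central G H n \<inter> K \<subseteq> upper_central G K n" for n
  proof (induction n)
    case (Suc n)
    then show ?case using assms(2,3) subgroup_commutator[of K] by simp blast
  qed simp
  moreover obtain n where "H \<subseteq> upper_central G H n"
    using assms(1) by (auto simp: nilpotent_subgroup_def)
  ultimately show ?thesis using assms(2,3) unfolding nilpotent_subgroup_def by blast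
qed

lemma nilpotent_subgroupD: "nilpotent_subgroup G H \<Longrightarrow> subgroup H G"
  by (simp add: nilpotent_subgroup_def)

lemma locally_nilpotent_subgroupD: "locally_nilpotent_subgroup G H \<Longrightarrow> subgroup H G"
  by (simp add: locally_nilpotent_subgroup_def)

lemma locally_nilpotent_subgroup_mono:
  "locally_nilpotent_subgroup G H \<Longrightarrow> subgroup K G \<Longrightarrow> K \<subseteq> H \<Longrightarrow> locally_nilpotent_subgroup G K"
  unfolding locally_nilpotent_subgroup_def by blast

lemma nilpotent_imp_locally_nilpotent_subgroup:
  "nilpotent_subgroup G H \<Longrightarrow> locally_nilpotent_subgroup G H"
  unfolding locally_nilpotent_subgroup_def
  by (meson dual_order.trans generate_is_subgroup generate_subgroup_incl nilpotent_subgroupD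
      nilpotent_subgroup_mono subgroup.subset)

lemma commuting_nilpotent_subgroup:
  assumes H: "subgroup H G" and "\<And>x y. x \<in> H \<Longrightarrow> y \<in> H \<Longrightarrow> x \<otimes> y = y \<otimes> x"
  shows "nilpotent_subgroup G H"
proof -
  have "H \<subseteq> upper_central G H 1"
    using assms subgroup.mem_carrier[OF H] by (auto simp: commutator_eq_one_iff)
  then show ?thesis using H unfolding nilpotent_subgroup_def by blast
qed

text \<open>The two series are compared from opposite ends: the i-th lower term lies in Z_(n-i).
  With the dual inclusion in \<open>lower_central_eq_one_imp_upper_central\<close> this links
  nilpotency as defined by the lower series to the form used in the proofs.\<close>

lemma upper_central_eq_carrier_imp_lower_central:
  assumes "carrier G \<subseteq> upper_central G (carrier G) n"
  shows "lower_central G n = {\<one>}"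
proof -
  let ?Z = "upper_central G (carrier G)"
  have "i \<le> n \<Longrightarrow> lower_central G i \<subseteq> ?Z (n - i)" for i
  proof (induction i)
    case 0
    then show ?case using assms by simp
  next
    case (Suc i)
    then have "n - i = Suc (n - Suc i)" by simp
    then have "lower_central G i \<subseteq> ?Z (Suc (n - Suc i))" using Suc by simp
    then have "{commutator G x y | x y. x \<in> lower_central G i \<and> y \<in> carrier G} \<subseteq> ?Z (n - Suc i)"
      by auto
    then show ?case
      using subgroup_upper_central[OF subgroup_self] by (simp add: generate_subgroup_incl)
  qed
  from this[of n] have "lower_central G n \<subseteq> {\<one>}" by simp
  moreover have "\<one> \<in> lower_central G n" by (cases n) (simp_all add: generate.one)
  ultimately show ?thesis by blast
qed

lemma lower_central_subset: "lower_central G n \<subseteq> carrier G"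
proof (induction n)
  case (Suc n)
  then show ?case by (simp, intro generate_incl) auto
qed simp

lemma lower_central_eq_one_imp_upper_central:
  assumes n: "lower_central G n = {\<one>}"
  shows "carrier G \<subseteq> upper_central G (carrier G) n"
proof -
  have "i \<le> n \<Longrightarrow> lower_central G (n - i) \<subseteq> upper_central G (carrier G) i" for i
  proof (induction i)
    case 0
    then show ?case using n by simp
  next
    case (Suc i)
    then have *: "lower_central G (Suc (n - Suc i)) \<subseteq> upper_central G (carrier G) i"
      by (simp add: Suc_diff_Suc del: lower_central.simps)
    have "commutator G z x \<in> upper_central G (carrier G) i"
      if "z \<in> lower_central G (n - Suc i)" "x \<in> carrier G" for z x
    proof -
      have "commutator G z x \<in> lower_central G (Suc (n - Suc i))"
        using that by (auto intro: generate.incl)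
      then show ?thesis using * by blast
    qed
    then show ?case using lower_central_subset by auto
  qed
  from this[of n] show ?thesis by simp
qed

lemma nilpotent_group_iff: "nilpotent_group G \<longleftrightarrow> nilpotent_subgroup G (carrier G)"
  unfolding nilpotent_group_def nilpotent_subgroup_def
  using upper_central_eq_carrier_imp_lower_central lower_central_eq_one_imp_upper_central
    is_group subgroup_self by blast

lemma commutator_consistent:
  assumes "subgroup H G" "x \<in> H" "y \<in> H"
  shows "commutator (G\<lparr>carrier := H\<rparr>) x y = commutator G x y"
  using assms by (simp add: commutator_def)

lemma nilpotent_group_subgroup_iff:
  assumes H: "subgroup H G"
  shows "nilpotent_group (G\<lparr>carrier := H\<rparr>) \<longleftrightarrow> nilpotent_subgroup G H"
proof -
  interpret H: group "G\<lparr>carrier := H\<rparr>" by (rule subgroup_imp_group[OF H])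
  have "upper_central (G\<lparr>carrier := H\<rparr>) H n = upper_central G H n" for n
    by (induction n) (auto simp: commutator_consistent[OF H])
  then show ?thesis
    unfolding H.nilpotent_group_iff nilpotent_subgroup_def
    using H H.subgroup_self by simp
qed

lemma locally_nilpotent_subgroup_iff:
  assumes H: "subgroup H G"
  shows "locally_nilpotent (G\<lparr>carrier := H\<rparr>) \<longleftrightarrow> locally_nilpotent_subgroup G H"
proof -
  have "nilpotent_group (G\<lparr>carrier := generate (G\<lparr>carrier := H\<rparr>) A\<rparr>) \<longleftrightarrow>
      nilpotent_subgroup G (generate G A)" if "A \<subseteq> H" for A
    using that H subgroup.subset[OF H]
    by (simp add: generate_consistent nilpotent_group_subgroup_iff generate_is_subgroup)
  then show ?thesis
    unfolding locally_nilpotent_def locally_nilpotent_subgroup_def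
    using H subgroup_imp_group[OF H] by auto
qed

text \<open>The bounds come from
  \<open>Z\<^sub>i(P) \<inter> Z\<^sub>j(Q) \<le> Z\<^sub>i\<^sub>+\<^sub>j(PQ)\<close>, which handles \<open>P \<inter> Q\<close>; modulo \<open>P \<inter> Q\<close> the two factors commute.\<close>

theorem fitting:
  assumes P: "nilpotent_subgroup G P" and Q: "nilpotent_subgroup G Q"
    and PQ: "P \<subseteq> normalizing G Q" and QP: "Q \<subseteq> normalizing G P"
  shows "nilpotent_subgroup G (generate G (P \<union> Q))"
proof -
  let ?J = "generate G (P \<union> Q)"
  obtain c d where c: "P \<subseteq> upper_central G P c" and d: "Q \<subseteq> upper_central G Q d"
    and sP: "subgroup P G" and sQ: "subgroup Q G"
    using P Q by (auto simp: nilpotent_subgroup_def)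
  have PQc: "P \<union> Q \<subseteq> carrier G" using sP sQ by (auto dest: subgroup.subset)
  have J: "subgroup ?J G" by (rule generate_is_subgroup[OF PQc])
  have PJ: "P \<subseteq> ?J" "Q \<subseteq> ?J" by (auto intro: generate.incl)
  have sZ: "subgroup (upper_central G ?J m) G" for m by (rule subgroup_upper_central[OF J])
  have nZ: "P \<union> Q \<subseteq> normalizing G (upper_central G ?J m)" for m
    using PJ subgroup_le_normalizing[OF J] normalizing_upper_central[OF J, of m] by blast
  have step: "u \<in> upper_central G ?J (Suc m)"
    if "u \<in> P \<union> Q" "\<And>a. a \<in> P \<union> Q \<Longrightarrow> commutator G u a \<in> upper_central G ?J m" for u m
  proof -
    have "u \<in> ?J" "u \<in> carrier G" using that(1) PJ PQc by auto
    then show ?thesis using commutator_generate[OF PQc sZ _ nZ that(2)] by simp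
  qed
  have normP: "P \<union> Q \<subseteq> normalizing G (upper_central G P i)" for i
    using subgroup_le_normalizing[OF sP] QP normalizing_upper_central[OF sP, of i] by blast
  have normQ: "P \<union> Q \<subseteq> normalizing G (upper_central G Q i)" for i
    using subgroup_le_normalizing[OF sQ] PQ normalizing_upper_central[OF sQ, of i] by blast
  have commP: "commutator G u a \<in> upper_central G P i"
    if "u \<in> upper_central G P i" "a \<in> P \<union> Q" for u a i
    using commutator_in_normalized[OF subgroup_upper_central[OF sP] that(1)] normP that(2) by blast
  have commQ: "commutator G u a \<in> upper_central G Q i"
    if "u \<in> upper_central G Q i" "a \<in> P \<union> Q" for u a i
    using commutator_in_normalized[OF subgroup_upper_central[OF sQ] that(1)] normQ that(2) by blast
  have inter: "upper_central G P i \<inter> upper_central G Q j \<subseteq> upper_central G ?J m"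
    if "i + j = m" for i j m
    using that
  proof (induction m arbitrary: i j)
    case 0
    then show ?case by simp
  next
    case (Suc m)
    \<comment> \<open>Commuting with P lowers the index in P and keeps the index in Q, since P
      normalizes Q and with it the central terms of Q; so i + j drops by one. For i = 0 the element
      u is 1.\<close>
    have uP: "commutator G u a \<in> upper_central G ?J m"
      if u: "u \<in> upper_central G P i" "u \<in> upper_central G Q j" and a: "a \<in> P" for u a
    proof (cases i)
      case 0
      then show ?thesis using u a sZ subgroup.one_closed[OF sZ] PQc by (auto simp: word)
    next
      case (Suc i')
      then have "commutator G u a \<in> upper_central G P i'" using u a by simp
      then show ?thesis
        using commQ[OF u(2)] a Suc.IH[of i' j] \<open>i + j = Suc m\<close> \<open>i = Suc i'\<close> by auto
    qed
    have uQ: "commutator G u a \<in> upper_central G ?J m"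
      if u: "u \<in> upper_central G P i" "u \<in> upper_central G Q j" and a: "a \<in> Q" for u a
    proof (cases j)
      case 0
      then show ?thesis using u a sZ subgroup.one_closed[OF sZ] PQc by (auto simp: word)
    next
      case (Suc j')
      then have "commutator G u a \<in> upper_central G Q j'" using u a by simp
      then show ?thesis
        using commP[OF u(1)] a Suc.IH[of i j'] \<open>i + j = Suc m\<close> \<open>j = Suc j'\<close> by auto
    qed
    show ?case
    proof
      fix u assume u: "u \<in> upper_central G P i \<inter> upper_central G Q j"
      then have "u \<in> P \<union> Q" using upper_central_subset[OF sP] by blast
      then show "u \<in> upper_central G ?J (Suc m)"
        by (rule step) (use u uP uQ in blast)
    qed
  qed
  \<comment> \<open>[p, q] lies in P \<inter> Q, hence in Z_c(P) \<inter> Z_d(Q), hence in the term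
    of index c + d for the product.\<close>
  define e where "e = c + d"
  have PQe: "commutator G p q \<in> upper_central G ?J e" if "p \<in> P" "q \<in> Q" for p q
  proof -
    have "commutator G p q \<in> P" using commutator_in_normalized[OF sP that(1)] that(2) QP by blast
    moreover have "inv (commutator G q p) \<in> Q"
      using commutator_in_normalized[OF sQ that(2)] that(1) PQ sQ by (blast intro: subgroup.m_inv_closed)
    then have "commutator G p q \<in> Q"
      using that PQc by (subst (asm) inv_commutator) auto
    ultimately show ?thesis using inter[of c d e] c d unfolding e_def by blast
  qed
  have QPe: "commutator G q p \<in> upper_central G ?J e" if "p \<in> P" "q \<in> Q" for p q
  proof -
    have "inv (commutator G p q) \<in> upper_central G ?J e"
      using PQe[OF that] sZ by (blast intro: subgroup.m_inv_closed)
    then show ?thesis using that PQc by (subst (asm) inv_commutator) auto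
  qed
  have mono: "upper_central G ?J e \<subseteq> upper_central G ?J (e + i)" for i
    by (rule upper_central_mono[OF J]) simp
  have Pi: "upper_central G P i \<subseteq> upper_central G ?J (e + i)" for i
  proof (induction i)
    case 0
    then show ?case using subgroup.one_closed[OF sZ] by simp
  next
    case (Suc i)
    show ?case
    proof
      fix u assume u: "u \<in> upper_central G P (Suc i)"
      then have uP: "u \<in> P" by simp
      have "u \<in> upper_central G ?J (Suc (e + i))"
      proof (rule step)
        fix a assume "a \<in> P \<union> Q"
        then show "commutator G u a \<in> upper_central G ?J (e + i)"
          using u Suc PQe[OF uP] mono[of i] by auto
      qed (use uP in simp)
      then show "u \<in> upper_central G ?J (e + Suc i)" by simp
    qed
  qed
  have Qi: "upper_central G Q i \<subseteq> upper_central G ?J (e + i)" for i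
  proof (induction i)
    case 0
    then show ?case using subgroup.one_closed[OF sZ] by simp
  next
    case (Suc i)
    show ?case
    proof
      fix u assume u: "u \<in> upper_central G Q (Suc i)"
      then have uQ: "u \<in> Q" by simp
      have "u \<in> upper_central G ?J (Suc (e + i))"
      proof (rule step)
        fix a assume "a \<in> P \<union> Q"
        then show "commutator G u a \<in> upper_central G ?J (e + i)"
          using u Suc QPe[OF _ uQ] mono[of i] by auto
      qed (use uQ in simp)
      then show "u \<in> upper_central G ?J (e + Suc i)" by simp
    qed
  qed
  \<comment> \<open>A common bound for the indices e + c of P and e + d of Q.\<close>
  have "P \<union> Q \<subseteq> upper_central G ?J (e + (c + d))"
    using c d Pi[of c] Qi[of d] upper_central_mono[OF J, of "e + c" "e + (c + d)"]
      upper_central_mono[OF J, of "e + d" "e + (c + d)"] by auto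
  then have "?J \<subseteq> upper_central G ?J (e + (c + d))"
    using sZ by (rule generate_subgroup_incl)
  then show ?thesis using J unfolding nilpotent_subgroup_def by blast
qed

end

section \<open>The Hirsch-Plotkin theorem\<close>

context group
begin

text \<open>As V is closed under inverses, the condition for x^(-1) supplies the second half of
  normalization by x.\<close>

lemma normalizing_generate_symmetric:
  assumes A: "A \<subseteq> carrier G" and V: "V \<subseteq> carrier G" "\<And>x. x \<in> V \<Longrightarrow> inv x \<in> V"
    and AX: "\<And>x a. x \<in> V \<Longrightarrow> a \<in> A \<Longrightarrow> inv x \<otimes> a \<otimes> x \<in> generate G A"
  shows "V \<subseteq> normalizing G (generate G A)"
proof
  fix x assume x: "x \<in> V"
  then have xc: "x \<in> carrier G" using V by auto
  show "x \<in> normalizing G (generate G A)"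
    using AX[OF x] AX[OF V(2)[OF x]] xc by (intro normalizing_generate[OF A xc]) auto
qed

lemma subgroup_conj_commutator:
  assumes S: "subgroup S G" and "b \<in> S" "commutator G b x \<in> S" "b \<in> carrier G" "x \<in> carrier G"
  shows "inv x \<otimes> b \<otimes> x \<in> S"
proof -
  have "b \<otimes> commutator G b x \<in> S" using assms by (simp add: subgroup.m_closed)
  then show ?thesis using assms by (simp add: word)
qed

text \<open>The commutators of C with V lie one central term lower, so the induction on i closes
  them up to a finite B. Adding C keeps the span invariant because c^x = c [c, x]. K is carried
  along to keep the new generators in a second subgroup normalized by V.\<close>

lemma finite_invariant_closure:
  assumes N: "subgroup N G" and K: "subgroup K G"
    and V: "finite V" "V \<subseteq> N" "V \<subseteq> normalizing G K" "\<And>x. x \<in> V \<Longrightarrow> inv x \<in> V"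
  shows "finite C \<Longrightarrow> C \<subseteq> upper_central G N i \<Longrightarrow> C \<subseteq> K \<Longrightarrow>
    \<exists>B. finite B \<and> C \<subseteq> B \<and> B \<subseteq> N \<and> B \<subseteq> K \<and> V \<subseteq> normalizing G (generate G B)"
proof (induction i arbitrary: C)
  case 0
  have Cc: "C \<subseteq> carrier G" and Vc: "V \<subseteq> carrier G" using 0 V(2) subgroup.subset[OF N] by auto
  have "V \<subseteq> normalizing G (generate G C)"
  proof (rule normalizing_generate_symmetric[OF Cc Vc V(4)])
    fix x a assume "x \<in> V" "a \<in> C"
    then have "a = \<one>" "x \<in> carrier G" using 0 Vc by auto
    then show "inv x \<otimes> a \<otimes> x \<in> generate G C" by (simp add: generate.one)
  qed
  then show ?case using 0 subgroup.one_closed[OF N] by auto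
next
  case (Suc i)
  have Vc: "V \<subseteq> carrier G" using V(2) subgroup.subset[OF N] by auto
  let ?C = "(\<lambda>(c, x). commutator G c x) ` (C \<times> V)"
  have "finite ?C" using Suc.prems V(1) by simp
  moreover have "?C \<subseteq> upper_central G N i" using Suc.prems V(2) by auto
  moreover have "?C \<subseteq> K"
    using Suc.prems(3) V(3) by (auto intro!: commutator_in_normalized[OF K])
  ultimately obtain B where B: "finite B" "?C \<subseteq> B" "B \<subseteq> N" "B \<subseteq> K"
    "V \<subseteq> normalizing G (generate G B)" using Suc.IH[of ?C] by auto
  have C: "C \<subseteq> N" using Suc.prems by auto
  have CB: "C \<union> B \<subseteq> carrier G" using C B subgroup.subset[OF N] by auto
  note S = generate_is_subgroup[OF CB]
  have "generate G B \<subseteq> generate G (C \<union> B)" by (rule mono_generate) simp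
  have "V \<subseteq> normalizing G (generate G (C \<union> B))"
  proof (rule normalizing_generate_symmetric[OF CB Vc V(4)])
    fix x a assume x: "x \<in> V" and "a \<in> C \<union> B"
    then consider "a \<in> C" | "a \<in> B" by blast
    then show "inv x \<otimes> a \<otimes> x \<in> generate G (C \<union> B)"
    proof cases
      case 1
      then have "commutator G a x \<in> generate G (C \<union> B)" using B(2) x by (auto intro: generate.incl)
      then show ?thesis
        using 1 CB x Vc by (intro subgroup_conj_commutator[OF S]) (auto intro: generate.incl)
    next
      case 2
      then have "inv x \<otimes> a \<otimes> x \<in> generate G B"
        using B(5) x by (intro normalizingD(1)[of x "generate G B"]) (auto intro: generate.incl)
      then show ?thesis using \<open>generate G B \<subseteq> _\<close> by blast
    qed
  qed
  then show ?case using B C Suc.prems by (intro exI[of _ "C \<union> B"]) auto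
qed

text \<open>The commutators [x, y] lie in P \<inter> Q. Seen in P they generate with V a nilpotent
  group, which bounds the closure under V; the closure stays in Q, where together with Y it
  generates a nilpotent group again. Exchanging the roles gives a partner for Fitting's
  theorem.\<close>

lemma mutual_closure:
  assumes P: "locally_nilpotent_subgroup G P" and Q: "locally_nilpotent_subgroup G Q"
    and PQ: "P \<subseteq> normalizing G Q" and QP: "Q \<subseteq> normalizing G P"
    and V: "finite V" "V \<subseteq> P" "\<And>x. x \<in> V \<Longrightarrow> inv x \<in> V"
    and Y: "finite Y" "Y \<subseteq> Q" "\<And>y. y \<in> Y \<Longrightarrow> inv y \<in> Y"
  obtains T where "nilpotent_subgroup G T" "Y \<subseteq> T" "T \<subseteq> generate G (V \<union> Y)"
    "V \<union> Y \<subseteq> normalizing G T"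
proof -
  have sP: "subgroup P G" and sQ: "subgroup Q G"
    using P Q by (auto simp: locally_nilpotent_subgroup_def)
  have Vc: "V \<subseteq> carrier G" and Yc: "Y \<subseteq> carrier G"
    using V(2) Y(2) sP sQ by (auto dest: subgroup.subset)
  let ?C = "(\<lambda>(x, y). commutator G x y) ` (V \<times> Y)"
  have C: "finite ?C" "?C \<subseteq> carrier G" using V(1) Y(1) Vc Yc by auto
  have CP: "?C \<subseteq> P"
    using V(2) Y(2) QP by (auto intro!: commutator_in_normalized[OF sP])
  have CQ: "?C \<subseteq> Q"
  proof clarify
    fix x y assume "x \<in> V" "y \<in> Y"
    then have "inv (commutator G y x) \<in> Q"
      using V(2) Y(2) PQ
      by (intro subgroup.m_inv_closed[OF sQ] commutator_in_normalized[OF sQ]) auto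
    then show "commutator G x y \<in> Q"
      using Vc Yc \<open>x \<in> V\<close> \<open>y \<in> Y\<close> by (auto simp: inv_commutator subset_iff)
  qed
  define N where "N = generate G (V \<union> ?C)"
  have "nilpotent_subgroup G N"
    using P C(1) V(1,2) CP unfolding N_def locally_nilpotent_subgroup_def by simp
  then obtain n where N: "subgroup N G" "N \<subseteq> upper_central G N n"
    by (auto simp: nilpotent_subgroup_def)
  have "V \<subseteq> N" "?C \<subseteq> N" unfolding N_def by (auto intro: generate.incl)
  then obtain B where B: "finite B" "?C \<subseteq> B" "B \<subseteq> N" "B \<subseteq> Q" "V \<subseteq> normalizing G (generate G B)"
    using finite_invariant_closure[OF N(1) sQ V(1) \<open>V \<subseteq> N\<close> _ V(3) C(1) _ CQ, of n] V(2) PQ N(2)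
    by (metis (no_types, lifting) order_trans)
  define T where "T = generate G (Y \<union> B)"
  have YB: "Y \<union> B \<subseteq> carrier G" using Yc B(4) sQ by (auto dest: subgroup.subset)
  have sT: "subgroup T G" unfolding T_def by (rule generate_is_subgroup[OF YB])
  have YT: "Y \<subseteq> T" and BT: "B \<subseteq> T" unfolding T_def by (auto intro: generate.incl)
  have BT': "generate G B \<subseteq> T" using BT sT by (rule generate_subgroup_incl)
  have "nilpotent_subgroup G T"
    using Q B(1,4) Y(1,2) unfolding T_def locally_nilpotent_subgroup_def by simp
  moreover have "T \<subseteq> generate G (V \<union> Y)"
  proof -
    have s: "subgroup (generate G (V \<union> Y)) G" using Vc Yc by (simp add: generate_is_subgroup)
    have "?C \<subseteq> generate G (V \<union> Y)"
      using subgroup_commutator[OF s] by (auto intro: generate.incl)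
    then have "V \<union> ?C \<subseteq> generate G (V \<union> Y)" by (auto intro: generate.incl)
    then have "N \<subseteq> generate G (V \<union> Y)"
      unfolding N_def using s by (rule generate_subgroup_incl)
    then have "Y \<union> B \<subseteq> generate G (V \<union> Y)" using B(3) by (auto intro: generate.incl)
    then show ?thesis unfolding T_def using s by (rule generate_subgroup_incl)
  qed
  moreover have "V \<subseteq> normalizing G T"
    unfolding T_def
  proof (rule normalizing_generate_symmetric[OF YB Vc V(3)])
    fix x a assume x: "x \<in> V" and "a \<in> Y \<union> B"
    then consider "a \<in> Y" | "a \<in> B" by blast
    then have "inv x \<otimes> a \<otimes> x \<in> T"
    proof cases
      case 1
      have "commutator G x a \<in> T" using 1 x B(2) BT by auto
      then have "inv (commutator G x a) \<in> T" by (rule subgroup.m_inv_closed[OF sT])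
      then have "commutator G a x \<in> T" using 1 x Vc Yc by (auto simp: inv_commutator subset_iff)
      then show ?thesis
        using 1 x YT Vc Yc by (intro subgroup_conj_commutator[OF sT]) auto
    next
      case 2
      then have "inv x \<otimes> a \<otimes> x \<in> generate G B"
        using B(5) x by (intro normalizingD(1)[of x "generate G B"]) (auto intro: generate.incl)
      then show ?thesis using BT' by blast
    qed
    then show "inv x \<otimes> a \<otimes> x \<in> generate G (Y \<union> B)" by (simp add: T_def)
  qed
  moreover have "Y \<subseteq> normalizing G T" using YT subgroup_le_normalizing[OF sT] by blast
  ultimately show thesis using that YT by blast
qed

text \<open>Finitely many generators are split into V in P and Y in Q. The two nilpotent groups T
  and U from \<open>mutual_closure\<close> normalize each other, because both lie in the span of V
  and Y and this span normalizes both.\<close>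

theorem hirsch_plotkin:
  assumes P: "locally_nilpotent_subgroup G P" and Q: "locally_nilpotent_subgroup G Q"
    and PQ: "P \<subseteq> normalizing G Q" and QP: "Q \<subseteq> normalizing G P"
  shows "locally_nilpotent_subgroup G (generate G (P \<union> Q))"
  unfolding locally_nilpotent_subgroup_def
proof (intro conjI allI impI)
  have sP: "subgroup P G" and sQ: "subgroup Q G"
    using P Q by (auto simp: locally_nilpotent_subgroup_def)
  note c = subgroup.mem_carrier[OF sP] subgroup.mem_carrier[OF sQ]
  show "subgroup (generate G (P \<union> Q)) G"
    using c by (intro generate_is_subgroup) auto
  fix A assume A: "finite A \<and> A \<subseteq> generate G (P \<union> Q)"
  then obtain F where F: "finite F" "F \<subseteq> P \<union> Q" "A \<subseteq> generate G F"
    using finite_in_generate[of A "P \<union> Q"] by blast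
  define V where "V = (F \<inter> P) \<union> (\<lambda>x. inv x) ` (F \<inter> P)"
  define Y where "Y = (F \<inter> Q) \<union> (\<lambda>x. inv x) ` (F \<inter> Q)"
  have V: "finite V" "V \<subseteq> P" "\<And>x. x \<in> V \<Longrightarrow> inv x \<in> V"
    using F(1) sP c unfolding V_def by (auto simp: subgroup.m_inv_closed)
  have Y: "finite Y" "Y \<subseteq> Q" "\<And>x. x \<in> Y \<Longrightarrow> inv x \<in> Y"
    using F(1) sQ c unfolding Y_def by (auto simp: subgroup.m_inv_closed)
  have VYc: "V \<union> Y \<subseteq> carrier G" using V(2) Y(2) c by auto
  have FVY: "F \<subseteq> V \<union> Y" using F(2) unfolding V_def Y_def by auto
  obtain T where T: "nilpotent_subgroup G T" "Y \<subseteq> T" "T \<subseteq> generate G (V \<union> Y)"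
    "V \<union> Y \<subseteq> normalizing G T" using mutual_closure[OF P Q PQ QP V Y] .
  obtain U where U: "nilpotent_subgroup G U" "V \<subseteq> U" "U \<subseteq> generate G (Y \<union> V)"
    "Y \<union> V \<subseteq> normalizing G U" using mutual_closure[OF Q P QP PQ Y V] .
  note sT = nilpotent_subgroupD[OF T(1)] and sU = nilpotent_subgroupD[OF U(1)]
  have "generate G (V \<union> Y) \<subseteq> normalizing G T"
    using T(4) subgroup.subset[OF sT] by (rule generate_le_normalizing)
  moreover have "generate G (V \<union> Y) \<subseteq> normalizing G U"
    using U(4) subgroup.subset[OF sU] by (subst Un_commute) (rule generate_le_normalizing)
  ultimately have nil: "nilpotent_subgroup G (generate G (T \<union> U))"
    using T(3) U(3) by (intro fitting[OF T(1) U(1)]) (auto simp: Un_commute)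
  have TUc: "T \<union> U \<subseteq> carrier G" using sT sU by (auto dest: subgroup.subset)
  have AT: "A \<subseteq> generate G (T \<union> U)"
    using F(3) mono_generate[OF FVY] mono_generate[of "V \<union> Y" "T \<union> U"] T(2) U(2) by blast
  have "A \<subseteq> carrier G" using AT generate_incl[OF TUc] by blast
  then show "nilpotent_subgroup G (generate G A)"
    using nilpotent_subgroup_mono[OF nil generate_is_subgroup]
      generate_subgroup_incl[OF AT nilpotent_subgroupD[OF nil]] by blast
qed

lemma normalizing_generate_Union:
  assumes "\<And>S. S \<in> \<D> \<Longrightarrow> S \<subseteq> carrier G" "g \<in> carrier G" "\<And>S. S \<in> \<D> \<Longrightarrow> g \<in> normalizing G S"
  shows "g \<in> normalizing G (generate G (\<Union>\<D>))"
proof (rule normalizing_generate)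
  show "\<Union>\<D> \<subseteq> carrier G" using assms(1) by blast
  show "inv g \<otimes> a \<otimes> g \<in> generate G (\<Union>\<D>)" if "a \<in> \<Union>\<D>" for a
    using that normalizingD(1)[OF assms(3)] by (auto intro: generate.incl)
  show "g \<otimes> a \<otimes> inv g \<in> generate G (\<Union>\<D>)" if "a \<in> \<Union>\<D>" for a
    using that normalizingD(2)[OF assms(3)] by (auto intro: generate.incl)
qed (rule assms(2))

text \<open>The subgroups of the span that are locally nilpotent and normal in it are directed
  by \<open>hirsch_plotkin\<close>, so every finite subset lies in one of them.\<close>

theorem hirsch_plotkin_Union:
  assumes D: "\<And>S. S \<in> \<D> \<Longrightarrow> locally_nilpotent_subgroup G S"
    and norm: "\<And>S T. S \<in> \<D> \<Longrightarrow> T \<in> \<D> \<Longrightarrow> S \<subseteq> normalizing G T"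
  shows "locally_nilpotent_subgroup G (generate G (\<Union>\<D>))"
proof -
  let ?H = "generate G (\<Union>\<D>)"
  have Dc: "S \<subseteq> carrier G" if "S \<in> \<D>" for S
    using D[OF that] by (auto simp: locally_nilpotent_subgroup_def dest: subgroup.subset)
  then have Uc: "\<Union>\<D> \<subseteq> carrier G" by blast
  have H: "subgroup ?H G" using Uc by (rule generate_is_subgroup)
  define \<N> where "\<N> = {S. locally_nilpotent_subgroup G S \<and> S \<subseteq> ?H \<and> ?H \<subseteq> normalizing G S}"
  have N_mem: "S \<in> \<N>" if S: "S \<in> \<D>" for S
  proof -
    have "\<Union>\<D> \<subseteq> normalizing G S" using norm S by blast
    then have "?H \<subseteq> normalizing G S" using Dc[OF S] by (rule generate_le_normalizing)
    moreover have "S \<subseteq> ?H" using S by (auto intro: generate.incl)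
    ultimately show ?thesis using D[OF S] unfolding \<N>_def by simp
  qed
  have N_triv: "{\<one>} \<in> \<N>"
  proof -
    have "locally_nilpotent_subgroup G {\<one>}"
      by (intro nilpotent_imp_locally_nilpotent_subgroup commuting_nilpotent_subgroup triv_subgroup) auto
    moreover have "?H \<subseteq> normalizing G {\<one>}"
      using subgroup.subset[OF H] by (auto simp: normalizing_def)
    ultimately show ?thesis unfolding \<N>_def using subgroup.one_closed[OF H] by simp
  qed
  have N_join: "\<exists>U\<in>\<N>. S \<union> T \<subseteq> U" if S: "S \<in> \<N>" and T: "T \<in> \<N>" for S T
  proof -
    have "locally_nilpotent_subgroup G (generate G (S \<union> T))"
      using S T unfolding \<N>_def by (intro hirsch_plotkin) auto
    moreover have "generate G (S \<union> T) \<subseteq> ?H"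
      using S T H unfolding \<N>_def by (intro generate_subgroup_incl) auto
    moreover have "?H \<subseteq> normalizing G (generate G (S \<union> T))"
    proof
      fix g assume "g \<in> ?H"
      then have "g \<in> normalizing G (generate G (\<Union>{S, T}))"
        using S T subgroup.subset[OF H] unfolding \<N>_def
        by (intro normalizing_generate_Union) auto
      then show "g \<in> normalizing G (generate G (S \<union> T))" by simp
    qed
    moreover have "S \<union> T \<subseteq> generate G (S \<union> T)" by (auto intro: generate.incl)
    ultimately show ?thesis unfolding \<N>_def by blast
  qed
  have N_elem: "\<exists>S\<in>\<N>. x \<in> S" if "x \<in> ?H" for x
    using that
  proof (induction rule: generate.induct)
    case one
    then show ?case using N_triv by blast
  next
    case (incl h)
    then show ?case using N_mem by blast
  next
    case (inv h)
    then obtain S where "S \<in> \<D>" "h \<in> S" by blast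
    then show ?case
      using N_mem subgroup.m_inv_closed[OF locally_nilpotent_subgroupD[OF D]] by blast
  next
    case (eng a b)
    then obtain S where S: "S \<in> \<N>" "a \<in> S" "b \<in> S" using N_join by blast
    then have "subgroup S G" unfolding \<N>_def by (auto dest: locally_nilpotent_subgroupD)
    then show ?case using S subgroup.m_closed[of S G a b] by blast
  qed
  have N_finite: "\<exists>S\<in>\<N>. A \<subseteq> S" if "finite A" "A \<subseteq> ?H" for A
    using that
  proof (induction rule: finite_induct)
    case empty
    then show ?case using N_triv by blast
  next
    case (insert a A)
    then obtain S T where "S \<in> \<N>" "A \<subseteq> S" "T \<in> \<N>" "a \<in> T" using N_elem by blast
    then show ?case using N_join[of S T] by blast
  qed
  show ?thesis
    unfolding locally_nilpotent_subgroup_def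
  proof (intro conjI H allI impI)
    fix A assume A: "finite A \<and> A \<subseteq> ?H"
    then obtain S where S: "S \<in> \<N>" "A \<subseteq> S" using N_finite by blast
    then have "locally_nilpotent_subgroup G S" unfolding \<N>_def by simp
    then show "nilpotent_subgroup G (generate G A)"
      using A S(2) unfolding locally_nilpotent_subgroup_def by blast
  qed
qed

lemma HP_radical_eq:
  "HP_radical G = generate G (\<Union>{H. H \<lhd> G \<and> locally_nilpotent_subgroup G H})"
proof -
  have "{H. H \<lhd> G \<and> locally_nilpotent (G\<lparr>carrier := H\<rparr>)} =
      {H. H \<lhd> G \<and> locally_nilpotent_subgroup G H}"
    using locally_nilpotent_subgroup_iff normal_imp_subgroup by blast
  then show ?thesis by (simp add: HP_radical_def)
qed

lemma HP_radical_upper: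
  "H \<lhd> G \<Longrightarrow> locally_nilpotent_subgroup G H \<Longrightarrow> H \<subseteq> HP_radical G"
  unfolding HP_radical_eq by (auto intro!: generate.incl)

lemma normal_generate_Union:
  assumes "\<And>H. H \<in> \<D> \<Longrightarrow> H \<lhd> G"
  shows "generate G (\<Union>\<D>) \<lhd> G"
proof -
  have sub: "\<And>H. H \<in> \<D> \<Longrightarrow> subgroup H G" using assms by (simp add: normal_imp_subgroup)
  then have "\<Union>\<D> \<subseteq> carrier G" by (auto dest: subgroup.mem_carrier)
  moreover have "carrier G \<subseteq> normalizing G (generate G (\<Union>\<D>))"
    using assms sub unfolding normal_iff_normalizing
    by (auto intro!: normalizing_generate_Union dest: subgroup.mem_carrier)
  ultimately show ?thesis by (simp add: normal_iff_normalizing generate_is_subgroup)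
qed

lemma normal_HP_radical: "HP_radical G \<lhd> G"
  unfolding HP_radical_def by (rule normal_generate_Union) simp

lemma normal_NR_radical: "NR_radical G \<lhd> G"
  unfolding NR_radical_def by (rule normal_generate_Union) simp

lemma locally_nilpotent_HP_radical: "locally_nilpotent_subgroup G (HP_radical G)"
  unfolding HP_radical_eq
  by (rule hirsch_plotkin_Union) (auto simp: normal_iff_normalizing dest: subgroup.mem_carrier)

end

section \<open>Noetherian subgroups\<close>

text \<open>Finite generation of all subgroups is the form of the maximal condition that passes
  directly to images and to cyclic extensions; maximal members are recovered in
  \<open>noetherian_subgroup_maximal\<close>.\<close>

definition noetherian_subgroup :: "('a, 'b) monoid_scheme \<Rightarrow> 'a set \<Rightarrow> bool" where
  "noetherian_subgroup G H \<longleftrightarrow> subgroup H G \<and>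
     (\<forall>S. subgroup S G \<and> S \<subseteq> H \<longrightarrow> (\<exists>B. finite B \<and> generate G B = S))"

definition locally_noetherian_subgroup :: "('a, 'b) monoid_scheme \<Rightarrow> 'a set \<Rightarrow> bool" where
  "locally_noetherian_subgroup G H \<longleftrightarrow>
     subgroup H G \<and> (\<forall>A. finite A \<and> A \<subseteq> H \<longrightarrow> noetherian_subgroup G (generate G A))"

context group
begin

lemma noetherian_subgroup_generators:
  assumes "noetherian_subgroup G H" "subgroup S G" "S \<subseteq> H"
  obtains B where "finite B" "B \<subseteq> S" "generate G B = S"
proof -
  obtain B where "finite B" "generate G B = S"
    using assms unfolding noetherian_subgroup_def by blast
  moreover from this have "B \<subseteq> S" by (auto intro: generate.incl)
  ultimately show thesis using that by blast
qed

lemma noetherian_subgroup_mono: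
  "noetherian_subgroup G H \<Longrightarrow> subgroup K G \<Longrightarrow> K \<subseteq> H \<Longrightarrow> noetherian_subgroup G K"
  unfolding noetherian_subgroup_def by blast

text \<open>A maximal member among the finitely generated subgroups of S absorbs every further
  element of S, so it is S.\<close>

lemma noetherian_group_imp_noetherian_subgroup:
  assumes H: "subgroup H G" and noeth: "noetherian_group (G\<lparr>carrier := H\<rparr>)"
  shows "noetherian_subgroup G H"
  unfolding noetherian_subgroup_def
proof (intro conjI H allI impI)
  fix S assume S: "subgroup S G \<and> S \<subseteq> H"
  let ?F = "generate G ` {B. finite B \<and> B \<subseteq> S}"
  have sc: "B \<subseteq> S \<Longrightarrow> B \<subseteq> carrier G" for B using S by (auto dest: subgroup.mem_carrier)
  have "?F \<subseteq> {K. subgroup K (G\<lparr>carrier := H\<rparr>)}"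
  proof clarify
    fix B assume "B \<subseteq> S"
    then have "generate G B \<subseteq> H" "subgroup (generate G B) G"
      using S generate_subgroup_incl[of B S] sc by (auto intro!: generate_is_subgroup)
    then show "subgroup (generate G B) (G\<lparr>carrier := H\<rparr>)" using H by (simp add: subgroup_incl)
  qed
  moreover have "?F \<noteq> {}" by blast
  ultimately obtain M where M: "M \<in> ?F" "\<forall>K\<in>?F. M \<subseteq> K \<longrightarrow> K = M"
    using noeth unfolding noetherian_group_def by meson
  then obtain B where B: "finite B" "B \<subseteq> S" "M = generate G B" by blast
  have "x \<in> M" if x: "x \<in> S" for x
  proof -
    have "generate G (insert x B) \<in> ?F" using B x by blast
    moreover have "M \<subseteq> generate G (insert x B)" unfolding B(3) by (rule mono_generate) blast
    ultimately have "generate G (insert x B) = M" using M(2) by blast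
    then show ?thesis by (auto intro: generate.incl)
  qed
  then have "M = S" using generate_subgroup_incl[OF B(2)] S B(3) by blast
  then show "\<exists>B. finite B \<and> generate G B = S" using B by blast
qed

lemma locally_noetherian_imp_locally_noetherian_subgroup:
  assumes H: "subgroup H G" and noeth: "locally_noetherian (G\<lparr>carrier := H\<rparr>)"
  shows "locally_noetherian_subgroup G H"
  unfolding locally_noetherian_subgroup_def
proof (intro conjI H allI impI)
  fix A assume A: "finite A \<and> A \<subseteq> H"
  then have "noetherian_group (G\<lparr>carrier := generate G A\<rparr>)"
    using noeth H unfolding locally_noetherian_def by (auto simp: generate_consistent)
  then show "noetherian_subgroup G (generate G A)"
    using A subgroup.subset[OF H]
    by (intro noetherian_group_imp_noetherian_subgroup generate_is_subgroup) auto
qed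

text \<open>Zorn's lemma applies because the union of a chain is finitely generated: the generators
  already lie in one member of the chain, which is therefore the union.\<close>

lemma noetherian_subgroup_maximal:
  assumes noeth: "noetherian_subgroup G K" and ne: "\<F> \<noteq> {}"
    and F: "\<And>S. S \<in> \<F> \<Longrightarrow> subgroup S G \<and> S \<subseteq> K"
  obtains M where "M \<in> \<F>" "\<forall>S\<in>\<F>. M \<subseteq> S \<longrightarrow> S = M"
proof -
  have "\<exists>M\<in>\<F>. \<forall>S\<in>\<F>. M \<subseteq> S \<longrightarrow> S = M"
  proof (rule subset_Zorn_nonempty[OF ne])
    fix \<C> assume C: "\<C> \<noteq> {}" "subset.chain \<F> \<C>"
    then have CF: "\<C> \<subseteq> \<F>" and lin: "\<And>S T. S \<in> \<C> \<Longrightarrow> T \<in> \<C> \<Longrightarrow> S \<subseteq> T \<or> T \<subseteq> S"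
      by (auto simp: subset_chain_def)
    have sub: "S \<in> \<C> \<Longrightarrow> subgroup S G" for S using CF F by blast
    have "subgroup (\<Union>\<C>) G"
    proof (rule subgroupI)
      show "\<Union>\<C> \<subseteq> carrier G" using sub by (auto dest: subgroup.mem_carrier)
      show "\<Union>\<C> \<noteq> {}" using C(1) subgroup.one_closed[OF sub] by blast
      show "inv a \<in> \<Union>\<C>" if "a \<in> \<Union>\<C>" for a
        using that subgroup.m_inv_closed[OF sub] by blast
      show "a \<otimes> b \<in> \<Union>\<C>" if ab: "a \<in> \<Union>\<C>" "b \<in> \<Union>\<C>" for a b
      proof -
        obtain S where "S \<in> \<C>" "a \<in> S" "b \<in> S" using ab lin by blast
        then show ?thesis using subgroup.m_closed[OF sub] by blast
      qed
    qed
    moreover have "\<Union>\<C> \<subseteq> K" using CF F by blast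
    ultimately obtain B where B: "finite B" "B \<subseteq> \<Union>\<C>" "generate G B = \<Union>\<C>"
      by (rule noetherian_subgroup_generators[OF noeth])
    then obtain S where S: "S \<in> \<C>" "B \<subseteq> S"
      using finite_subset_Union_chain[OF B(1,2) C] by blast
    then have "\<Union>\<C> \<subseteq> S" using B(3) generate_subgroup_incl[OF S(2) sub[OF S(1)]] by simp
    then have "\<Union>\<C> = S" using S(1) by blast
    then show "\<Union>\<C> \<in> \<F>" using S(1) CF by blast
  qed
  then show thesis using that by blast
qed

text \<open>A subgroup \<open>S\<close> of \<open>\<langle>g\<rangle>L\<close> is generated by generators of \<open>S \<inter> L\<close> together with one
  element \<open>g\<^sup>d l\<close>, where \<open>d\<close> generates the image of \<open>S\<close> in the cyclic group modulo \<open>L\<close>.\<close>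

lemma noetherian_subgroup_insert:
  assumes L: "noetherian_subgroup G L" and g: "g \<in> normalizing G L"
  shows "noetherian_subgroup G (generate G (insert g L))"
proof -
  have sL: "subgroup L G" using L by (simp add: noetherian_subgroup_def)
  note Lc = subgroup.mem_carrier[OF sL]
  have gc: "g \<in> carrier G" using g normalizing_subset by auto
  have gL: "insert g L \<subseteq> carrier G" using gc Lc by auto
  have pow: "g [^] m \<in> normalizing G L" for m :: int
    using subgroup_int_pow_closed[OF subgroup_normalizing[OF subgroup.subset[OF sL]] g] .
  have conj: "inv (g [^] m) \<otimes> l \<otimes> g [^] m \<in> L" "g [^] m \<otimes> l \<otimes> inv (g [^] m) \<in> L"
    if "l \<in> L" for l and m :: int
    using normalizingD[OF pow that] by auto
  have prod: "\<exists>l\<in>L. (g [^] m \<otimes> a) \<otimes> (g [^] n \<otimes> b) = g [^] (m + n) \<otimes> l"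
    if "a \<in> L" "b \<in> L" for a b and m n :: int
  proof
    show "(g [^] m \<otimes> a) \<otimes> (g [^] n \<otimes> b) = g [^] (m + n) \<otimes> (inv (g [^] n) \<otimes> a \<otimes> g [^] n \<otimes> b)"
      using that gc Lc by (simp add: int_pow_mult word)
    show "inv (g [^] n) \<otimes> a \<otimes> g [^] n \<otimes> b \<in> L"
      using conj(1) that sL by (simp add: subgroup.m_closed)
  qed
  have invs: "\<exists>l\<in>L. inv (g [^] m \<otimes> a) = g [^] (- m) \<otimes> l" if "a \<in> L" for a and m :: int
  proof
    show "inv (g [^] m \<otimes> a) = g [^] (- m) \<otimes> (g [^] m \<otimes> inv a \<otimes> inv (g [^] m))"
      using that gc Lc by (simp add: int_pow_neg word)
    show "g [^] m \<otimes> inv a \<otimes> inv (g [^] m) \<in> L"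
      using conj(2) that sL by (simp add: subgroup.m_inv_closed)
  qed
  define E where "E = {g [^] m \<otimes> l | (m::int) l. l \<in> L}"
  have "subgroup E G"
  proof (rule subgroupI)
    show "E \<subseteq> carrier G" unfolding E_def using gc Lc by auto
    show "E \<noteq> {}" unfolding E_def using subgroup.one_closed[OF sL] by blast
    show "inv a \<in> E" if "a \<in> E" for a
      using that invs unfolding E_def by blast
    show "a \<otimes> b \<in> E" if "a \<in> E" "b \<in> E" for a b
      using that prod unfolding E_def by blast
  qed
  moreover have "insert g L \<subseteq> E"
  proof -
    have "l \<in> E" if "l \<in> L" for l
      using that Lc unfolding E_def by (auto intro!: exI[of _ "0::int"] exI[of _ l])
    moreover have "g \<in> E"
      using gc subgroup.one_closed[OF sL] unfolding E_def by (auto intro!: exI[of _ "1::int"] exI[of _ \<one>])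
    ultimately show ?thesis by blast
  qed
  ultimately have KE: "generate G (insert g L) \<subseteq> E" by (simp add: generate_subgroup_incl)
  show ?thesis
    unfolding noetherian_subgroup_def
  proof (intro conjI allI impI generate_is_subgroup gL)
    fix S assume S: "subgroup S G \<and> S \<subseteq> generate G (insert g L)"
    then have sS: "subgroup S G" and SE: "S \<subseteq> E" using KE by auto
    have "subgroup (S \<inter> L) G" using sS sL by (rule subgroups_Inter_pair)
    then obtain B where B: "finite B" "B \<subseteq> S \<inter> L" "generate G B = S \<inter> L"
      using noetherian_subgroup_generators[OF L] by blast
    \<comment> \<open>Working with integer exponents treats finite and infinite order of g modulo L
      alike; \<open>D\<close> is a subgroup of the integers.\<close>
    define D where "D = {m::int. \<exists>l\<in>L. g [^] m \<otimes> l \<in> S}"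
    have Dadd: "m + n \<in> D" if mn: "m \<in> D" "n \<in> D" for m n
    proof -
      obtain a b where ab: "a \<in> L" "b \<in> L" "g [^] m \<otimes> a \<in> S" "g [^] n \<otimes> b \<in> S"
        using mn unfolding D_def by blast
      have "(g [^] m \<otimes> a) \<otimes> (g [^] n \<otimes> b) \<in> S" using ab sS by (simp add: subgroup.m_closed)
      then show ?thesis using prod[OF ab(1,2), of m n] unfolding D_def by auto
    qed
    have Dneg: "- m \<in> D" if m: "m \<in> D" for m
    proof -
      obtain a where a: "a \<in> L" "g [^] m \<otimes> a \<in> S" using m unfolding D_def by blast
      then have "inv (g [^] m \<otimes> a) \<in> S" using sS by (simp add: subgroup.m_inv_closed)
      then show ?thesis using invs[OF a(1), of m] unfolding D_def by auto
    qed
    have D0: "0 \<in> D"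
      unfolding D_def using subgroup.one_closed[OF sL] subgroup.one_closed[OF sS]
      by (auto intro!: bexI[of _ \<one>])
    have "\<exists>d\<in>D. \<forall>m\<in>D. d dvd m"
    proof (cases "D = {0}")
      case True
      then show ?thesis by simp
    next
      case False
      then obtain m where m: "m \<in> D" "m \<noteq> 0" using D0 by blast
      define d where "d = (LEAST n. 0 < n \<and> int n \<in> D)"
      have "\<exists>n. 0 < n \<and> int n \<in> D"
        using m Dneg[of m] by (intro exI[of _ "nat \<bar>m\<bar>"]) (auto simp: abs_if)
      then have d: "0 < d" "int d \<in> D" unfolding d_def by (rule LeastI2_ex; simp)+
      have least: "d \<le> n" if "0 < n" "int n \<in> D" for n
        unfolding d_def using that by (simp add: Least_le)
      have Dmul: "int k * int d \<in> D" for k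
        by (induction k) (auto simp: D0 Dadd d algebra_simps)
      have Dmul': "k * int d \<in> D" for k
        using Dmul[of "nat k"] Dneg[OF Dmul[of "nat (- k)"]] by (cases "0 \<le> k") auto
      have "int d dvd m" if m: "m \<in> D" for m
      proof (rule ccontr)
        assume "\<not> int d dvd m"
        then have "0 < m mod int d" using d(1)
          by (metis dvd_eq_mod_eq_0 of_nat_0_less_iff order_le_less pos_mod_sign)
        moreover have "m mod int d = m + (- (m div int d)) * int d"
          by (simp add: minus_div_mult_eq_mod)
        then have "m mod int d \<in> D" by (simp only: Dadd[OF m Dmul'])
        ultimately have "d \<le> nat (m mod int d)" by (intro least) auto
        then show False using d(1) pos_mod_bound[of "int d" m] by linarith
      qed
      then show ?thesis using d by blast
    qed
    then obtain d where d: "d \<in> D" "\<And>m. m \<in> D \<Longrightarrow> d dvd m" by blast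
    then obtain l where l: "l \<in> L" "g [^] d \<otimes> l \<in> S" unfolding D_def by blast
    let ?s = "g [^] d \<otimes> l"
    let ?T = "generate G (insert ?s B)"
    have sc: "?s \<in> carrier G" using gc l Lc by simp
    have "insert ?s B \<subseteq> carrier G" using sc B(2) Lc by auto
    then have sT: "subgroup ?T G" by (rule generate_is_subgroup)
    have powers: "\<exists>a\<in>L. ?s [^] (k::int) = g [^] (d * k) \<otimes> a" for k
    proof -
      have nat: "\<exists>a\<in>L. ?s [^] (int k) = g [^] (d * int k) \<otimes> a" for k
      proof (induction k)
        case 0
        then show ?case using subgroup.one_closed[OF sL] by (intro bexI[of _ \<one>]) auto
      next
        case (Suc k)
        then obtain a where a: "a \<in> L" "?s [^] (int k) = g [^] (d * int k) \<otimes> a" by blast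
        have "?s [^] (int (Suc k)) = ?s [^] (int k) \<otimes> ?s"
          using sc int_pow_mult[of ?s "int k" 1] by (simp add: add.commute)
        also have "\<dots> = (g [^] (d * int k) \<otimes> a) \<otimes> (g [^] d \<otimes> l)" using a by simp
        finally show ?case using prod[OF a(1) l(1), of "d * int k" d] by (simp add: algebra_simps)
      qed
      show ?thesis
      proof (cases "0 \<le> k")
        case True
        then show ?thesis using nat[of "nat k"] by simp
      next
        case False
        obtain a where a: "a \<in> L" "?s [^] (int (nat (- k))) = g [^] (d * int (nat (- k))) \<otimes> a"
          using nat by blast
        have "?s [^] k = inv (?s [^] (int (nat (- k))))"
          using False sc int_pow_neg[of ?s "- k"] by simp
        then show ?thesis
          using a invs[OF a(1), of "d * int (nat (- k))"] False by simp
      qed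
    qed
    have "S \<subseteq> ?T"
    proof
      fix x assume x: "x \<in> S"
      then obtain m :: int and a where a: "a \<in> L" "x = g [^] m \<otimes> a" using SE unfolding E_def by blast
      then have "m \<in> D" using x unfolding D_def by blast
      then obtain k where k: "m = d * k" using d(2) by blast
      obtain b where b: "b \<in> L" "?s [^] k = g [^] m \<otimes> b" using powers[of k] k by blast
      have sk: "?s [^] k \<in> S" using subgroup_int_pow_closed[OF sS l(2)] .
      \<comment> \<open>\<open>x\<close> and the k-th power of \<open>?s\<close> carry the same
        power of g, so their quotient falls into S \<inter> L.\<close>
      have "inv (?s [^] k) \<otimes> x = inv b \<otimes> a" using a b gc Lc by (simp add: word)
      then have "inv (?s [^] k) \<otimes> x \<in> S \<inter> L"
        using subgroup.m_closed[OF sS subgroup.m_inv_closed[OF sS sk] x] a b sL by (simp add: subgroup.m_closed subgroup.m_inv_closed)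
      then have "inv (?s [^] k) \<otimes> x \<in> ?T" using B(3) mono_generate[of B "insert ?s B"] by blast
      moreover have "?s [^] k \<in> ?T"
        by (rule subgroup_int_pow_closed[OF sT]) (simp add: generate.incl)
      ultimately have "?s [^] k \<otimes> (inv (?s [^] k) \<otimes> x) \<in> ?T" using sT by (simp add: subgroup.m_closed)
      then show "x \<in> ?T" using sc x subgroup.mem_carrier[OF sS] by simp
    qed
    moreover have "?T \<subseteq> S" using l(2) B(2) sS by (intro generate_subgroup_incl) auto
    ultimately show "\<exists>B. finite B \<and> generate G B = S" using B(1) by (intro exI[of _ "insert ?s B"]) auto
  qed
qed

end

section \<open>Homomorphic images\<close>

context group_hom
begin

lemma hom_commutator:
  "x \<in> carrier G \<Longrightarrow> y \<in> carrier G \<Longrightarrow> h (commutator G x y) = commutator H (h x) (h y)"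
  by (simp add: commutator_def)

lemma upper_central_image:
  assumes K: "subgroup K G"
  shows "h ` upper_central G K n \<subseteq> upper_central H (h ` K) n"
proof (induction n)
  case 0
  then show ?case by simp
next
  case (Suc n)
  show ?case
  proof clarify
    fix z assume z: "z \<in> upper_central G K (Suc n)"
    have "commutator H (h z) (h x) \<in> upper_central H (h ` K) n" if x: "x \<in> K" for x
    proof -
      have "h (commutator G z x) \<in> upper_central H (h ` K) n" using Suc z x by auto
      then show ?thesis using z x subgroup.mem_carrier[OF K] by (simp add: hom_commutator)
    qed
    then show "h z \<in> upper_central H (h ` K) (Suc n)" using z by auto
  qed
qed

lemma nilpotent_subgroup_image:
  assumes "nilpotent_subgroup G K"
  shows "nilpotent_subgroup H (h ` K)"
  using assms upper_central_image[of K] subgroup_img_is_subgroup[of K]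
  unfolding nilpotent_subgroup_def by (meson image_mono order_trans)

lemma locally_nilpotent_subgroup_image:
  assumes K: "locally_nilpotent_subgroup G K"
  shows "locally_nilpotent_subgroup H (h ` K)"
  unfolding locally_nilpotent_subgroup_def
proof (intro conjI allI impI)
  have sK: "subgroup K G" using K by (simp add: locally_nilpotent_subgroup_def)
  show "subgroup (h ` K) H" by (rule subgroup_img_is_subgroup[OF sK])
  fix A assume "finite A \<and> A \<subseteq> h ` K"
  then obtain B where B: "finite B" "B \<subseteq> K" "A = h ` B" by (meson finite_subset_image)
  then have "nilpotent_subgroup G (generate G B)"
    using K by (simp add: locally_nilpotent_subgroup_def)
  moreover have "generate H A = h ` generate G B"
    using B subgroup.subset[OF sK] by (simp add: generate_img)
  ultimately show "nilpotent_subgroup H (generate H A)" by (simp add: nilpotent_subgroup_image)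
qed

lemma noetherian_subgroup_image:
  assumes K: "noetherian_subgroup G K"
  shows "noetherian_subgroup H (h ` K)"
  unfolding noetherian_subgroup_def
proof (intro conjI allI impI)
  have sK: "subgroup K G" using K by (simp add: noetherian_subgroup_def)
  note Kc = subgroup.mem_carrier[OF sK]
  show "subgroup (h ` K) H" by (rule subgroup_img_is_subgroup[OF sK])
  fix S assume S: "subgroup S H \<and> S \<subseteq> h ` K"
  define T where "T = {x \<in> K. h x \<in> S}"
  have "subgroup T G"
  proof (rule G.subgroupI)
    show "T \<subseteq> carrier G" using Kc unfolding T_def by blast
    have "\<one>\<^bsub>G\<^esub> \<in> T"
      unfolding T_def using S subgroup.one_closed[OF sK] by (simp add: subgroup.one_closed)
    then show "T \<noteq> {}" by blast
    show "inv\<^bsub>G\<^esub> a \<in> T" if "a \<in> T" for a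
      using that S sK Kc unfolding T_def by (simp add: subgroup.m_inv_closed)
    show "a \<otimes>\<^bsub>G\<^esub> b \<in> T" if "a \<in> T" "b \<in> T" for a b
      using that S sK Kc unfolding T_def by (simp add: subgroup.m_closed)
  qed
  then obtain B where B: "finite B" "B \<subseteq> T" "generate G B = T"
    using G.noetherian_subgroup_generators[OF K] unfolding T_def by blast
  have "B \<subseteq> carrier G" using B(2) Kc unfolding T_def by blast
  then have "generate H (h ` B) = h ` T" using B(3) by (simp add: generate_img)
  moreover have "h ` T = S" using S unfolding T_def by blast
  ultimately show "\<exists>B. finite B \<and> generate H B = S" using B(1) by blast
qed

lemma locally_noetherian_subgroup_image:
  assumes K: "locally_noetherian_subgroup G K"
  shows "locally_noetherian_subgroup H (h ` K)"
  unfolding locally_noetherian_subgroup_def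
proof (intro conjI allI impI)
  have sK: "subgroup K G" using K by (simp add: locally_noetherian_subgroup_def)
  show "subgroup (h ` K) H" by (rule subgroup_img_is_subgroup[OF sK])
  fix A assume "finite A \<and> A \<subseteq> h ` K"
  then obtain B where B: "finite B" "B \<subseteq> K" "A = h ` B" by (meson finite_subset_image)
  then have "noetherian_subgroup G (generate G B)"
    using K by (simp add: locally_noetherian_subgroup_def)
  moreover have "generate H A = h ` generate G B"
    using B subgroup.subset[OF sK] by (simp add: generate_img)
  ultimately show "noetherian_subgroup H (generate H A)" by (simp add: noetherian_subgroup_image)
qed

text \<open>Injectivity on K alone is what a quotient map offers when K meets its kernel
  trivially.\<close>

lemma noetherian_subgroup_inj:
  assumes sK: "subgroup K G" and inj: "inj_on h K" and noeth: "noetherian_subgroup H (h ` K)"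
  shows "noetherian_subgroup G K"
  unfolding noetherian_subgroup_def
proof (intro conjI sK allI impI)
  fix S assume S: "subgroup S G \<and> S \<subseteq> K"
  then have "subgroup (h ` S) H" "h ` S \<subseteq> h ` K" by (auto intro: subgroup_img_is_subgroup)
  then obtain B' where B': "finite B'" "B' \<subseteq> h ` S" "generate H B' = h ` S"
    by (rule H.noetherian_subgroup_generators[OF noeth])
  then obtain B where B: "finite B" "B \<subseteq> S" "B' = h ` B" by (meson finite_subset_image)
  have gS: "generate G B \<subseteq> S" using B(2) S by (simp add: G.generate_subgroup_incl)
  have "B \<subseteq> carrier G" using B(2) S subgroup.subset by blast
  then have "h ` generate G B = h ` S" using B' B(3) by (simp add: generate_img)
  then have "generate G B = S" using inj_on_image_eq_iff[OF inj] gS S by blast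
  then show "\<exists>B. finite B \<and> generate G B = S" using B(1) by blast
qed

lemma locally_noetherian_subgroup_inj:
  assumes sK: "subgroup K G" and inj: "inj_on h K"
    and noeth: "locally_noetherian_subgroup H (h ` K)"
  shows "locally_noetherian_subgroup G K"
  unfolding locally_noetherian_subgroup_def
proof (intro conjI sK allI impI)
  fix A assume A: "finite A \<and> A \<subseteq> K"
  then have Ac: "A \<subseteq> carrier G" using subgroup.subset[OF sK] by blast
  have "noetherian_subgroup H (generate H (h ` A))"
    using A noeth unfolding locally_noetherian_subgroup_def by blast
  moreover have "inj_on h (generate G A)"
    using inj A G.generate_subgroup_incl[OF _ sK] by (meson inj_on_subset)
  ultimately show "noetherian_subgroup G (generate G A)"
    using Ac by (intro noetherian_subgroup_inj) (simp_all add: generate_img G.generate_is_subgroup)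
qed

lemma normal_image:
  assumes N: "N \<lhd> G" and surj: "h ` carrier G = carrier H"
  shows "h ` N \<lhd> H"
  unfolding H.normal_inv_iff
proof (intro conjI ballI)
  show "subgroup (h ` N) H" using N by (simp add: normal_imp_subgroup subgroup_img_is_subgroup)
  fix x y assume "x \<in> carrier H" "y \<in> h ` N"
  then obtain a b where ab: "a \<in> carrier G" "x = h a" "b \<in> N" "y = h b"
    using surj by (metis imageE)
  then have "b \<in> carrier G" using N normal_imp_subgroup subgroup.mem_carrier by metis
  then have "x \<otimes>\<^bsub>H\<^esub> y \<otimes>\<^bsub>H\<^esub> inv\<^bsub>H\<^esub> x = h (a \<otimes>\<^bsub>G\<^esub> b \<otimes>\<^bsub>G\<^esub> inv\<^bsub>G\<^esub> a)"
    using ab by simp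
  then show "x \<otimes>\<^bsub>H\<^esub> y \<otimes>\<^bsub>H\<^esub> inv\<^bsub>H\<^esub> x \<in> h ` N"
    using normal.inv_op_closed2[OF N ab(1,3)] by simp
qed

lemma normal_vimage:
  assumes N: "N \<lhd> H"
  shows "{x \<in> carrier G. h x \<in> N} \<lhd> G"
  unfolding G.normal_inv_iff
proof (intro conjI ballI)
  have sN: "subgroup N H" by (rule normal_imp_subgroup[OF N])
  show "subgroup {x \<in> carrier G. h x \<in> N} G"
    by (rule G.subgroupI)
      (auto simp: subgroup.one_closed[OF sN] subgroup.m_closed[OF sN] subgroup.m_inv_closed[OF sN]
        intro!: exI[of _ "\<one>\<^bsub>G\<^esub>"])
  fix x y assume "x \<in> carrier G" "y \<in> {x \<in> carrier G. h x \<in> N}"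
  then show "x \<otimes>\<^bsub>G\<^esub> y \<otimes>\<^bsub>G\<^esub> inv\<^bsub>G\<^esub> x \<in> {x \<in> carrier G. h x \<in> N}"
    using normal.inv_op_closed2[OF N, of "h x" "h y"] by simp
qed

end

section \<open>Engel elements\<close>

context group
begin

lemma engel_word_closed [simp, intro]:
  "x \<in> carrier G \<Longrightarrow> y \<in> carrier G \<Longrightarrow> engel_word G n x y \<in> carrier G"
  by (induction n) auto

lemma engel_word_commutator: "engel_word G n (commutator G x y) y = engel_word G (Suc n) x y"
  by (induction n) auto

lemma engel_word_eq_one_mono:
  assumes "engel_word G m x y = \<one>" "m \<le> n" "x \<in> carrier G" "y \<in> carrier G"
  shows "engel_word G n x y = \<one>"
  using assms(2) by (induction rule: dec_induct) (auto simp: assms word)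

lemma engel_word_in_normalized:
  assumes "subgroup S G" "x \<in> S" "y \<in> normalizing G S"
  shows "engel_word G n x y \<in> S"
  using assms by (induction n) (auto intro: commutator_in_normalized)

lemma conj_hom:
  assumes "g \<in> carrier G"
  shows "group_hom G G (\<lambda>x. inv g \<otimes> x \<otimes> g)"
  using assms by (unfold_locales) (auto simp: hom_def word)

end

context group_hom
begin

lemma hom_engel_word:
  "x \<in> carrier G \<Longrightarrow> y \<in> carrier G \<Longrightarrow> h (engel_word G n x y) = engel_word H n (h x) (h y)"
  by (induction n) (simp_all add: hom_commutator)

end

context group
begin

text \<open>Conjugation is an automorphism; it follows that conjugates of Engel elements are
  Engel.\<close>

lemma engel_word_conj:
  assumes "k \<in> carrier G" "x \<in> carrier G" "g \<in> carrier G"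
  shows "engel_word G n x (inv k \<otimes> g \<otimes> k) = inv k \<otimes> engel_word G n (k \<otimes> x \<otimes> inv k) g \<otimes> k"
proof -
  interpret conj: group_hom G G "\<lambda>x. inv k \<otimes> x \<otimes> k" using assms(1) by (rule conj_hom)
  have "inv k \<otimes> (k \<otimes> x \<otimes> inv k) \<otimes> k = x" using assms by (simp add: word)
  then show ?thesis using conj.hom_engel_word[of "k \<otimes> x \<otimes> inv k" g n] assms by simp
qed

text \<open>Inductively, \<open>Z\<^sub>i(V)\<close> lies in some term of the upper central series of \<open>\<langle>V, z\<rangle>\<close>: an
  element \<open>u\<close> of \<open>Z\<^sub>i\<^sub>+\<^sub>1(V)\<close> does by induction on the \<open>n\<close> with \<open>e\<^sub>n(u, z) \<in> Z\<^sub>i(V)\<close>, and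
  finitely many such elements suffice.\<close>

lemma nilpotent_subgroup_insert:
  assumes V: "nilpotent_subgroup G V" and noeth: "noetherian_subgroup G V"
    and z: "z \<in> normalizing G V"
    and engel: "\<And>v. v \<in> V \<Longrightarrow> \<exists>n. engel_word G n v z = \<one>"
  shows "nilpotent_subgroup G (generate G (insert z V))"
proof -
  let ?W = "generate G (insert z V)"
  obtain c where sV: "subgroup V G" and c: "V \<subseteq> upper_central G V c"
    using V by (auto simp: nilpotent_subgroup_def)
  note Vc = subgroup.mem_carrier[OF sV]
  have zc: "z \<in> carrier G" using z normalizing_subset by auto
  have zV: "insert z V \<subseteq> carrier G" using zc Vc by auto
  have W: "subgroup ?W G" by (rule generate_is_subgroup[OF zV])
  have VW: "V \<subseteq> ?W" "z \<in> ?W" by (auto intro: generate.incl)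
  have sZ: "subgroup (upper_central G ?W m) G" for m by (rule subgroup_upper_central[OF W])
  have nZ: "insert z V \<subseteq> normalizing G (upper_central G ?W m)" for m
    using VW subgroup_le_normalizing[OF W] normalizing_upper_central[OF W, of m] by blast
  have zZ: "z \<in> normalizing G (upper_central G V i)" for i
    using z normalizing_upper_central[OF sV] by blast
  have "\<exists>m. upper_central G V i \<subseteq> upper_central G ?W m" for i
  proof (induction i)
    case 0
    have "upper_central G V 0 \<subseteq> upper_central G ?W 0" by simp
    then show ?case by blast
  next
    case (Suc i)
    then obtain m where m: "upper_central G V i \<subseteq> upper_central G ?W m" by blast
    let ?Z = "upper_central G V (Suc i)"
    have claim: "u \<in> upper_central G ?W (m + j)"
      if "u \<in> ?Z" "engel_word G j u z \<in> upper_central G ?W m" for u j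
      using that
    proof (induction j arbitrary: u)
      case 0
      then show ?case by simp
    next
      case (Suc j)
      have uV: "u \<in> V" using Suc.prems(1) by simp
      have "commutator G u z \<in> ?Z"
        by (rule commutator_in_normalized[OF subgroup_upper_central[OF sV] Suc.prems(1) zZ])
      moreover have "engel_word G j (commutator G u z) z \<in> upper_central G ?W m"
        using Suc.prems(2) by (simp only: engel_word_commutator)
      ultimately have 1: "commutator G u z \<in> upper_central G ?W (m + j)" by (rule Suc.IH)
      have "commutator G u v \<in> upper_central G ?W (m + j)" if "v \<in> V" for v
        using Suc.prems(1) that m upper_central_mono[OF W, of m "m + j"] by auto
      then have "commutator G u w \<in> upper_central G ?W (m + j)" if "w \<in> ?W" for w
        using 1 uV Vc by (intro commutator_generate[OF zV sZ _ nZ _ that]) auto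
      then show ?case using uV VW by auto
    qed
    have "subgroup ?Z G" "?Z \<subseteq> V" by (rule subgroup_upper_central[OF sV]) auto
    then obtain B where B: "finite B" "B \<subseteq> ?Z" "generate G B = ?Z"
      by (rule noetherian_subgroup_generators[OF noeth])
    have "\<exists>j. engel_word G j b z = \<one>" if "b \<in> B" for b using that B(2) engel by auto
    then obtain f where f: "\<And>b. b \<in> B \<Longrightarrow> engel_word G (f b) b z = \<one>" by metis
    \<comment> \<open>An Engel word that has reached 1 stays 1, so the largest exponent serves all
      generators. For empty \<open>B\<close> the value is unspecified, but then no generator has to
      be checked.\<close>
    define n where "n = Max (f ` B)"
    have "b \<in> upper_central G ?W (m + n)" if b: "b \<in> B" for b
    proof (rule claim)
      have "f b \<le> n" unfolding n_def using B(1) b by simp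
      moreover have "b \<in> carrier G" using b B(2) Vc by auto
      ultimately have "engel_word G n b z = \<one>" using f[OF b] zc engel_word_eq_one_mono by blast
      then show "engel_word G n b z \<in> upper_central G ?W m" using subgroup.one_closed[OF sZ] by simp
    qed (use b B(2) in blast)
    then have "generate G B \<subseteq> upper_central G ?W (m + n)"
      using sZ by (intro generate_subgroup_incl) auto
    then show ?case using B(3) by blast
  qed
  from this[of c] obtain m where m: "V \<subseteq> upper_central G ?W m" using c by blast
  \<comment> \<open>Since \<open>?W\<close> is cyclic modulo V, all commutators of \<open>?W\<close>
    lie in V, which is inside the term of index m; hence \<open>?W\<close> is its own term of index
    m + 1.\<close>
  have nV: "insert z V \<subseteq> normalizing G V" using z subgroup_le_normalizing[OF sV] by blast
  have "u \<in> upper_central G ?W (Suc m)" if u: "u \<in> insert z V" for u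
  proof -
    have uc: "u \<in> carrier G" using u zV by auto
    have "commutator G u a \<in> V" if a: "a \<in> insert z V" for a
    proof (cases "u \<in> V")
      case True
      then show ?thesis using a nV by (blast intro: commutator_in_normalized[OF sV])
    next
      case False
      then have uz: "u = z" using u by simp
      show ?thesis
      proof (cases "a \<in> V")
        case True
        then have "commutator G a u \<in> V" using uz z by (blast intro: commutator_in_normalized[OF sV])
        then have "inv (commutator G a u) \<in> V" by (rule subgroup.m_inv_closed[OF sV])
        then show ?thesis using True uc Vc by (simp add: inv_commutator)
      next
        case False
        then have "commutator G u a = \<one>" using uz a zc by (simp add: commutator_eq_one_iff)
        then show ?thesis using subgroup.one_closed[OF sV] by simp
      qed
    qed
    then have "commutator G u w \<in> V" if "w \<in> ?W" for w
      by (rule commutator_generate[OF zV sV uc nV _ that])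
    then show ?thesis using u VW m by auto
  qed
  then have "?W \<subseteq> upper_central G ?W (Suc m)" by (intro generate_subgroup_incl[OF _ sZ]) blast
  then show ?thesis using W unfolding nilpotent_subgroup_def by blast
qed

text \<open>With \<open>i\<close> maximal such that \<open>C \<inter> I Z\<^sub>i(U) \<subseteq> I\<close>, an element of \<open>C \<inter> I Z\<^sub>i\<^sub>+\<^sub>1(U)\<close>
  outside \<open>I\<close> conjugates \<open>C \<inter> I\<close> into \<open>C \<inter> I Z\<^sub>i(U) \<subseteq> I\<close>.\<close>

lemma nilpotent_normalizer_condition:
  assumes U: "nilpotent_subgroup G U" and CI: "C \<inter> I \<subseteq> U"
    and I: "subgroup I G" "I = generate G (C \<inter> I)"
    and conj: "\<And>c u. c \<in> C \<Longrightarrow> u \<in> U \<Longrightarrow> inv u \<otimes> c \<otimes> u \<in> C"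
    and proper: "\<not> C \<inter> U \<subseteq> I"
  obtains x where "x \<in> C" "x \<in> U" "x \<notin> I" "x \<in> normalizing G I"
proof -
  obtain c where sU: "subgroup U G" and c: "U \<subseteq> upper_central G U c"
    using U by (auto simp: nilpotent_subgroup_def)
  note Uc = subgroup.mem_carrier[OF sU]
  have IU: "I \<subseteq> U" using I(2) generate_subgroup_incl[OF CI sU] by simp
  define small where "small i \<longleftrightarrow> C \<inter> (I <#> upper_central G U i) \<subseteq> I" for i
  have "I <#> upper_central G U 0 = I"
    using IU Uc unfolding set_mult_def by force
  then have "small 0" unfolding small_def by simp
  moreover have "\<not> small c"
  proof -
    have "U \<subseteq> I <#> upper_central G U c"
      using c Uc subgroup.one_closed[OF I(1)] unfolding set_mult_def by force
    then show ?thesis using proper unfolding small_def by blast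
  qed
  ultimately obtain i where i: "small i" "\<not> small (Suc i)"
    using nat_induct[of small] by blast
  then obtain x where x: "x \<in> C" "x \<in> I <#> upper_central G U (Suc i)" "x \<notin> I"
    unfolding small_def by blast
  then obtain a z where az: "a \<in> I" "z \<in> upper_central G U (Suc i)" "x = a \<otimes> z"
    unfolding set_mult_def by blast
  have zU: "z \<in> U" using az(2) by simp
  have aU: "a \<in> U" using az(1) IU by blast
  \<comment> \<open>For w = bv, t^w = t^b [t^b, v], where t^b is in I and the commutator is in
    Z_i(U); as t^w is also in C, the choice of i puts it into I.\<close>
  have main: "inv w \<otimes> t \<otimes> w \<in> I"
    if w: "w = b \<otimes> v" "b \<in> I" "v \<in> upper_central G U (Suc i)" and t: "t \<in> C \<inter> I" for w b v t
  proof -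
    have vU: "v \<in> U" and bU: "b \<in> U" and tU: "t \<in> U" using w t IU by auto
    have tb: "inv b \<otimes> t \<otimes> b \<in> I"
      using w(2) t I(1) by (simp add: subgroup.m_closed subgroup.m_inv_closed)
    then have tbU: "inv b \<otimes> t \<otimes> b \<in> U" using IU by blast
    have "commutator G v (inv b \<otimes> t \<otimes> b) \<in> upper_central G U i" using w(3) tbU by simp
    then have "inv (commutator G v (inv b \<otimes> t \<otimes> b)) \<in> upper_central G U i"
      by (rule subgroup.m_inv_closed[OF subgroup_upper_central[OF sU]])
    then have "(inv b \<otimes> t \<otimes> b) \<otimes> commutator G (inv b \<otimes> t \<otimes> b) v \<in> I <#> upper_central G U i"
      using tb tbU vU Uc unfolding set_mult_def by (auto simp: inv_commutator)
    moreover have "(inv b \<otimes> t \<otimes> b) \<otimes> commutator G (inv b \<otimes> t \<otimes> b) v = inv w \<otimes> t \<otimes> w"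
      using w(1) vU bU tU Uc by (simp add: word)
    moreover have "inv w \<otimes> t \<otimes> w \<in> C"
      using conj[of t w] t w(1) bU vU sU by (simp add: subgroup.m_closed)
    ultimately show ?thesis using i(1) unfolding small_def by auto
  qed
  have xU: "x \<in> U" using az(3) aU zU sU by (simp add: subgroup.m_closed)
  have xc: "x \<in> carrier G" using xU Uc by blast
  have CIc: "C \<inter> I \<subseteq> carrier G" using CI Uc by blast
  have "x \<in> normalizing G (generate G (C \<inter> I))"
  proof (rule normalizing_generate[OF CIc xc])
    fix t assume t: "t \<in> C \<inter> I"
    show "inv x \<otimes> t \<otimes> x \<in> generate G (C \<inter> I)"
      using main[OF az(3,1,2) t] I(2) by simp
    \<comment> \<open>The inverse of x is again a product of an element of I and one of Z_(i+1)(U),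
      so \<open>main\<close> also covers conjugation by it.\<close>
    have "inv x = inv a \<otimes> (a \<otimes> inv z \<otimes> inv a)"
      using az(3) aU zU Uc by (simp add: word)
    moreover have "inv a \<in> I" using az(1) I(1) by (simp add: subgroup.m_inv_closed)
    moreover have "a \<otimes> inv z \<otimes> inv a \<in> upper_central G U (Suc i)"
    proof -
      have "a \<in> normalizing G (upper_central G U (Suc i))"
        using aU subgroup_le_normalizing[OF sU] normalizing_upper_central[OF sU] by blast
      then show ?thesis
        using subgroup.m_inv_closed[OF subgroup_upper_central[OF sU] az(2)] by (rule normalizingD(2))
    qed
    ultimately have "inv (inv x) \<otimes> t \<otimes> inv x \<in> I" using t by (rule main)
    then show "x \<otimes> t \<otimes> inv x \<in> generate G (C \<inter> I)" using xc I(2) by simp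
  qed
  then show thesis using that x xU I(2) by simp
qed

end

section \<open>Baer's theorem on Engel elements of noetherian groups\<close>

context group
begin

text \<open>Suppose that no nilpotent subgroup contains the class \<open>C\<close> of \<open>g\<close>. Among the pairs
  \<open>U \<noteq> V\<close> of maximal nilpotent subgroups generated by elements of \<open>C\<close>, choose one for which
  \<open>I = \<langle>C \<inter> U \<inter> V\<rangle>\<close> is maximal, and pick \<open>x \<in> C \<inter> U\<close> and \<open>y \<in> C \<inter> V\<close> outside \<open>I\<close>
  normalizing \<open>I\<close>. Then \<open>V\<close> is the only maximal subgroup containing \<open>I\<close> and \<open>y\<close>. As
  \<open>e\<^sub>n(x, y) = 1\<close> for some \<open>n\<close>, descending induction on \<open>i\<close> shows that \<open>e\<^sub>i(x, y)\<close> normalizes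
  \<open>V\<close>; for \<open>i = 0\<close> this makes \<open>\<langle>V, x\<rangle>\<close> nilpotent, so \<open>x \<in> V\<close>, a contradiction.\<close>

theorem baer:
  assumes K: "noetherian_subgroup G K" and gK: "g \<in> K"
    and engel: "\<And>x. x \<in> K \<Longrightarrow> \<exists>n. engel_word G n x g = \<one>"
  shows "nilpotent_subgroup G (generate G ((\<lambda>k. inv k \<otimes> g \<otimes> k) ` K))"
proof -
  have sK: "subgroup K G" using K by (simp add: noetherian_subgroup_def)
  note Kc = subgroup.mem_carrier[OF sK]
  define C where "C = (\<lambda>k. inv k \<otimes> g \<otimes> k) ` K"
  have CK: "C \<subseteq> K"
    using gK sK unfolding C_def by (auto simp: subgroup.m_closed subgroup.m_inv_closed)
  have Ccar: "C \<subseteq> carrier G" using CK Kc by auto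
  have C_conj: "inv u \<otimes> c \<otimes> u \<in> C" if cu: "c \<in> C" "u \<in> K" for c u
  proof -
    obtain k where k: "k \<in> K" "c = inv k \<otimes> g \<otimes> k" using cu(1) unfolding C_def by blast
    then have "inv u \<otimes> c \<otimes> u = inv (k \<otimes> u) \<otimes> g \<otimes> (k \<otimes> u)"
      using cu(2) gK Kc by (simp add: word)
    moreover have "k \<otimes> u \<in> K" using k(1) cu(2) sK by (simp add: subgroup.m_closed)
    ultimately show ?thesis unfolding C_def by blast
  qed
  have C_engel: "\<exists>n. engel_word G n x c = \<one>" if cu: "c \<in> C" "x \<in> K" for c x
  proof -
    obtain k where k: "k \<in> K" "c = inv k \<otimes> g \<otimes> k" using cu(1) unfolding C_def by blast
    have "k \<otimes> x \<otimes> inv k \<in> K"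
      using k(1) cu(2) sK by (simp add: subgroup.m_closed subgroup.m_inv_closed)
    then obtain n where "engel_word G n (k \<otimes> x \<otimes> inv k) g = \<one>" using engel by blast
    then show ?thesis
      using k cu(2) gK Kc by (intro exI[of _ n]) (simp add: engel_word_conj)
  qed
  define \<U> where "\<U> = {U. nilpotent_subgroup G U \<and> U = generate G (C \<inter> U)}"
  define \<M> where "\<M> = {M \<in> \<U>. \<forall>U\<in>\<U>. M \<subseteq> U \<longrightarrow> U = M}"
  have U_sub: "subgroup U G" "U \<subseteq> K" if "U \<in> \<U>" for U
  proof -
    have U: "nilpotent_subgroup G U" "U = generate G (C \<inter> U)" using that unfolding \<U>_def by auto
    show "subgroup U G" using U(1) by (rule nilpotent_subgroupD)
    have "C \<inter> U \<subseteq> K" using CK by blast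
    then show "U \<subseteq> K" using U(2) generate_subgroup_incl[OF _ sK] by blast
  qed
  have U_gen: "generate G S \<in> \<U>" if "nilpotent_subgroup G (generate G S)" "S \<subseteq> C" for S
  proof -
    have "generate G S = generate G (C \<inter> generate G S)"
      using that(2) Ccar generate_incl[of S]
      by (intro generate_generate_eqI) (auto intro: generate.incl)
    then show ?thesis using that(1) unfolding \<U>_def by simp
  qed
  have U_le_M: "\<exists>M\<in>\<M>. U \<subseteq> M" if U: "U \<in> \<U>" for U
  proof -
    have ne: "{V \<in> \<U>. U \<subseteq> V} \<noteq> {}" using U by blast
    have sub: "\<And>S. S \<in> {V \<in> \<U>. U \<subseteq> V} \<Longrightarrow> subgroup S G \<and> S \<subseteq> K" using U_sub by blast
    obtain M where "M \<in> {V \<in> \<U>. U \<subseteq> V}" "\<forall>S\<in>{V \<in> \<U>. U \<subseteq> V}. M \<subseteq> S \<longrightarrow> S = M"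
      by (rule noetherian_subgroup_maximal[OF K ne sub])
    then have "M \<in> \<M>" "U \<subseteq> M" unfolding \<M>_def by blast+
    then show ?thesis by blast
  qed
  have M_maximal: "U = M" if "M \<in> \<M>" "U \<in> \<U>" "M \<subseteq> U" for M U
    using that unfolding \<M>_def by blast
  have MU: "M \<in> \<U>" if "M \<in> \<M>" for M using that unfolding \<M>_def by blast
  \<comment> \<open>Adjoining x to M preserves nilpotency by the Engel property of x, and the result
    is still generated by elements of C; maximality of M does the rest.\<close>
  have M_absorb: "x \<in> M" if M: "M \<in> \<M>" and x: "x \<in> C" "x \<in> normalizing G M" for M x
  proof -
    have nil: "nilpotent_subgroup G M" and gen: "M = generate G (C \<inter> M)"
      using MU[OF M] unfolding \<U>_def by auto
    note sM = U_sub[OF MU[OF M]]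
    have "nilpotent_subgroup G (generate G (insert x M))"
    proof (rule nilpotent_subgroup_insert[OF nil _ x(2)])
      show "noetherian_subgroup G M" by (rule noetherian_subgroup_mono[OF K sM])
      show "\<exists>n. engel_word G n v x = \<one>" if "v \<in> M" for v
        using C_engel[OF x(1)] that sM(2) by blast
    qed
    moreover have eq: "generate G (insert x M) = generate G (insert x (C \<inter> M))"
    proof (rule generate_generate_eqI)
      have "M \<subseteq> generate G (insert x (C \<inter> M))" by (subst gen) (rule mono_generate, blast)
      then show "insert x M \<subseteq> generate G (insert x (C \<inter> M))" by (auto intro: generate.incl)
    qed (use x(1) Ccar sM Kc in \<open>auto intro: generate.incl\<close>)
    ultimately have "generate G (insert x M) \<in> \<U>" using U_gen[of "insert x (C \<inter> M)"] x(1) by simp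
    then have "generate G (insert x M) = M" by (rule M_maximal[OF M]) (auto intro: generate.incl)
    then show ?thesis by (auto intro: generate.incl)
  qed
  have "\<exists>M\<in>\<U>. C \<subseteq> M"
  proof (rule ccontr)
    assume none: "\<not> ?thesis"
    define \<P> where "\<P> = {(U, V). U \<in> \<M> \<and> V \<in> \<M> \<and> U \<noteq> V}"
    have "\<P> \<noteq> {}"
    proof -
      have cyclic: "generate G {c} \<in> \<U>" if "c \<in> C" for c
      proof (rule U_gen)
        have c: "{c} \<subseteq> carrier G" using that Ccar by blast
        have "x \<otimes> y = y \<otimes> x" if gen: "x \<in> generate G {c}" "y \<in> generate G {c}" for x y
        proof -
          have "c \<in> carrier G" using c by blast
          then obtain i j :: int where "x = c [^] i" "y = c [^] j"
            using gen generate_pow by auto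
          then show ?thesis using c by (simp add: int_pow_mult[symmetric] add.commute)
        qed
        then show "nilpotent_subgroup G (generate G {c})"
          by (intro commuting_nilpotent_subgroup generate_is_subgroup c)
      qed (use that in blast)
      have "\<one> \<in> K" using sK by (rule subgroup.one_closed)
      then have "inv \<one> \<otimes> g \<otimes> \<one> \<in> C" unfolding C_def by blast
      then obtain U where U: "U \<in> \<M>" using cyclic U_le_M by blast
      then obtain x where x: "x \<in> C" "x \<notin> U" using none MU by blast
      then obtain V where V: "V \<in> \<M>" "generate G {x} \<subseteq> V" using cyclic U_le_M by blast
      then have "x \<in> V" by (auto intro: generate.incl)
      then show ?thesis using U V x(2) unfolding \<P>_def by blast
    qed
    define inter where "inter = (\<lambda>(U, V). generate G (C \<inter> U \<inter> V))"
    have ne: "inter ` \<P> \<noteq> {}" using \<open>\<P> \<noteq> {}\<close> by blast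
    have sub: "subgroup S G \<and> S \<subseteq> K" if "S \<in> inter ` \<P>" for S
    proof -
      obtain U V where S: "S = generate G (C \<inter> U \<inter> V)"
        using \<open>S \<in> inter ` \<P>\<close> unfolding inter_def by auto
      have "C \<inter> U \<inter> V \<subseteq> K" using CK by blast
      then show ?thesis
        unfolding S using sK Kc by (intro conjI generate_is_subgroup generate_subgroup_incl) auto
    qed
    obtain I where I: "I \<in> inter ` \<P>" "\<forall>S\<in>inter ` \<P>. I \<subseteq> S \<longrightarrow> S = I"
      by (rule noetherian_subgroup_maximal[OF K ne sub])
    from I(1) obtain U V where UV: "U \<in> \<M>" "V \<in> \<M>" "U \<noteq> V" "I = generate G (C \<inter> U \<inter> V)"
      unfolding \<P>_def inter_def by auto
    note sU = U_sub[OF MU[OF UV(1)]] and sV = U_sub[OF MU[OF UV(2)]]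
    have sI: "subgroup I G" unfolding UV(4) using Ccar by (intro generate_is_subgroup) auto
    have IUV: "I \<subseteq> U" "I \<subseteq> V" 
      unfolding UV(4) by (rule generate_subgroup_incl[OF _ sU(1)], blast)
        (rule generate_subgroup_incl[OF _ sV(1)], blast)
    have CI: "C \<inter> I = C \<inter> U \<inter> V"
      using IUV unfolding UV(4) by (auto intro: generate.incl)
    \<comment> \<open>Otherwise the pair (M, V) would have an intersection group containing I and
      also z, against the maximality of I.\<close>
    have unique: "M = V" if "M \<in> \<M>" "I \<subseteq> M" "z \<in> C" "z \<in> M" "z \<in> V" "z \<notin> I" for M z
    proof (rule ccontr)
      assume "M \<noteq> V"
      then have "inter (M, V) \<in> inter ` \<P>" using that(1) UV(2) unfolding \<P>_def by blast
      moreover have "I \<subseteq> inter (M, V)"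
        unfolding inter_def UV(4) prod.case using that(2) CI by (intro mono_generate) auto
      ultimately have "inter (M, V) = I" using I(2) by blast
      moreover have "z \<in> inter (M, V)" unfolding inter_def using that by (auto intro: generate.incl)
      ultimately show False using that(6) by blast
    qed
    have pick: "\<exists>x. x \<in> C \<and> x \<in> M \<and> x \<notin> I \<and> x \<in> normalizing G I"
      if M: "M \<in> \<M>" "M' \<in> \<M>" "M \<noteq> M'" "I \<subseteq> M" "I \<subseteq> M'" for M M'
    proof -
      have nil: "nilpotent_subgroup G M" "M = generate G (C \<inter> M)"
        using MU[OF M(1)] unfolding \<U>_def by auto
      \<comment> \<open>If C \<inter> M were inside I, then M, being generated by it, would lie in I
        and so in M', contradicting maximality.\<close>
      have proper: "\<not> C \<inter> M \<subseteq> I"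
      proof
        assume "C \<inter> M \<subseteq> I"
        then have "M \<subseteq> I" using nil(2) generate_subgroup_incl[OF _ sI] by blast
        then have "M \<subseteq> M'" using M(5) by blast
        then show False using M_maximal[OF M(1) MU[OF M(2)]] M(3) by blast
      qed
      have gI: "I = generate G (C \<inter> I)" using UV(4) CI by simp
      have CIM: "C \<inter> I \<subseteq> M" using M(4) by blast
      have "inv u \<otimes> c \<otimes> u \<in> C" if "c \<in> C" "u \<in> M" for c u
        using C_conj that U_sub(2)[OF MU[OF M(1)]] by blast
      then show ?thesis
        using nilpotent_normalizer_condition[OF nil(1) CIM sI gI _ proper] by metis
    qed
    obtain x where x: "x \<in> C" "x \<in> U" "x \<notin> I" "x \<in> normalizing G I"
      using pick[OF UV(1,2,3) IUV] by blast
    obtain y where y: "y \<in> C" "y \<in> V" "y \<notin> I" "y \<in> normalizing G I"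
      using pick[OF UV(2,1) UV(3)[symmetric] IUV(2,1)] by blast
    have xy: "x \<in> K" "y \<in> K" using x(1) y(1) CK by auto
    define c where "c i = engel_word G i x y" for i
    have cK: "c i \<in> K" for i
      unfolding c_def using xy subgroup_le_normalizing[OF sK]
      by (intro engel_word_in_normalized[OF sK]) auto
    have cI: "c i \<in> normalizing G I" for i
      unfolding c_def
      using x(4) y(4) subgroup_normalizing[OF subgroup.subset[OF sI]]
        subgroup_le_normalizing[OF subgroup_normalizing[OF subgroup.subset[OF sI]]]
      by (intro engel_word_in_normalized) auto
    have nV: "subgroup (normalizing G V) G" by (rule subgroup_normalizing[OF subgroup.subset[OF sV(1)]])
    have step: "c i \<in> normalizing G V" if ci: "c (Suc i) \<in> normalizing G V" for i
    proof -
      let ?f = "\<lambda>t. inv (c i) \<otimes> t \<otimes> c i"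
      have cc: "c i \<in> carrier G" "y \<in> carrier G" using cK xy Kc by auto
      \<comment> \<open>Rewriting of c_(i+1) = [c_i, y]: the conjugate of y by c_i is y
        c_(i+1)^(-1), which normalizes V. Being in C, it is absorbed by V.\<close>
      have "?f y = y \<otimes> inv (c (Suc i))" unfolding c_def using xy Kc by (simp add: word)
      moreover have "y \<in> normalizing G V" using y(2) subgroup_le_normalizing[OF sV(1)] by blast
      ultimately have zn: "?f y \<in> normalizing G V"
        using ci nV by (simp add: subgroup.m_closed subgroup.m_inv_closed)
      have zC: "?f y \<in> C" using y(1) cK by (rule C_conj)
      have zV: "?f y \<in> V" using M_absorb[OF UV(2) zC zn] .
      have zI: "?f y \<notin> I"
      proof
        assume "?f y \<in> I"
        then have "c i \<otimes> ?f y \<otimes> inv (c i) \<in> I" by (rule normalizingD(2)[OF cI])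
        then show False using y(3) cc by (simp add: word)
      qed
      have conj_U: "(\<lambda>t. inv k \<otimes> t \<otimes> k) ` V \<in> \<U>" if k: "k \<in> K" for k
      proof -
        interpret conj: group_hom G G "\<lambda>t. inv k \<otimes> t \<otimes> k" using k Kc by (simp add: conj_hom)
        have V: "nilpotent_subgroup G V" "V = generate G (C \<inter> V)"
          using MU[OF UV(2)] unfolding \<U>_def by auto
        have "(\<lambda>t. inv k \<otimes> t \<otimes> k) ` V = (\<lambda>t. inv k \<otimes> t \<otimes> k) ` generate G (C \<inter> V)"
          using V(2) by simp
        also have "\<dots> = generate G ((\<lambda>t. inv k \<otimes> t \<otimes> k) ` (C \<inter> V))"
          using Ccar by (intro conj.generate_img[symmetric]) auto
        finally have eq: "(\<lambda>t. inv k \<otimes> t \<otimes> k) ` V = generate G ((\<lambda>t. inv k \<otimes> t \<otimes> k) ` (C \<inter> V))" .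
        show ?thesis
          unfolding eq
        proof (rule U_gen)
          show "nilpotent_subgroup G (generate G ((\<lambda>t. inv k \<otimes> t \<otimes> k) ` (C \<inter> V)))"
            using conj.nilpotent_subgroup_image[OF V(1)] eq by simp
          show "(\<lambda>t. inv k \<otimes> t \<otimes> k) ` (C \<inter> V) \<subseteq> C" using C_conj k by blast
        qed
      qed
      \<comment> \<open>A maximal subgroup above the conjugate of V contains I, because c_i
        normalizes I, and the conjugate of y, which lies in V but not in I. By \<open>unique\<close>
        it is V.\<close>
      obtain M where M: "M \<in> \<M>" "?f ` V \<subseteq> M" using U_le_M[OF conj_U[OF cK]] by blast
      have "t \<in> ?f ` V" if t: "t \<in> I" for t
      proof
        show "t = ?f (c i \<otimes> t \<otimes> inv (c i))"
          using t cc subgroup.mem_carrier[OF sI] by (simp add: word)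
        show "c i \<otimes> t \<otimes> inv (c i) \<in> V" using normalizingD(2)[OF cI t] IUV(2) by blast
      qed
      then have "I \<subseteq> M" using M(2) by blast
      moreover have "?f y \<in> M" using y(2) M(2) by blast
      ultimately have "M = V" using unique[OF M(1) _ zC _ zV zI] by blast
      then have fV: "?f ` V \<subseteq> V" using M(2) by blast
      \<comment> \<open>So far only one inclusion is known. Conjugating back turns it into an
        inclusion of V in another nilpotent subgroup generated by elements of C, and maximality of V
        makes it an equality.\<close>
      let ?f' = "\<lambda>t. inv (inv (c i)) \<otimes> t \<otimes> inv (c i)"
      have ff: "?f' (?f v) = v" if "v \<in> V" for v
        using that cc subgroup.mem_carrier[OF sV(1)] by (simp add: word)
      have "V \<subseteq> ?f' ` V"
      proof
        fix v assume v: "v \<in> V"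
        then have "?f v \<in> V" using fV by blast
        then show "v \<in> ?f' ` V" using ff[OF v] by (metis imageI)
      qed
      moreover have "?f' ` V \<in> \<U>" using cK sK by (intro conj_U) (simp add: subgroup.m_inv_closed)
      ultimately have "?f' ` V = V" using M_maximal[OF UV(2)] by blast
      then have "?f' v \<in> V" if "v \<in> V" for v using that by blast
      then show ?thesis
        using fV cc by (intro normalizingI) auto
    qed
    obtain n where "c n = \<one>" unfolding c_def using C_engel[OF y(1) xy(1)] by blast
    then have cn: "c n \<in> normalizing G V" using nV by (simp add: subgroup.one_closed)
    have "c 0 \<in> normalizing G V"
      using le0[of n] cn by (induction rule: inc_induct) (auto intro: step)
    then have "x \<in> normalizing G V" unfolding c_def by simp
    then have "x \<in> V" using M_absorb[OF UV(2) x(1)] by blast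
    then have "x \<in> C \<inter> I" using CI x(1,2) by blast
    then show False using x(3) by blast
  qed
  then obtain M where M: "M \<in> \<U>" "C \<subseteq> M" by blast
  then have "nilpotent_subgroup G M" unfolding \<U>_def by simp
  then have "nilpotent_subgroup G (generate G C)"
    using generate_is_subgroup[OF Ccar] generate_subgroup_incl[OF M(2) U_sub(1)[OF M(1)]]
    by (rule nilpotent_subgroup_mono)
  then show ?thesis unfolding C_def .
qed

end

section \<open>Engel elements of a group with trivial Hirsch-Plotkin radical\<close>

definition engel_elements :: "('a, 'b) monoid_scheme \<Rightarrow> 'a set" where
  "engel_elements G =
     {g \<in> carrier G. \<forall>x\<in>carrier G. \<exists>n. engel_word G n x g = \<one>\<^bsub>G\<^esub>}"

definition centralizing :: "('a, 'b) monoid_scheme \<Rightarrow> 'a set \<Rightarrow> 'a set" where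
  "centralizing G S = {x \<in> carrier G. \<forall>y\<in>S. x \<otimes>\<^bsub>G\<^esub> y = y \<otimes>\<^bsub>G\<^esub> x}"

context group
begin

lemma subgroup_centralizing:
  assumes S: "S \<subseteq> carrier G"
  shows "subgroup (centralizing G S) G"
proof (rule subgroupI)
  show "centralizing G S \<subseteq> carrier G" by (auto simp: centralizing_def)
  have "\<one> \<in> centralizing G S" using S by (auto simp: centralizing_def subset_iff)
  then show "centralizing G S \<noteq> {}" by blast
next
  fix a assume a: "a \<in> centralizing G S"
  have "inv a \<otimes> y = y \<otimes> inv a" if y: "y \<in> S" for y
  proof -
    have ay: "a \<in> carrier G" "y \<in> carrier G" using a y S by (auto simp: centralizing_def)
    have "inv a \<otimes> (a \<otimes> y) \<otimes> inv a = inv a \<otimes> (y \<otimes> a) \<otimes> inv a"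
      using a y by (simp add: centralizing_def)
    then show ?thesis using ay by (simp add: m_assoc)
  qed
  then show "inv a \<in> centralizing G S" using a by (simp add: centralizing_def)
next
  fix a b assume a: "a \<in> centralizing G S" and b: "b \<in> centralizing G S"
  have "a \<otimes> b \<otimes> y = y \<otimes> (a \<otimes> b)" if y: "y \<in> S" for y
  proof -
    have c: "a \<in> carrier G" "b \<in> carrier G" "y \<in> carrier G" "a \<otimes> y = y \<otimes> a" "b \<otimes> y = y \<otimes> b"
      using a b y S by (auto simp: centralizing_def)
    have "a \<otimes> b \<otimes> y = a \<otimes> (y \<otimes> b)" using c by (simp add: m_assoc)
    also have "\<dots> = (y \<otimes> a) \<otimes> b" using c by (simp add: m_assoc[symmetric])
    finally show ?thesis using c by (simp add: m_assoc)
  qed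
  then show "a \<otimes> b \<in> centralizing G S" using a b by (simp add: centralizing_def)
qed

lemma normal_centralizing:
  assumes N: "N \<lhd> G"
  shows "centralizing G N \<lhd> G"
  unfolding normal_inv_iff
proof (intro conjI ballI)
  have sN: "subgroup N G" by (rule normal_imp_subgroup[OF N])
  note Nc = subgroup.mem_carrier[OF sN]
  show "subgroup (centralizing G N) G" using sN by (intro subgroup_centralizing) (rule subgroup.subset)
  fix x h assume x: "x \<in> carrier G" and h: "h \<in> centralizing G N"
  have hc: "h \<in> carrier G" using h by (simp add: centralizing_def)
  have "x \<otimes> h \<otimes> inv x \<otimes> y = y \<otimes> (x \<otimes> h \<otimes> inv x)" if y: "y \<in> N" for y
  proof -
    have "inv x \<otimes> y \<otimes> x \<in> N" by (rule normal.inv_op_closed1[OF N x y])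
    then have "h \<otimes> (inv x \<otimes> y \<otimes> x) = (inv x \<otimes> y \<otimes> x) \<otimes> h" using h by (simp add: centralizing_def)
    then have "x \<otimes> (h \<otimes> (inv x \<otimes> y \<otimes> x)) \<otimes> inv x = x \<otimes> ((inv x \<otimes> y \<otimes> x) \<otimes> h) \<otimes> inv x" by simp
    then show ?thesis using x hc Nc[OF y] by (simp add: word)
  qed
  then show "x \<otimes> h \<otimes> inv x \<in> centralizing G N" using x hc by (simp add: centralizing_def)
qed

lemma normal_Int: "N \<lhd> G \<Longrightarrow> K \<lhd> G \<Longrightarrow> N \<inter> K \<lhd> G"
  unfolding normal_inv_iff by (auto simp: subgroups_Inter_pair)

lemma conj_engel_elements:
  assumes g: "g \<in> engel_elements G" and k: "k \<in> carrier G"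
  shows "inv k \<otimes> g \<otimes> k \<in> engel_elements G"
proof -
  have gc: "g \<in> carrier G" using g by (simp add: engel_elements_def)
  have "\<exists>n. engel_word G n x (inv k \<otimes> g \<otimes> k) = \<one>" if x: "x \<in> carrier G" for x
  proof -
    have "k \<otimes> x \<otimes> inv k \<in> carrier G" using k x by simp
    then obtain n where "engel_word G n (k \<otimes> x \<otimes> inv k) g = \<one>"
      using g by (auto simp: engel_elements_def)
    then show ?thesis using gc k x by (intro exI[of _ n]) (simp add: engel_word_conj)
  qed
  then show ?thesis using gc k by (simp add: engel_elements_def)
qed

lemma locally_noetherian_subgroup_mono:
  "locally_noetherian_subgroup G H \<Longrightarrow> subgroup K G \<Longrightarrow> K \<subseteq> H \<Longrightarrow> locally_noetherian_subgroup G K"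
  unfolding locally_noetherian_subgroup_def by blast

text \<open>B consists of all e_j(a, g) with a in A; it is finite since each sequence reaches 1.
  Conjugation by g is covered by b^g = b [b, g]; the opposite direction runs down from the end of
  the sequence, as g e_i g^(-1) = e_i (g e_(i+1) g^(-1))^(-1).\<close>

lemma engel_invariant_closure:
  assumes H: "subgroup H G" and g: "g \<in> normalizing G H" and A: "finite A" "A \<subseteq> H"
    and engel: "\<And>a. a \<in> A \<Longrightarrow> \<exists>n. engel_word G n a g = \<one>"
  obtains B where "finite B" "A \<subseteq> B" "B \<subseteq> H" "g \<in> normalizing G (generate G B)"
proof -
  have gc: "g \<in> carrier G" using g normalizing_subset by auto
  have Ac: "A \<subseteq> carrier G" using A(2) subgroup.subset[OF H] by blast
  define B where "B = (\<Union>a\<in>A. range (\<lambda>j. engel_word G j a g))"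
  have "finite (range (\<lambda>j. engel_word G j a g))" if a: "a \<in> A" for a
  proof -
    obtain n where n: "engel_word G n a g = \<one>" using engel[OF a] by blast
    have "engel_word G j a g \<in> insert \<one> ((\<lambda>j. engel_word G j a g) ` {..n})" for j
      using engel_word_eq_one_mono[OF n, of j] a Ac gc by (cases "j \<le> n") auto
    then have "range (\<lambda>j. engel_word G j a g) \<subseteq> insert \<one> ((\<lambda>j. engel_word G j a g) ` {..n})" by blast
    then show ?thesis by (rule finite_subset) simp
  qed
  then have "finite B" unfolding B_def using A(1) by simp
  moreover have "A \<subseteq> B"
  proof
    fix a assume "a \<in> A"
    then show "a \<in> B" unfolding B_def by (intro UN_I[of a] range_eqI[of _ _ 0]) simp_all
  qed
  moreover have BH: "B \<subseteq> H" unfolding B_def using A(2) engel_word_in_normalized[OF H _ g] by blast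
  moreover have "g \<in> normalizing G (generate G B)"
  proof -
    have Bc: "B \<subseteq> carrier G" using BH subgroup.subset[OF H] by blast
    have L: "subgroup (generate G B) G" by (rule generate_is_subgroup[OF Bc])
    show ?thesis
    proof (rule normalizing_generate[OF Bc gc])
      fix b assume "b \<in> B"
      then obtain a j where aj: "a \<in> A" "b = engel_word G j a g" unfolding B_def by blast
      have e: "engel_word G i a g \<in> generate G B" for i
        unfolding B_def using aj(1) by (intro generate.incl) blast
      have ec: "engel_word G i a g \<in> carrier G" for i using aj(1) Ac gc by auto
      have "commutator G b g \<in> generate G B" using e[of "Suc j"] aj(2) by simp
      then show "inv g \<otimes> b \<otimes> g \<in> generate G B"
        using e[of j] ec[of j] gc aj(2) by (intro subgroup_conj_commutator[OF L]) auto
      obtain n where n: "engel_word G n a g = \<one>" using engel[OF aj(1)] by blast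
      \<comment> \<open>The descending induction needs a starting index that is at least j and where
        the word is trivial.\<close>
      have "engel_word G (max n j) a g = \<one>"
        using engel_word_eq_one_mono[OF n, of "max n j"] aj(1) Ac gc by auto
      then have base: "g \<otimes> engel_word G (max n j) a g \<otimes> inv g \<in> generate G B"
        using gc by (simp add: generate.one)
      have "j \<le> max n j" by simp
      then have "g \<otimes> engel_word G j a g \<otimes> inv g \<in> generate G B"
      proof (induction rule: inc_induct)
        case base
        then show ?case by (rule \<open>g \<otimes> engel_word G (max n j) a g \<otimes> inv g \<in> generate G B\<close>)
      next
        case (step i)
        have "engel_word G i a g \<otimes> inv (g \<otimes> engel_word G (Suc i) a g \<otimes> inv g) \<in> generate G B"
          using step.IH e[of i] L by (simp add: subgroup.m_closed subgroup.m_inv_closed)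
        moreover have "engel_word G i a g \<otimes> inv (g \<otimes> engel_word G (Suc i) a g \<otimes> inv g)
            = g \<otimes> engel_word G i a g \<otimes> inv g"
          using ec[of i] gc by (simp add: word)
        ultimately show ?case by simp
      qed
      then show "g \<otimes> b \<otimes> inv g \<in> generate G B" using aj(2) by simp
    qed
  qed
  ultimately show thesis using that by blast
qed

text \<open>Finitely many conjugates of g under H involve a finite set E of conjugators. Enlarged to
  B with span normalized by g, it yields the noetherian group \<open>?K\<close>, to which Baer's
  theorem applies.\<close>

lemma locally_nilpotent_Engel_closure:
  assumes H: "H \<lhd> G" and noeth: "locally_noetherian_subgroup G H" and g: "g \<in> engel_elements G"
  shows "locally_nilpotent_subgroup G (generate G ((\<lambda>k. inv k \<otimes> g \<otimes> k) ` H))"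
  unfolding locally_nilpotent_subgroup_def
proof (intro conjI allI impI)
  have sH: "subgroup H G" by (rule normal_imp_subgroup[OF H])
  note Hc = subgroup.mem_carrier[OF sH]
  have gc: "g \<in> carrier G" and engel: "\<And>x. x \<in> carrier G \<Longrightarrow> \<exists>n. engel_word G n x g = \<one>"
    using g by (auto simp: engel_elements_def)
  have gH: "g \<in> normalizing G H" using H gc by (auto simp: normal_iff_normalizing)
  let ?conj = "\<lambda>k. inv k \<otimes> g \<otimes> k"
  have conjH: "?conj ` H \<subseteq> carrier G" using gc Hc by auto
  then show "subgroup (generate G (?conj ` H)) G" by (rule generate_is_subgroup)
  fix A assume A: "finite A \<and> A \<subseteq> generate G (?conj ` H)"
  then obtain F where F: "finite F" "F \<subseteq> ?conj ` H" "A \<subseteq> generate G F"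
    using finite_in_generate[of A "?conj ` H"] by blast
  then obtain E where E: "finite E" "E \<subseteq> H" "F = ?conj ` E" by (meson finite_subset_image)
  have "\<exists>n. engel_word G n a g = \<one>" if "a \<in> E" for a using that E(2) Hc engel by blast
  then obtain B where B: "finite B" "E \<subseteq> B" "B \<subseteq> H" "g \<in> normalizing G (generate G B)"
    using engel_invariant_closure[OF sH gH E(1,2)] by metis
  let ?K = "generate G (insert g (generate G B))"
  have Bc: "B \<subseteq> carrier G" using B(3) Hc by blast
  have sK: "subgroup ?K G" using gc generate_incl[OF Bc] by (intro generate_is_subgroup) auto
  note Kc = subgroup.mem_carrier[OF sK]
  have "noetherian_subgroup G (generate G B)"
    using noeth B(1,3) unfolding locally_noetherian_subgroup_def by blast
  then have "noetherian_subgroup G ?K" using B(4) by (rule noetherian_subgroup_insert)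
  moreover have "g \<in> ?K" by (auto intro: generate.incl)
  ultimately have nil: "nilpotent_subgroup G (generate G (?conj ` ?K))"
    using Kc engel by (intro baer) auto
  have EK: "E \<subseteq> ?K" using B(2) by (auto intro!: generate.incl)
  then have "generate G F \<subseteq> generate G (?conj ` ?K)" unfolding E(3) by (intro mono_generate) blast
  then have AK: "A \<subseteq> generate G (?conj ` ?K)" using F(3) by blast
  then have "A \<subseteq> carrier G" using subgroup.subset[OF nilpotent_subgroupD[OF nil]] by blast
  then show "nilpotent_subgroup G (generate G A)"
    using nilpotent_subgroup_mono[OF nil generate_is_subgroup]
      generate_subgroup_incl[OF AK nilpotent_subgroupD[OF nil]] by blast
qed

text \<open>The group \<open>?N\<close> is the Hirsch-Plotkin radical of H. Conjugation by elements
  of G permutes the subgroups generating it, so it is normal in G and therefore trivial.\<close>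

lemma locally_nilpotent_normal_in_normal_trivial:
  assumes HP: "HP_radical G = {\<one>}" and H: "H \<lhd> G"
    and D: "locally_nilpotent_subgroup G D" "D \<subseteq> H" "H \<subseteq> normalizing G D"
  shows "D \<subseteq> {\<one>}"
proof -
  have sH: "subgroup H G" by (rule normal_imp_subgroup[OF H])
  note Hc = subgroup.mem_carrier[OF sH]
  define \<D> where "\<D> = {S. locally_nilpotent_subgroup G S \<and> S \<subseteq> H \<and> H \<subseteq> normalizing G S}"
  let ?N = "generate G (\<Union>\<D>)"
  have "locally_nilpotent_subgroup G ?N"
    by (rule hirsch_plotkin_Union) (auto simp: \<D>_def)
  moreover have "?N \<lhd> G"
    unfolding normal_iff_normalizing
  proof (intro conjI)
    have Dc: "\<Union>\<D> \<subseteq> carrier G" unfolding \<D>_def using Hc by blast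
    then show "subgroup ?N G" by (rule generate_is_subgroup)
    have conj: "inv c \<otimes> a \<otimes> c \<in> ?N" if c: "c \<in> carrier G" and a: "a \<in> \<Union>\<D>" for a c
    proof -
      interpret conj: group_hom G G "\<lambda>x. inv c \<otimes> x \<otimes> c" using c by (rule conj_hom)
      obtain S where S: "a \<in> S" "locally_nilpotent_subgroup G S" "S \<subseteq> H" "H \<subseteq> normalizing G S"
        using a unfolding \<D>_def by blast
      let ?S = "(\<lambda>x. inv c \<otimes> x \<otimes> c) ` S"
      have "locally_nilpotent_subgroup G ?S" by (rule conj.locally_nilpotent_subgroup_image[OF S(2)])
      moreover have "?S \<subseteq> H" using S(3) normal.inv_op_closed1[OF H c] by blast
      moreover have "H \<subseteq> normalizing G ?S"
      proof
        fix h assume h: "h \<in> H"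
        have k: "c \<otimes> h \<otimes> inv c \<in> normalizing G S"
          using normal.inv_op_closed2[OF H c h] S(4) by blast
        show "h \<in> normalizing G ?S"
        proof (rule normalizingI)
          fix s assume "s \<in> ?S"
          then obtain t where t: "t \<in> S" "s = inv c \<otimes> t \<otimes> c" by blast
          have tc: "t \<in> carrier G" using t(1) S(3) Hc by blast
          have "inv h \<otimes> s \<otimes> h = inv c \<otimes> (inv (c \<otimes> h \<otimes> inv c) \<otimes> t \<otimes> (c \<otimes> h \<otimes> inv c)) \<otimes> c"
            using t(2) tc c Hc[OF h] by (simp add: word)
          then show "inv h \<otimes> s \<otimes> h \<in> ?S" using normalizingD(1)[OF k t(1)] by blast
          have "h \<otimes> s \<otimes> inv h = inv c \<otimes> ((c \<otimes> h \<otimes> inv c) \<otimes> t \<otimes> inv (c \<otimes> h \<otimes> inv c)) \<otimes> c"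
            using t(2) tc c Hc[OF h] by (simp add: word)
          then show "h \<otimes> s \<otimes> inv h \<in> ?S" using normalizingD(2)[OF k t(1)] by blast
        qed (rule Hc[OF h])
      qed
      ultimately have "?S \<in> \<D>" unfolding \<D>_def by blast
      then show ?thesis using S(1) by (intro generate.incl) blast
    qed
    show "carrier G \<subseteq> normalizing G ?N"
    proof
      fix c assume c: "c \<in> carrier G"
      show "c \<in> normalizing G ?N"
        using conj[OF c] conj[OF inv_closed[OF c]] c by (intro normalizing_generate[OF Dc c]) auto
    qed
  qed
  ultimately have "?N \<subseteq> {\<one>}" using HP_radical_upper HP by blast
  moreover have "D \<subseteq> ?N" using D unfolding \<D>_def by (auto intro: generate.incl)
  ultimately show ?thesis by blast
qed

text \<open>The span \<open>?T\<close> of the conjugates of g under H is normalized by H, though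
  perhaps not by G; this is why triviality is required for subgroups that are normal only in
  H.\<close>

lemma engel_centralizes_locally_noetherian:
  assumes HP: "HP_radical G = {\<one>}"
    and H: "H \<lhd> G" and noeth: "locally_noetherian_subgroup G H" and g: "g \<in> engel_elements G"
  shows "g \<in> centralizing G H"
proof -
  have sH: "subgroup H G" by (rule normal_imp_subgroup[OF H])
  note Hc = subgroup.mem_carrier[OF sH]
  have gc: "g \<in> carrier G" using g by (simp add: engel_elements_def)
  let ?C = "(\<lambda>k. inv k \<otimes> g \<otimes> k) ` H"
  let ?T = "generate G ?C"
  have Cc: "?C \<subseteq> carrier G" using gc Hc by auto
  have sT: "subgroup ?T G" by (rule generate_is_subgroup[OF Cc])
  have sD: "subgroup (?T \<inter> H) G" using sT sH by (rule subgroups_Inter_pair)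
  have HT: "H \<subseteq> normalizing G ?T"
  proof (rule normalizing_generate_symmetric[OF Cc subgroup.subset[OF sH] subgroup.m_inv_closed[OF sH]])
    fix x a assume x: "x \<in> H" and "a \<in> ?C"
    then obtain k where k: "k \<in> H" "a = inv k \<otimes> g \<otimes> k" by blast
    have "inv x \<otimes> a \<otimes> x = inv (k \<otimes> x) \<otimes> g \<otimes> (k \<otimes> x)" using x k gc Hc by (simp add: word)
    moreover have "k \<otimes> x \<in> H" using k(1) x sH by (simp add: subgroup.m_closed)
    ultimately show "inv x \<otimes> a \<otimes> x \<in> ?T" by (auto intro: generate.incl)
  qed
  have "H \<subseteq> normalizing G (?T \<inter> H)"
  proof
    fix h assume h: "h \<in> H"
    then have "h \<in> normalizing G ?T" "h \<in> normalizing G H"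
      using HT subgroup_le_normalizing[OF sH] by auto
    then show "h \<in> normalizing G (?T \<inter> H)" by (simp add: normalizing_def)
  qed
  moreover have "locally_nilpotent_subgroup G (?T \<inter> H)"
    using locally_nilpotent_subgroup_mono[OF locally_nilpotent_Engel_closure[OF H noeth g] sD] by blast
  ultimately have triv: "?T \<inter> H \<subseteq> {\<one>}"
    using locally_nilpotent_normal_in_normal_trivial[OF HP H] by blast
  have "commutator G h g = \<one>" if h: "h \<in> H" for h
  proof -
    have hc: "h \<in> carrier G" using h by (rule Hc)
    have "inv \<one> \<otimes> g \<otimes> \<one> \<in> ?C" using subgroup.one_closed[OF sH] by blast
    then have "g \<in> ?T" using gc by (auto intro: generate.incl)
    moreover have "inv h \<otimes> g \<otimes> h \<in> ?T" using h by (auto intro: generate.incl)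
    ultimately have "inv (inv h \<otimes> g \<otimes> h) \<otimes> g \<in> ?T"
      using sT by (simp add: subgroup.m_closed subgroup.m_inv_closed)
    then have "commutator G h g \<in> ?T" using hc gc by (simp add: word)
    moreover have "commutator G h g \<in> H"
      using h H gc by (intro commutator_in_normalized[OF sH]) (auto simp: normal_iff_normalizing)
    ultimately show ?thesis using triv by blast
  qed
  then have "h \<otimes> g = g \<otimes> h" if "h \<in> H" for h
    using that gc Hc by (simp add: commutator_eq_one_iff[symmetric])
  then show ?thesis using gc by (simp add: centralizing_def)
qed

text \<open>The intersection is the center of N: an abelian normal subgroup of G.\<close>

lemma normal_Int_centralizing_trivial:
  assumes HP: "HP_radical G = {\<one>}" and N: "N \<lhd> G"
  shows "N \<inter> centralizing G N = {\<one>}"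
proof -
  have Z: "N \<inter> centralizing G N \<lhd> G" using N by (intro normal_Int normal_centralizing)
  then have sZ: "subgroup (N \<inter> centralizing G N) G" by (rule normal_imp_subgroup)
  then have "nilpotent_subgroup G (N \<inter> centralizing G N)"
    by (rule commuting_nilpotent_subgroup) (unfold centralizing_def, blast)
  then have "N \<inter> centralizing G N \<subseteq> {\<one>}"
    using HP_radical_upper[OF Z] HP nilpotent_imp_locally_nilpotent_subgroup by blast
  then show ?thesis using subgroup.one_closed[OF sZ] by blast
qed

lemma r_coset_eq_iff:
  assumes "subgroup M G" "x \<in> carrier G" "y \<in> carrier G"
  shows "M #> x = M #> y \<longleftrightarrow> x \<otimes> inv y \<in> M"
proof
  have M: "M \<subseteq> carrier G" using assms(1) by (rule subgroup.subset)
  have c: "x \<otimes> inv y \<in> carrier G" using assms by simp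
  show "x \<otimes> inv y \<in> M" if "M #> x = M #> y"
    using coset_mult_inv2[OF that assms(2,3) M] c assms(1) by (rule coset_join1)
  show "M #> x = M #> y" if "x \<otimes> inv y \<in> M"
    using coset_join2[OF c assms(1) that] assms(2,3) M by (rule coset_mult_inv1)
qed

lemma quotient_hom: "N \<lhd> G \<Longrightarrow> group_hom G (G Mod N) (\<lambda>x. N #> x)"
  by (simp add: group_hom_def group_hom_axioms_def normal.factorgroup_is_group
      normal.r_coset_hom_Mod)

text \<open>Put \<open>D = H \<inter> C(M)\<close>. As \<open>D \<inter> M\<close> is trivial, \<open>D\<close> embeds into \<open>H/M\<close>; hence Engel
  elements centralize \<open>D\<close>. For \<open>h\<close> in \<open>H\<close> the commutator \<open>[h, g]\<close> lies in \<open>D\<close> and is a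
  quotient of Engel elements, so it lies in the center of \<open>D\<close>.\<close>

lemma engel_centralizes_extension:
  assumes HP: "HP_radical G = {\<one>}" and M: "M \<lhd> G" and H: "H \<lhd> G"
    and noeth: "locally_noetherian_subgroup (G Mod M) ((\<lambda>x. M #> x) ` H)"
    and centr: "engel_elements G \<subseteq> centralizing G M"
  shows "engel_elements G \<subseteq> centralizing G H"
proof
  fix g assume g: "g \<in> engel_elements G"
  then have gc: "g \<in> carrier G" by (simp add: engel_elements_def)
  have sM: "subgroup M G" and sH: "subgroup H G" using M H by (auto intro: normal_imp_subgroup)
  note Hc = subgroup.mem_carrier[OF sH]
  interpret quot: group_hom G "G Mod M" "\<lambda>x. M #> x" by (rule quotient_hom[OF M])
  define D where "D = H \<inter> centralizing G M"
  have nC: "centralizing G M \<lhd> G" by (rule normal_centralizing[OF M])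
  have sC: "subgroup (centralizing G M) G" by (rule normal_imp_subgroup[OF nC])
  have nD: "D \<lhd> G" unfolding D_def using H nC by (rule normal_Int)
  have sD: "subgroup D G" by (rule normal_imp_subgroup[OF nD])
  note Dc = subgroup.mem_carrier[OF sD]
  have "inj_on (\<lambda>x. M #> x) D"
  proof (rule inj_onI)
    fix x y assume xy: "x \<in> D" "y \<in> D" "M #> x = M #> y"
    then have "x \<otimes> inv y \<in> M" using r_coset_eq_iff[OF sM] Dc by blast
    moreover have "x \<otimes> inv y \<in> centralizing G M"
      using xy sC unfolding D_def by (simp add: subgroup.m_closed subgroup.m_inv_closed)
    ultimately have "x \<otimes> inv y = \<one>" using normal_Int_centralizing_trivial[OF HP M] by blast
    then show "x = y" using xy(1,2) Dc by (metis inv_closed inv_equality inv_inv)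
  qed
  moreover have "locally_noetherian_subgroup (G Mod M) ((\<lambda>x. M #> x) ` D)"
    using noeth quot.subgroup_img_is_subgroup[OF sD]
    by (rule quot.H.locally_noetherian_subgroup_mono) (auto simp: D_def)
  ultimately have noethD: "locally_noetherian_subgroup G D"
    by (rule quot.locally_noetherian_subgroup_inj[OF sD])
  have central: "engel_elements G \<subseteq> centralizing G D"
    using engel_centralizes_locally_noetherian[OF HP nD noethD] by blast
  have sCD: "subgroup (centralizing G D) G" by (intro subgroup_centralizing subgroup.subset[OF sD])
  have "commutator G h g = \<one>" if h: "h \<in> H" for h
  proof -
    have hc: "h \<in> carrier G" using h by (rule Hc)
    have gh: "inv h \<otimes> g \<otimes> h \<in> engel_elements G" by (rule conj_engel_elements[OF g hc])
    have eq: "commutator G h g = inv (inv h \<otimes> g \<otimes> h) \<otimes> g" using hc gc by (simp add: word)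
    \<comment> \<open>Stated for every subgroup S containing the Engel elements, because it is
      applied to both C(M) and C(D).\<close>
    have "inv (inv h \<otimes> g \<otimes> h) \<otimes> g \<in> S"
      if "subgroup S G" "engel_elements G \<subseteq> S" for S
      using that g gh by (meson subgroup.m_closed subgroup.m_inv_closed subsetD)
    note quotient = this[folded eq]
    have "commutator G h g \<in> centralizing G M" using sC centr by (rule quotient)
    moreover have "commutator G h g \<in> H"
      using h H gc by (intro commutator_in_normalized[OF sH]) (auto simp: normal_iff_normalizing)
    moreover have "commutator G h g \<in> centralizing G D" using sCD central by (rule quotient)
    ultimately show ?thesis using normal_Int_centralizing_trivial[OF HP nD] unfolding D_def by blast
  qed
  then have "h \<otimes> g = g \<otimes> h" if "h \<in> H" for h
    using that gc Hc by (simp add: commutator_eq_one_iff[symmetric])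
  then show "g \<in> centralizing G H" using gc by (simp add: centralizing_def)
qed

end

section \<open>Radical series\<close>

context group
begin

lemma radical_step_properties:
  assumes F: "\<And>\<Gamma>. group \<Gamma> \<Longrightarrow> F \<Gamma> \<lhd> \<Gamma>" and N: "N \<lhd> G"
  shows "radical_step F G N \<lhd> G" "N \<subseteq> radical_step F G N"
proof -
  interpret quot: group_hom G "G Mod N" "\<lambda>x. N #> x" by (rule quotient_hom[OF N])
  have FN: "F (G Mod N) \<lhd> G Mod N" by (rule F) (rule quot.H.is_group)
  then show "radical_step F G N \<lhd> G"
    unfolding radical_step_def by (rule quot.normal_vimage)
  have sN: "subgroup N G" by (rule normal_imp_subgroup[OF N])
  have "N \<in> F (G Mod N)" using subgroup.one_closed[OF normal_imp_subgroup[OF FN]] by simp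
  then show "N \<subseteq> radical_step F G N"
    using subgroup.mem_carrier[OF sN] coset_join2[OF _ sN] unfolding radical_step_def by auto
qed

lemma upper_series_nat_normal:
  assumes F: "\<And>\<Gamma>. group \<Gamma> \<Longrightarrow> F \<Gamma> \<lhd> \<Gamma>"
  shows "upper_series F G natLeq k \<lhd> G"
proof (induction k)
  case 0
  then show ?case by (simp add: upper_series_nat one_is_normal)
next
  case (Suc k)
  then show ?case by (simp add: upper_series_nat radical_step_properties[OF F])
qed

text \<open>Normality and monotonicity are proved together: at a limit stage the union is a subgroup
  only because the earlier stages form a chain.\<close>

lemma upper_series_normal_increasing:
  assumes F: "\<And>\<Gamma>. group \<Gamma> \<Longrightarrow> F \<Gamma> \<lhd> \<Gamma>" and r: "Well_order r"
  shows "i \<in> Field r \<Longrightarrow>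
    upper_series F G r i \<lhd> G \<and> (\<forall>j\<in>underS r i. upper_series F G r j \<subseteq> upper_series F G r i)"
proof -
  let ?S = "upper_series F G r"
  have wf: "wf (r - Id)" using r unfolding well_order_on_def by auto
  have po: "Refl r" "Total r" using r
    unfolding well_order_on_def linear_order_on_def partial_order_on_def preorder_on_def by auto
  show "i \<in> Field r \<Longrightarrow> ?S i \<lhd> G \<and> (\<forall>j\<in>underS r i. ?S j \<subseteq> ?S i)"
  proof (induction i rule: wf_induct_rule[OF wf])
    case (1 i)
    have IH: "?S j \<lhd> G \<and> (\<forall>k\<in>underS r j. ?S k \<subseteq> ?S j)" if "j \<in> underS r i" for j
      using 1(1)[of j] that by (auto simp: underS_def intro: FieldI1)
    show ?case
    proof (cases "underS r i = {}")
      case True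
      then show ?thesis using upper_series_zero[OF r 1(2) True, of F G] by (simp add: one_is_normal)
    next
      case ne: False
      show ?thesis
      proof (cases "\<exists>j. underS r i = under r j")
        case True
        then obtain j where j: "underS r i = under r j" by blast
        then have jF: "j \<in> Field r" using ne by (auto simp: under_def intro: FieldI2)
        then have ji: "j \<in> underS r i" using j po(1) by (auto simp: under_def refl_on_def)
        note Si = upper_series_succ[OF r 1(2) ne j, of F G]
        note step = radical_step_properties[OF F conjunct1[OF IH[OF ji]]]
        have "?S k \<subseteq> ?S i" if "k \<in> underS r i" for k
        proof (cases "k = j")
          case True
          then show ?thesis using step(2) Si by simp
        next
          case False
          then have "k \<in> underS r j" using that j by (auto simp: under_def underS_def)
          then show ?thesis using IH[OF ji] step(2) Si by blast
        qed
        then show ?thesis using step(1) Si by simp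
      next
        case False
        note Si = upper_series_limit[OF r 1(2) ne False, of F G]
        have sub: "subgroup (?S j) G" if "j \<in> underS r i" for j
          using IH[OF that] by (blast intro: normal_imp_subgroup)
        have "?S i \<lhd> G"
          unfolding normal_inv_iff Si
        proof (intro conjI ballI)
          show "subgroup (\<Union>j\<in>underS r i. ?S j) G"
          proof (rule subgroupI)
            show "(\<Union>j\<in>underS r i. ?S j) \<subseteq> carrier G" using subgroup.mem_carrier[OF sub] by blast
            show "(\<Union>j\<in>underS r i. ?S j) \<noteq> {}" using ne subgroup.one_closed[OF sub] by blast
            show "inv a \<in> (\<Union>j\<in>underS r i. ?S j)" if "a \<in> (\<Union>j\<in>underS r i. ?S j)" for a
              using that subgroup.m_inv_closed[OF sub] by blast
            show "a \<otimes> b \<in> (\<Union>j\<in>underS r i. ?S j)"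
              if ab: "a \<in> (\<Union>j\<in>underS r i. ?S j)" "b \<in> (\<Union>j\<in>underS r i. ?S j)" for a b
            proof -
              obtain j k where jk: "j \<in> underS r i" "k \<in> underS r i" "a \<in> ?S j" "b \<in> ?S k"
                using ab by blast
              then have "j \<in> Field r" "k \<in> Field r" by (auto simp: underS_def intro: FieldI1)
              then have "j = k \<or> j \<in> underS r k \<or> k \<in> underS r j"
                using po(2) unfolding underS_def total_on_def by auto
              then have "\<exists>l\<in>underS r i. a \<in> ?S l \<and> b \<in> ?S l" using jk IH by blast
              then show ?thesis using subgroup.m_closed[OF sub] by blast
            qed
          qed
          fix x y assume "x \<in> carrier G" "y \<in> (\<Union>j\<in>underS r i. ?S j)"
          then show "x \<otimes> y \<otimes> inv x \<in> (\<Union>j\<in>underS r i. ?S j)"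
            using IH normal.inv_op_closed2 by fast
        qed
        then show ?thesis using Si by blast
      qed
    qed
  qed
qed

end

context group_hom
begin

text \<open>The induced map G/M \<rightarrow> H/h(M), along which locally noetherian subgroups are
  transported.\<close>

lemma quotient_image:
  assumes surj: "h ` carrier G = carrier H" and M: "M \<lhd> G"
  obtains f where "group_hom (G Mod M) (H Mod (h ` M)) f"
    "\<And>x. x \<in> carrier G \<Longrightarrow> f (M #>\<^bsub>G\<^esub> x) = h ` M #>\<^bsub>H\<^esub> h x"
proof -
  have nM: "h ` M \<lhd> H" using M surj by (rule normal_image)
  have sM: "subgroup M G" "subgroup (h ` M) H" using M nM by (auto intro: normal_imp_subgroup)
  interpret qG: group_hom G "G Mod M" "\<lambda>x. M #>\<^bsub>G\<^esub> x" by (rule G.quotient_hom[OF M])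
  interpret qH: group_hom H "H Mod (h ` M)" "\<lambda>y. h ` M #>\<^bsub>H\<^esub> y" by (rule H.quotient_hom[OF nM])
  have hom: "(\<lambda>x. h ` M #>\<^bsub>H\<^esub> h x) \<in> hom G (H Mod (h ` M))"
    using qH.hom_mult qH.hom_closed by (intro homI) auto
  have "h ` M #>\<^bsub>H\<^esub> h x = h ` M #>\<^bsub>H\<^esub> h y"
    if "x \<in> carrier G" "y \<in> carrier G" "M #>\<^bsub>G\<^esub> x = M #>\<^bsub>G\<^esub> y" for x y
  proof -
    have "h (x \<otimes>\<^bsub>G\<^esub> inv\<^bsub>G\<^esub> y) \<in> h ` M" using that G.r_coset_eq_iff[OF sM(1)] by blast
    then show ?thesis using that H.r_coset_eq_iff[OF sM(2)] by simp
  qed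
  from FactGroup_universal[OF hom M this]
  obtain f where "f \<in> hom (G Mod M) (H Mod (h ` M))"
    "\<And>x. x \<in> carrier G \<Longrightarrow> f (M #>\<^bsub>G\<^esub> x) = h ` M #>\<^bsub>H\<^esub> h x" by blast
  moreover from this(1) have "group_hom (G Mod M) (H Mod (h ` M)) f"
    by (simp add: group_hom_def group_hom_axioms_def qG.H.is_group qH.H.is_group)
  ultimately show thesis using that by blast
qed

text \<open>The radical is known only through its generating subgroups N. The set \<open>E\<close>
  of elements whose image commutes with all Engel elements is a subgroup containing M, so it
  suffices to put the full preimage L of each N into \<open>E\<close>.\<close>

lemma engel_centralizes_radical_step:
  assumes surj: "h ` carrier G = carrier H" and HP: "HP_radical H = {\<one>\<^bsub>H\<^esub>}"
    and M: "M \<lhd> G" and centr: "engel_elements H \<subseteq> centralizing H (h ` M)"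
  shows "engel_elements H \<subseteq> centralizing H (h ` radical_step NR_radical G M)"
proof -
  have sM: "subgroup M G" by (rule normal_imp_subgroup[OF M])
  interpret qG: group_hom G "G Mod M" "\<lambda>x. M #>\<^bsub>G\<^esub> x" by (rule G.quotient_hom[OF M])
  have nM: "h ` M \<lhd> H" using M surj by (rule normal_image)
  define C where "C = centralizing H (engel_elements H)"
  have eng: "engel_elements H \<subseteq> carrier H" by (auto simp: engel_elements_def)
  have sC: "subgroup C H" unfolding C_def using eng by (rule H.subgroup_centralizing)
  have C_iff: "engel_elements H \<subseteq> centralizing H S \<longleftrightarrow> S \<subseteq> C" if "S \<subseteq> carrier H" for S
    using that eng unfolding C_def centralizing_def by (auto simp: subset_iff)
  define E where "E = {x \<in> carrier G. h x \<in> C}"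
  have sE: "subgroup E G"
  proof (rule G.subgroupI)
    show "E \<subseteq> carrier G" by (auto simp: E_def)
    have "\<one>\<^bsub>G\<^esub> \<in> E" unfolding E_def using subgroup.one_closed[OF sC] by simp
    then show "E \<noteq> {}" by blast
    show "inv\<^bsub>G\<^esub> a \<in> E" if "a \<in> E" for a
      using that sC unfolding E_def by (simp add: subgroup.m_inv_closed)
    show "a \<otimes>\<^bsub>G\<^esub> b \<in> E" if "a \<in> E" "b \<in> E" for a b
      using that sC unfolding E_def by (simp add: subgroup.m_closed)
  qed
  have ME: "M \<subseteq> E"
  proof -
    have "h ` M \<subseteq> C" using centr C_iff subgroup.subset[OF normal_imp_subgroup[OF nM]] by blast
    then show ?thesis unfolding E_def using subgroup.subset[OF sM] by blast
  qed
  have "N \<subseteq> (\<lambda>x. M #>\<^bsub>G\<^esub> x) ` E"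
    if N: "N \<lhd> G Mod M" and noeth: "locally_noetherian ((G Mod M)\<lparr>carrier := N\<rparr>)" for N
  proof -
    have sN: "subgroup N (G Mod M)" by (rule normal_imp_subgroup[OF N])
    define L where "L = {x \<in> carrier G. M #>\<^bsub>G\<^esub> x \<in> N}"
    have nL: "L \<lhd> G" unfolding L_def using N by (rule qG.normal_vimage)
    have NL: "N = (\<lambda>x. M #>\<^bsub>G\<^esub> x) ` L"
      using subgroup.subset[OF sN] unfolding L_def carrier_FactGroup by blast
    have noethN: "locally_noetherian_subgroup (G Mod M) N"
      by (rule qG.H.locally_noetherian_imp_locally_noetherian_subgroup[OF sN noeth])
    obtain f where f: "group_hom (G Mod M) (H Mod (h ` M)) f"
      "\<And>x. x \<in> carrier G \<Longrightarrow> f (M #>\<^bsub>G\<^esub> x) = h ` M #>\<^bsub>H\<^esub> h x"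
      using quotient_image[OF surj M] by blast
    have "f ` N = (\<lambda>y. h ` M #>\<^bsub>H\<^esub> y) ` h ` L"
      unfolding NL image_image using f(2) by (intro image_cong) (auto simp: L_def)
    then have "locally_noetherian_subgroup (H Mod (h ` M)) ((\<lambda>y. h ` M #>\<^bsub>H\<^esub> y) ` h ` L)"
      using group_hom.locally_noetherian_subgroup_image[OF f(1) noethN] by simp
    then have "engel_elements H \<subseteq> centralizing H (h ` L)"
      by (rule H.engel_centralizes_extension[OF HP nM normal_image[OF nL surj] _ centr])
    moreover have "L \<subseteq> carrier G" unfolding L_def by blast
    moreover from this have "h ` L \<subseteq> carrier H" using hom_closed by blast
    ultimately have "L \<subseteq> E" using C_iff[of "h ` L"] unfolding E_def by blast
    then show ?thesis unfolding NL by (rule image_mono)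
  qed
  then have "NR_radical (G Mod M) \<subseteq> (\<lambda>x. M #>\<^bsub>G\<^esub> x) ` E"
    unfolding NR_radical_def
    by (intro qG.H.generate_subgroup_incl qG.subgroup_img_is_subgroup[OF sE]) blast
  then have "radical_step NR_radical G M \<subseteq> E"
  proof (intro subsetI)
    fix x assume NR: "NR_radical (G Mod M) \<subseteq> (\<lambda>x. M #>\<^bsub>G\<^esub> x) ` E"
      and x: "x \<in> radical_step NR_radical G M"
    then have xc: "x \<in> carrier G" by (simp add: radical_step_def)
    obtain e where e: "e \<in> E" "M #>\<^bsub>G\<^esub> x = M #>\<^bsub>G\<^esub> e"
      using NR x unfolding radical_step_def by blast
    have ec: "e \<in> carrier G" using e(1) by (simp add: E_def)
    have "x \<otimes>\<^bsub>G\<^esub> inv\<^bsub>G\<^esub> e \<in> E" using e(2) G.r_coset_eq_iff[OF sM xc ec] ME by blast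
    then have "x \<otimes>\<^bsub>G\<^esub> inv\<^bsub>G\<^esub> e \<otimes>\<^bsub>G\<^esub> e \<in> E" using e(1) sE by (simp add: subgroup.m_closed)
    then show "x \<in> E" using xc ec by (simp add: G.m_assoc)
  qed
  then have "h ` radical_step NR_radical G M \<subseteq> C" unfolding E_def by blast
  then show ?thesis using C_iff subgroup.subset[OF sC] by blast
qed

text \<open>The induction follows the series of G and looks only at the images of its stages in H;
  at the end these cover H, so Engel elements lie in its trivial center.\<close>

lemma engel_trivial:
  assumes surj: "h ` carrier G = carrier H" and HP: "HP_radical H = {\<one>\<^bsub>H\<^esub>}"
    and NR: "upper_radical NR_radical G = carrier G"
  shows "engel_elements H \<subseteq> {\<one>\<^bsub>H\<^esub>}"
proof -
  define r where "r = card_of (Pow (carrier G))"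
  have r: "Well_order r" unfolding r_def by simp
  have wf: "wf (r - Id)" using r unfolding well_order_on_def by auto
  have po: "Refl r" using r
    unfolding well_order_on_def linear_order_on_def partial_order_on_def preorder_on_def by auto
  let ?S = "upper_series NR_radical G r"
  have normal: "?S i \<lhd> G" if "i \<in> Field r" for i
    using G.upper_series_normal_increasing[OF group.normal_NR_radical r that] by blast
  have centr: "engel_elements H \<subseteq> centralizing H (h ` ?S i)" if "i \<in> Field r" for i
    using that
  proof (induction i rule: wf_induct_rule[OF wf])
    case (1 i)
    have IH: "engel_elements H \<subseteq> centralizing H (h ` ?S j)" if "j \<in> underS r i" for j
      using 1(1)[of j] that by (auto simp: underS_def intro: FieldI1)
    show ?case
    proof (cases "underS r i = {}")
      case True
      then show ?thesis
        using upper_series_zero[OF r 1(2) True, of NR_radical G]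
        by (auto simp: centralizing_def engel_elements_def)
    next
      case ne: False
      show ?thesis
      proof (cases "\<exists>j. underS r i = under r j")
        case True
        then obtain j where j: "underS r i = under r j" by blast
        then have jF: "j \<in> Field r" using ne by (auto simp: under_def intro: FieldI2)
        then have "j \<in> underS r i" using j po by (auto simp: under_def refl_on_def)
        then have "engel_elements H \<subseteq> centralizing H (h ` radical_step NR_radical G (?S j))"
          by (intro engel_centralizes_radical_step[OF surj HP normal[OF jF]] IH)
        then show ?thesis using upper_series_succ[OF r 1(2) ne j, of NR_radical G] by simp
      next
        case False
        have "engel_elements H \<subseteq> centralizing H (h ` (\<Union>j\<in>underS r i. ?S j))"
        proof
          fix c assume c: "c \<in> engel_elements H"
          have "c \<otimes>\<^bsub>H\<^esub> y = y \<otimes>\<^bsub>H\<^esub> c" if y: "y \<in> h ` (\<Union>j\<in>underS r i. ?S j)" for y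
          proof -
            obtain j where "j \<in> underS r i" "y \<in> h ` ?S j" using y by blast
            then show ?thesis using IH[of j] c unfolding centralizing_def by blast
          qed
          then show "c \<in> centralizing H (h ` (\<Union>j\<in>underS r i. ?S j))"
            using c unfolding centralizing_def engel_elements_def by blast
        qed
        then show ?thesis using upper_series_limit[OF r 1(2) ne False, of NR_radical G] by simp
      qed
    qed
  qed
  have "carrier G = (\<Union>i\<in>Field r. ?S i)" using NR unfolding upper_radical_def r_def by simp
  then have "carrier H = (\<Union>i\<in>Field r. h ` ?S i)" using surj by (metis image_UN)
  then have "engel_elements H \<subseteq> centralizing H (carrier H)"
    using centr unfolding centralizing_def engel_elements_def by blast
  moreover have "carrier H \<inter> centralizing H (carrier H) = {\<one>\<^bsub>H\<^esub>}"
    using HP by (rule H.normal_Int_centralizing_trivial) (rule H.normal_self)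
  ultimately show ?thesis unfolding centralizing_def by blast
qed

end

section \<open>Quasi-nil elements\<close>

text \<open>Winning positions of the game behind \<open>quasi_nil\<close>: with \<open>k\<close> moves left, the opponent
  chooses \<open>a\<close>, and the answer \<open>n\<close> replaces \<open>g\<close> by \<open>e\<^sub>n(a, g)\<close>; the aim is to reach \<open>1\<close>.\<close>

primrec quasi_nil_level :: "('a, 'b) monoid_scheme \<Rightarrow> nat \<Rightarrow> 'a set" where
  "quasi_nil_level G 0 = {\<one>\<^bsub>G\<^esub>}"
| "quasi_nil_level G (Suc k) =
     {g \<in> carrier G. \<forall>a\<in>carrier G. \<exists>n\<ge>1. engel_word G n a g \<in> quasi_nil_level G k}"

text \<open>\<open>eps_word\<close> unfolds at the last move, whereas the game is analysed by its
  first move.\<close>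

lemma eps_word_Suc_left:
  "eps_word G n x y (Suc i) =
     eps_word G (\<lambda>i. n (Suc i)) (\<lambda>i. x (Suc i)) (engel_word G (n 0) (x 0) y) i"
  by (induction i) simp_all

lemma eps_word_cong:
  "(\<And>i. i < k \<Longrightarrow> n i = n' i) \<Longrightarrow> eps_word G n x y k = eps_word G n' x y k"
  by (induction k) simp_all

context group
begin

text \<open>N is read as a strategy: the answer to an opening a is N [a], and N (a # as), as a
  function of as, is a strategy for the remaining game.\<close>

lemma quasi_nil_strategy_imp_level:
  assumes "\<forall>as\<in>lists (carrier G). 1 \<le> N as" "g \<in> carrier G"
    "\<forall>as\<in>lists (carrier G). length as = k \<longrightarrow>
       eps_word G (\<lambda>i. N (take (Suc i) as)) (\<lambda>i. as ! i) g k = \<one>"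
  shows "g \<in> quasi_nil_level G k"
  using assms
proof (induction k arbitrary: N g)
  case 0
  then show ?case by auto
next
  case (Suc k)
  have "engel_word G (N [a]) a g \<in> quasi_nil_level G k" if a: "a \<in> carrier G" for a
  proof (rule Suc.IH)
    show "\<forall>as\<in>lists (carrier G). 1 \<le> N (a # as)" using Suc.prems(1) a by simp
    show "engel_word G (N [a]) a g \<in> carrier G" using a Suc.prems(2) by simp
    show "\<forall>as\<in>lists (carrier G). length as = k \<longrightarrow>
        eps_word G (\<lambda>i. N (a # take (Suc i) as)) (\<lambda>i. as ! i) (engel_word G (N [a]) a g) k = \<one>"
    proof (intro ballI impI)
      fix as assume "as \<in> lists (carrier G)" "length as = k"
      then have "eps_word G (\<lambda>i. N (take (Suc i) (a # as))) (\<lambda>i. (a # as) ! i) g (Suc k) = \<one>"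
        using Suc.prems(3) a by (simp del: eps_word.simps take_Suc_Cons)
      then show "eps_word G (\<lambda>i. N (a # take (Suc i) as)) (\<lambda>i. as ! i) (engel_word G (N [a]) a g) k = \<one>"
        by (simp add: eps_word_Suc_left del: eps_word.simps)
    qed
  qed
  moreover have "1 \<le> N [a]" if "a \<in> carrier G" for a using Suc.prems(1) that by simp
  ultimately show ?case using Suc.prems(2) by auto
qed

lemma quasi_nil_level_imp_strategy:
  assumes "g \<in> quasi_nil_level G k"
  shows "\<exists>N. (\<forall>as\<in>lists (carrier G). 1 \<le> N as) \<and>
    (\<forall>as\<in>lists (carrier G). length as = k \<longrightarrow>
       eps_word G (\<lambda>i. N (take (Suc i) as)) (\<lambda>i. as ! i) g k = \<one>)"
  using assms
proof (induction k arbitrary: g)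
  case 0
  then show ?case by (intro exI[of _ "\<lambda>_. 1"]) simp
next
  case (Suc k)
  then have "\<forall>a\<in>carrier G. \<exists>n\<ge>1. engel_word G n a g \<in> quasi_nil_level G k" by simp
  then obtain n where n: "\<And>a. a \<in> carrier G \<Longrightarrow> 1 \<le> n a \<and> engel_word G (n a) a g \<in> quasi_nil_level G k"
    by metis
  then have "\<forall>a\<in>carrier G. \<exists>N. (\<forall>as\<in>lists (carrier G). 1 \<le> N as) \<and>
      (\<forall>as\<in>lists (carrier G). length as = k \<longrightarrow>
        eps_word G (\<lambda>i. N (take (Suc i) as)) (\<lambda>i. as ! i) (engel_word G (n a) a g) k = \<one>)"
    using Suc.IH by blast
  then obtain N where N: "\<And>a. a \<in> carrier G \<Longrightarrow> (\<forall>as\<in>lists (carrier G). 1 \<le> N a as) \<and>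
      (\<forall>as\<in>lists (carrier G). length as = k \<longrightarrow>
        eps_word G (\<lambda>i. N a (take (Suc i) as)) (\<lambda>i. as ! i) (engel_word G (n a) a g) k = \<one>)"
    by metis
  \<comment> \<open>The chosen answers and continuations are glued along the head of the list. The
    value 1 at the empty list is a filler: every queried prefix has length at least 1.\<close>
  define N' where "N' as = (case as of [] \<Rightarrow> 1 | a # bs \<Rightarrow> if bs = [] then n a else N a bs)" for as
  have "1 \<le> N' as" if "as \<in> lists (carrier G)" for as
    using that n N unfolding N'_def by (cases as) auto
  moreover have "eps_word G (\<lambda>i. N' (take (Suc i) as)) (\<lambda>i. as ! i) g (Suc k) = \<one>"
    if as: "as \<in> lists (carrier G)" "length as = Suc k" for as
  proof -
    obtain a bs where ab: "as = a # bs" "a \<in> carrier G" "bs \<in> lists (carrier G)" "length bs = k"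
      using as by (cases as) auto
    have "eps_word G (\<lambda>i. N' (take (Suc i) as)) (\<lambda>i. as ! i) g (Suc k)
        = eps_word G (\<lambda>i. N' (a # take (Suc i) bs)) (\<lambda>i. bs ! i) (engel_word G (n a) a g) k"
      unfolding ab(1) eps_word_Suc_left by (simp add: N'_def)
    also have "\<dots> = eps_word G (\<lambda>i. N a (take (Suc i) bs)) (\<lambda>i. bs ! i) (engel_word G (n a) a g) k"
      using ab(4) by (intro eps_word_cong) (auto simp: N'_def)
    finally show ?thesis using N[OF ab(2)] ab(3,4) by simp
  qed
  ultimately show ?case by blast
qed

lemma quasi_nil_iff_level:
  assumes "g \<in> carrier G"
  shows "quasi_nil G g \<longleftrightarrow> (\<exists>k\<ge>1. g \<in> quasi_nil_level G k)"
proof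
  assume "quasi_nil G g"
  then show "\<exists>k\<ge>1. g \<in> quasi_nil_level G k"
    unfolding quasi_nil_def using quasi_nil_strategy_imp_level[OF _ assms] by blast
next
  assume "\<exists>k\<ge>1. g \<in> quasi_nil_level G k"
  then show "quasi_nil G g"
    unfolding quasi_nil_def using quasi_nil_level_imp_strategy by blast
qed

text \<open>The element a is arbitrary, but [a, g] lies in the radical by normality, so the span of
  [a, g] and g is nilpotent. The extra first commutator also gives the exponent n + 1 \<ge>
  1.\<close>

lemma HP_radical_engel:
  assumes g: "g \<in> HP_radical G" and a: "a \<in> carrier G"
  shows "\<exists>n\<ge>1. engel_word G n a g = \<one>"
proof -
  have sR: "subgroup (HP_radical G) G" by (rule normal_imp_subgroup[OF normal_HP_radical])
  have gc: "g \<in> carrier G" using g by (rule subgroup.mem_carrier[OF sR])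
  let ?b = "commutator G a g"
  have "a \<in> normalizing G (HP_radical G)"
    using a normal_HP_radical by (auto simp: normal_iff_normalizing)
  then have "commutator G g a \<in> HP_radical G" using g by (intro commutator_in_normalized[OF sR])
  then have "inv (commutator G g a) \<in> HP_radical G" by (rule subgroup.m_inv_closed[OF sR])
  then have b: "?b \<in> HP_radical G" using a gc by (simp add: inv_commutator)
  define N where "N = generate G {?b, g}"
  have "nilpotent_subgroup G N"
    using locally_nilpotent_HP_radical b g
    unfolding locally_nilpotent_subgroup_def N_def by simp
  then obtain n where sN: "subgroup N G" and n: "N \<subseteq> upper_central G N n"
    by (auto simp: nilpotent_subgroup_def)
  have bg: "?b \<in> N" "g \<in> N" unfolding N_def by (auto intro: generate.incl)
  have "i \<le> n \<Longrightarrow> engel_word G i ?b g \<in> upper_central G N (n - i)" for i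
  proof (induction i)
    case 0
    then show ?case using n bg(1) by auto
  next
    case (Suc i)
    then have "engel_word G i ?b g \<in> upper_central G N (Suc (n - Suc i))"
      by (simp add: Suc_diff_Suc del: upper_central.simps)
    then show ?case using bg(2) by simp
  qed
  from this[of n] have "engel_word G (Suc n) a g = \<one>"
    using engel_word_commutator[of n a g] by (simp del: engel_word.simps)
  then show ?thesis by (intro exI[of _ "Suc n"]) simp
qed

lemma upper_series_subset_quasi_nil_level:
  "upper_series HP_radical G natLeq k \<subseteq> quasi_nil_level G k"
proof (induction k)
  case 0
  then show ?case by (simp add: upper_series_nat)
next
  case (Suc k)
  let ?R = "upper_series HP_radical G natLeq k"
  have R: "?R \<lhd> G" by (rule upper_series_nat_normal) (rule group.normal_HP_radical)
  interpret quot: group_hom G "G Mod ?R" "\<lambda>x. ?R #> x" by (rule quotient_hom[OF R])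
  show ?case
  proof
    fix g assume "g \<in> upper_series HP_radical G natLeq (Suc k)"
    then have g: "g \<in> carrier G" "?R #> g \<in> HP_radical (G Mod ?R)"
      by (auto simp: upper_series_nat radical_step_def)
    have "\<exists>n\<ge>1. engel_word G n a g \<in> quasi_nil_level G k" if a: "a \<in> carrier G" for a
    proof -
      obtain n where n: "n \<ge> 1" "engel_word (G Mod ?R) n (?R #> a) (?R #> g) = \<one>\<^bsub>G Mod ?R\<^esub>"
        using quot.H.HP_radical_engel[OF g(2) quot.hom_closed[OF a]] by blast
      then have "?R #> engel_word G n a g = ?R"
        using quot.hom_engel_word[OF a g(1)] by simp
      then have "engel_word G n a g \<in> ?R"
        using a g(1) by (intro coset_join1[OF _ _ normal_imp_subgroup[OF R]]) auto
      then show ?thesis using n(1) Suc by blast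
    qed
    then show "g \<in> quasi_nil_level G (Suc k)" using g(1) by simp
  qed
qed

text \<open>Stability of R says that G/R has trivial radical. By the induction hypothesis, reaching
  level k means becoming trivial modulo R, so level k + 1 consists of elements whose images are
  Engel.\<close>

lemma quasi_nil_level_subset:
  assumes R: "R \<lhd> G" and stable: "radical_step HP_radical G R = R"
    and NR: "upper_radical NR_radical G = carrier G"
  shows "quasi_nil_level G k \<subseteq> R"
proof (induction k)
  case 0
  then show ?case using subgroup.one_closed[OF normal_imp_subgroup[OF R]] by simp
next
  case (Suc k)
  have sR: "subgroup R G" by (rule normal_imp_subgroup[OF R])
  interpret quot: group_hom G "G Mod R" "\<lambda>x. R #> x" by (rule quotient_hom[OF R])
  have surj: "(\<lambda>x. R #> x) ` carrier G = carrier (G Mod R)" by (simp add: carrier_FactGroup)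
  have sHP: "subgroup (HP_radical (G Mod R)) (G Mod R)"
    by (rule normal_imp_subgroup[OF quot.H.normal_HP_radical])
  have "c = R" if c: "c \<in> HP_radical (G Mod R)" for c
  proof -
    obtain x where x: "x \<in> carrier G" "c = R #> x"
      using subgroup.mem_carrier[OF sHP c] surj by blast
    then have "x \<in> radical_step HP_radical G R" using c by (simp add: radical_step_def)
    then show ?thesis using x coset_join2[OF x(1) sR] stable by simp
  qed
  then have HP: "HP_radical (G Mod R) = {\<one>\<^bsub>G Mod R\<^esub>}"
    using subgroup.one_closed[OF sHP] by auto
  show ?case
  proof
    fix g assume g: "g \<in> quasi_nil_level G (Suc k)"
    then have gc: "g \<in> carrier G" by simp
    have "R #> g \<in> engel_elements (G Mod R)"
      unfolding engel_elements_def
    proof (intro CollectI conjI ballI)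
      show "R #> g \<in> carrier (G Mod R)" using gc by (rule quot.hom_closed)
      fix c assume "c \<in> carrier (G Mod R)"
      then obtain a where a: "a \<in> carrier G" "c = R #> a" using surj by blast
      then have "\<exists>n\<ge>1. engel_word G n a g \<in> quasi_nil_level G k" using g by simp
      then obtain n where "engel_word G n a g \<in> R" using Suc by blast
      then have "R #> engel_word G n a g = R" using a gc by (intro coset_join2[OF _ sR]) auto
      then show "\<exists>n. engel_word (G Mod R) n c (R #> g) = \<one>\<^bsub>G Mod R\<^esub>"
        using quot.hom_engel_word[OF a(1) gc] a(2) by auto
    qed
    then have "R #> g = R" using quot.engel_trivial[OF surj HP NR] by auto
    then show "g \<in> R" using gc sR by (rule coset_join1)
  qed
qed

end

theorem theorem4:
  fixes G (structure)
  assumes "group G"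
    and "upper_radical NR_radical G = carrier G"
    and "\<exists>k. upper_series HP_radical G natLeq k = upper_series HP_radical G natLeq (Suc k) \<and>
             upper_series HP_radical G natLeq (Suc k) = upper_radical HP_radical G"
  shows "upper_radical HP_radical G = {g \<in> carrier G. quasi_nil G g}"
proof -
  interpret group G by fact
  obtain k where k: "upper_series HP_radical G natLeq k = upper_series HP_radical G natLeq (Suc k)"
    "upper_series HP_radical G natLeq (Suc k) = upper_radical HP_radical G"
    using assms(3) by blast
  let ?R = "upper_series HP_radical G natLeq k"
  have R: "?R \<lhd> G" by (rule upper_series_nat_normal) (rule group.normal_HP_radical)
  have stable: "radical_step HP_radical G ?R = ?R" using k(1) by (simp add: upper_series_nat)
  have "g \<in> ?R \<longleftrightarrow> g \<in> carrier G \<and> quasi_nil G g" for g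
  proof
    assume g: "g \<in> ?R"
    then have gc: "g \<in> carrier G" using subgroup.mem_carrier[OF normal_imp_subgroup[OF R]] by blast
    \<comment> \<open>The parameter must be positive while k may be 0; stationarity of the series
      allows the passage to k + 1.\<close>
    have "g \<in> quasi_nil_level G (Suc k)"
      using g k(1) upper_series_subset_quasi_nil_level[of "Suc k"] by blast
    then have "quasi_nil G g"
      unfolding quasi_nil_iff_level[OF gc] by (intro exI[of _ "Suc k"]) simp
    then show "g \<in> carrier G \<and> quasi_nil G g" using gc by simp
  next
    assume g: "g \<in> carrier G \<and> quasi_nil G g"
    then show "g \<in> ?R"
      using quasi_nil_iff_level quasi_nil_level_subset[OF R stable assms(2)] by blast
  qed
  then show ?thesis using k by blast
qed

end
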